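(* Let $n,n'$ be positive integers, let $q$ be a prime power, and let $V=\mathbb{F}^{n+n'}$ be a vector space over the finite field $\mathbb{F}$ equipped with a form, where one of the following three cases holds. (Unitary) $\mathbb{F}=\mathbb{F}_{q^2}$, the form is a non-degenerate hermitian form, $q\ge 2$, $n,n'\ge 1$, $(n,n',q)\neq(1,1,2)$, and $c=\frac{9}{5}$. Let $\mathcal{U}$ (resp. $\mathcal{U}'$) be the set of all non-degenerate $n$-subspaces (resp. $n'$-subspaces) of $V$. (Symplectic) $\mathbb{F}=\mathbb{F}_{q}$, the form is a non-degenerate alternating form, $q\ge 2$, $n,n'\ge 2$ are both even, and $c=\frac{5}{3}$. Let $\mathcal{U}$ (resp. $\mathcal{U}'$) be the set of all non-degenerate $n$-subspaces (resp. $n'$-subspaces) of $V$. (Orthogonal) $\mathbb{F}=\mathbb{F}_{q}$, the form is a non-degenerate quadratic form, $q\ge 3$, $n,n'\ge 1$, $(n,n',q)\neq(1,1,3)$, $q$ is odd if one of $n,n'$ is odd, and $c=\frac{43}{16}$. Let $\sigma,\sigma'\in\{-,+\}$ be given subspace types, and let $\mathcal{U}$ (resp. $\mathcal{U}'$) be the set of all non-degenerate $n$-subspaces of $V$ of subspace type $\sigma$ (resp. non-degenerate $n'$-subspaces of $V$ of subspace type $\sigma'$). Then, in each case, the proportion $$\frac{|\{(U,U')\in\mathcal{U}\times\mathcal{U}' : U+U'=V\}|}{|\mathcal{U}\times\mathcal{U}'|}$$ is positive and at least $1-\dfrac{c}{|\mathbb{F}|}$.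
   Context: A subspace is non-degenerate if the restriction of the form to it is non-degenerate. In the orthogonal case let $Q$ be the quadratic form and $\beta(u,v)=Q(u+v)-Q(u)-Q(v)$ its polar form; $\perp$ is taken with respect to $\beta$. Non-degeneracy of a (sub)space $X$ means that $\{u\in X: Q(u)=0,\ \beta(u,v)=0\ \forall v\in X\}=\{0\}$; it is moreover assumed that $\{u\in X:\beta(u,v)=0\ \forall v\in X\}=\{0\}$ for $X=V,U,U'$ (under the parity assumption on $q$ this is automatic). The isometry type of a non-degenerate orthogonal space of even dimension $2k$ is $+$ (hyperbolic) if its Witt index is $k$ and $-$ (elliptic) if its Witt index is $k-1$; odd-dimensional spaces have isometry type $\circ$ (parabolic). For $q$ odd and $X$ non-degenerate, $\delta(X)=1$ if a Gram matrix of $\beta|_X$ has square determinant, and $\delta(X)=-1$ if it has non-square determinant. The subspace type $\sigma\in\{-,+\}$ (identified with $\{-1,1\}$) of a non-degenerate subspace $U$ of $V$ is: the isometry type of $Q|_{U}$ if $\dim U$ is even; the isometry type of $Q|_{U^\perp}$ if $\dim U$ is odd and $\dim U^\perp$ is even; and $\delta(U)$ if both $\dim U$ and $\dim U^\perp$ are odd. *)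

theory Defs
  imports
    "Jordan_Normal_Form.Determinant"
    "HOL-Number_Theory.Prime_Powers"
    "HOL-Analysis.Analysis"
begin

text \<open>The vector space is the coordinate space \<open>'a ^ 'd\<close> over a finite field \<open>'a\<close>; its subspaces and
  their dimension are \<open>vec.subspace\<close> and \<open>vec.dim\<close>, and forms are plain functions.\<close>

subsection \<open>Hermitian and alternating forms\<close>

text \<open>Over the field with \<open>q\<^sup>2\<close> elements, \<open>x \<mapsto> x ^ q\<close> is the automorphism of order 2. Additivity
  and semilinearity in the second argument follow from the two conditions.\<close>

definition hermitian_form ::
    "nat \<Rightarrow> ('a::field ^ 'd \<Rightarrow> 'a ^ 'd \<Rightarrow> 'a) \<Rightarrow> bool" where
  "hermitian_form q B \<longleftrightarrow>
     (\<forall>v. Vector_Spaces.linear (*s) (*) (\<lambda>u. B u v)) \<and>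
     (\<forall>u v. B v u = B u v ^ q)"

definition bilinear_form :: "('a::field ^ 'd \<Rightarrow> 'a ^ 'd \<Rightarrow> 'a) \<Rightarrow> bool" where
  "bilinear_form B \<longleftrightarrow>
     (\<forall>v. Vector_Spaces.linear (*s) (*) (\<lambda>u. B u v)) \<and>
     (\<forall>u. Vector_Spaces.linear (*s) (*) (\<lambda>v. B u v))"

definition alternating_form :: "('a::field ^ 'd \<Rightarrow> 'a ^ 'd \<Rightarrow> 'a) \<Rightarrow> bool" where
  "alternating_form B \<longleftrightarrow> bilinear_form B \<and> (\<forall>u. B u u = 0)"

definition nondegenerate_on ::
    "('a::field ^ 'd \<Rightarrow> 'a ^ 'd \<Rightarrow> 'a) \<Rightarrow> ('a ^ 'd) set \<Rightarrow> bool" where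
  "nondegenerate_on B X \<longleftrightarrow> {u \<in> X. \<forall>v\<in>X. B u v = 0} = {0}"

definition nondegenerate_subspaces ::
    "('a::field ^ 'd \<Rightarrow> 'a ^ 'd \<Rightarrow> 'a) \<Rightarrow> nat \<Rightarrow> ('a ^ 'd) set set" where
  "nondegenerate_subspaces B n =
     {U. vec.subspace U \<and> vec.dim U = n \<and> nondegenerate_on B U}"

subsection \<open>Quadratic forms\<close>

definition polar_form :: "('a::field ^ 'd \<Rightarrow> 'a) \<Rightarrow> 'a ^ 'd \<Rightarrow> 'a ^ 'd \<Rightarrow> 'a" where
  "polar_form Q u v = Q (u + v) - Q u - Q v"

definition quadratic_form :: "('a::field ^ 'd \<Rightarrow> 'a) \<Rightarrow> bool" where
  "quadratic_form Q \<longleftrightarrow>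
     (\<forall>c u. Q (c *s u) = c\<^sup>2 * Q u) \<and> bilinear_form (polar_form Q)"

text \<open>The first conjunct is non-degeneracy of the quadratic form. The second one, non-degeneracy of
  the polar form, is stronger only in odd dimension over fields of characteristic 2.\<close>

definition nondegenerate_quadratic_on ::
    "('a::field ^ 'd \<Rightarrow> 'a) \<Rightarrow> ('a ^ 'd) set \<Rightarrow> bool" where
  "nondegenerate_quadratic_on Q X \<longleftrightarrow>
     {u \<in> X. Q u = 0 \<and> (\<forall>v\<in>X. polar_form Q u v = 0)} = {0} \<and>
     nondegenerate_on (polar_form Q) X"

definition perp :: "('a::field ^ 'd \<Rightarrow> 'a) \<Rightarrow> ('a ^ 'd) set \<Rightarrow> ('a ^ 'd) set" where
  "perp Q U = {v. \<forall>u\<in>U. polar_form Q u v = 0}"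

definition witt_index :: "('a::{field,finite} ^ 'd \<Rightarrow> 'a) \<Rightarrow> ('a ^ 'd) set \<Rightarrow> nat" where
  "witt_index Q X = Max {vec.dim S |S. vec.subspace S \<and> S \<subseteq> X \<and> (\<forall>u\<in>S. Q u = 0)}"

subsection \<open>Subspace types\<close>

datatype space_sign = Plus | Minus

text \<open>Isometry types of even-dimensional spaces: \<open>Plus\<close> is hyperbolic, \<open>Minus\<close> is elliptic.\<close>

definition has_isometry_type ::
    "('a::{field,finite} ^ 'd \<Rightarrow> 'a) \<Rightarrow> ('a ^ 'd) set \<Rightarrow> space_sign \<Rightarrow> bool" where
  "has_isometry_type Q X \<sigma> \<longleftrightarrow>
     (\<exists>k. vec.dim X = 2 * k \<and>
        (case \<sigma> of Plus \<Rightarrow> witt_index Q X = k | Minus \<Rightarrow> witt_index Q X + 1 = k))"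

definition is_basis_list :: "('a::field ^ 'd) list \<Rightarrow> ('a ^ 'd) set \<Rightarrow> bool" where
  "is_basis_list bs X \<longleftrightarrow>
     distinct bs \<and> vec.independent (set bs) \<and> vec.span (set bs) = X"

definition gram_matrix :: "('a::field ^ 'd \<Rightarrow> 'a) \<Rightarrow> ('a ^ 'd) list \<Rightarrow> 'a mat" where
  "gram_matrix Q bs =
     Matrix.mat (length bs) (length bs) (\<lambda>(i, j). polar_form Q (bs ! i) (bs ! j))"

text \<open>\<open>\<delta>(X) = \<plusminus>1\<close>. A change of basis multiplies the determinant by a nonzero square, so the choice of
  the basis does not matter.\<close>

definition has_discriminant_type ::
    "('a::field ^ 'd \<Rightarrow> 'a) \<Rightarrow> ('a ^ 'd) set \<Rightarrow> space_sign \<Rightarrow> bool" where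
  "has_discriminant_type Q X \<sigma> \<longleftrightarrow>
     (\<exists>bs. is_basis_list bs X \<and>
        (case \<sigma> of
           Plus \<Rightarrow> (\<exists>a. Determinant.det (gram_matrix Q bs) = a\<^sup>2)
         | Minus \<Rightarrow> (\<nexists>a. Determinant.det (gram_matrix Q bs) = a\<^sup>2)))"

definition has_subspace_type ::
    "('a::{field,finite} ^ 'd \<Rightarrow> 'a) \<Rightarrow> ('a ^ 'd) set \<Rightarrow> space_sign \<Rightarrow> bool" where
  "has_subspace_type Q U \<sigma> \<longleftrightarrow>
     (if even (vec.dim U) then has_isometry_type Q U \<sigma>
      else if even (vec.dim (perp Q U)) then has_isometry_type Q (perp Q U) \<sigma>
      else has_discriminant_type Q U \<sigma>)"

definition nondegenerate_subspaces_of_type ::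
    "('a::{field,finite} ^ 'd \<Rightarrow> 'a) \<Rightarrow> nat \<Rightarrow> space_sign \<Rightarrow> ('a ^ 'd) set set" where
  "nondegenerate_subspaces_of_type Q n \<sigma> =
     {U. vec.subspace U \<and> vec.dim U = n \<and> nondegenerate_quadratic_on Q U \<and>
         has_subspace_type Q U \<sigma>}"

end

theory Submission
  imports Defs "HOL-Number_Theory.Residues"
begin

text \<open>The subspaces \<open>U\<close> and \<open>U'\<close> have complementary dimensions, so \<open>U + U' = V\<close> means that they meet trivially.

  In the unitary and orthogonal cases the proportion of pairs with a common nonzero vector is bounded by the
  expected number of common points. As the isometry group is transitive on the nonzero vectors of equal norm
  (by reflections), the probability that a random \<open>U'\<close> contains a vector of norm \<open>a\<close> is the average of
  \<open>t(U', a) / t(V, a)\<close>, where \<open>t(X, a)\<close> is the number of nonzero vectors of norm \<open>a\<close> in \<open>X\<close>. These numbers are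
  computed by splitting off nonisotropic lines or hyperbolic planes. It is enough to bound the ratio for the
  larger of the two dimensions, and \<open>a \<noteq> 0\<close> if the smaller one is 1.

  In the symplectic case the union bound fails for \<open>q = 2\<close>. There \<open>U'\<close> is built from orthogonal hyperbolic
  pairs, which for fixed \<open>U\<close> bounds the proportion below by
  \<open>(1 - 1/q) (1 - 1/q\<^sup>2) \<dots> \<ge> 1 - 1/q - 1/q\<^sup>2 \<ge> 1 - 5/(3q)\<close>.\<close>

section \<open>Subspaces over finite fields and reflexive forms\<close>

text \<open>A subspace U of dimension l has about |F|^l / (|F| - 1) points, and a random
  complementary-dimensional U' passes through each of them with probability about |F|^(-l). The
  expected number of common points is therefore close to 1/(|F| - 1) in every dimension. The
  constant c pays for |F| - 1 in place of |F| and for the uneven sizes of the level sets. The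
  unevenness is strongest in the smallest dimensions, so a few of these are computed by hand, and it
  is relatively weaker in the larger subspace, so that one is averaged over. In each case c is below
  the least admissible |F| (4, 2 and 3 respectively), which yields positivity.

  For alternating forms over two elements all nonzero vectors are alike and the expectation is (2^n
  - 1)(2^n' - 1)/(2^(n+n') - 1). It approaches 1, while 5/6 is required, so trivial intersection has
  to be counted directly there.\<close>

lemma card_span_independent:
  fixes S :: "('a::{field,finite} ^ 'd) set"
  assumes "finite S" "vec.independent S"
  shows "card (vec.span S) = CARD('a) ^ card S"
  using assms
proof (induction S rule: finite_induct)
  case empty
  then show ?case by simp
next
  case (insert a S)
  then have ind: "vec.independent S" and a: "a \<notin> vec.span S"
    using vec.independent_insert[of a S] by simp_all
  let ?f = "\<lambda>(k, s). k *s a + s"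
  have "bij_betw ?f (UNIV \<times> vec.span S) (vec.span (insert a S))"
  proof (rule bij_betw_imageI)
    show "inj_on ?f (UNIV \<times> vec.span S)"
    proof (clarsimp simp: inj_on_def)
      fix k s l t assume s: "s \<in> vec.span S" "t \<in> vec.span S" and eq: "k *s a + s = l *s a + t"
      have "(k - l) *s a = t - s"
        using eq by (simp add: vec.scale_left_diff_distrib algebra_simps)
      then have "(k - l) *s a \<in> vec.span S"
        using s by (simp add: vec.span_diff)
      then have "inverse (k - l) *s ((k - l) *s a) \<in> vec.span S" by (rule vec.span_scale)
      then have *: "(inverse (k - l) * (k - l)) *s a \<in> vec.span S"
        by (simp only: vec.scale_scale)
      have "k = l"
      proof (rule ccontr)
        assume "k \<noteq> l"
        then have "inverse (k - l) * (k - l) = 1" by simp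
        with * a show False by (simp only: vec.scale_one)
      qed
      then show "k = l \<and> s = t" using eq by simp
    qed
    show "?f ` (UNIV \<times> vec.span S) = vec.span (insert a S)"
    proof (intro equalityI subsetI)
      fix x assume "x \<in> ?f ` (UNIV \<times> vec.span S)"
      then obtain k s where "x = k *s a + s" "s \<in> vec.span S" by auto
      then have "x - k *s a \<in> vec.span S" by simp
      then show "x \<in> vec.span (insert a S)" by (auto simp: vec.span_insert)
    next
      fix x assume "x \<in> vec.span (insert a S)"
      then obtain k where k: "x - k *s a \<in> vec.span S" by (auto simp: vec.span_insert)
      have "x = ?f (k, x - k *s a)" by simp
      then show "x \<in> ?f ` (UNIV \<times> vec.span S)" using k by blast
    qed
  qed
  from bij_betw_same_card[OF this] show ?case
    using insert ind by (simp add: card_cartesian_product)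
qed

lemma card_subspace:
  fixes X :: "('a::{field,finite} ^ 'd) set"
  assumes "vec.subspace X"
  shows "card X = CARD('a) ^ vec.dim X"
proof -
  obtain S where S: "S \<subseteq> X" "vec.independent S" "X \<subseteq> vec.span S" "card S = vec.dim X"
    using vec.basis_exists by blast
  have "vec.span S = X"
    using S assms vec.span_minimal by blast
  with card_span_independent[of S] S vec.finiteI_independent show ?thesis by metis
qed

lemma one_less_CARD_field: "1 < CARD('a::{field,finite})"
proof -
  have "card {0, 1 :: 'a} \<le> CARD('a)" by (intro card_mono) auto
  then show ?thesis by simp
qed

text \<open>Counting replaces rank arguments: the dimensions of orthogonal complements and of images
  under isometries are read off from their cardinalities.\<close>

lemma dim_eq_of_card_eq:
  fixes X :: "('a::{field,finite} ^ 'd) set"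
  assumes "vec.subspace X" "card X = CARD('a) ^ k"
  shows "vec.dim X = k"
  using card_subspace[OF assms(1)] assms(2) one_less_CARD_field[where 'a='a]
  by (simp add: power_inject_exp)

lemma subspace_eq_zero_of_dim:
  fixes X :: "('a::{field,finite} ^ 'd) set"
  assumes "vec.subspace X" "vec.dim X = 0"
  shows "X = {0}"
  using assms vec.dim_eq_0 vec.subspace_0 by blast

lemma card_nonzero_subspace:
  fixes X :: "('a::{field,finite} ^ 'd) set"
  assumes "vec.subspace X"
  shows "card (X - {0}) = CARD('a) ^ vec.dim X - 1"
  using card_subspace[OF assms] vec.subspace_0[OF assms] by simp

lemma card_fiber:
  fixes X :: "('a::{field,finite} ^ 'd) set" and \<phi> :: "'a ^ 'd \<Rightarrow> 'b::ab_group_add"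
  assumes X: "vec.subspace X" and add: "\<And>x y. \<phi> (x + y) = \<phi> x + \<phi> y" and x0: "x0 \<in> X"
  shows "card {x \<in> X. \<phi> x = \<phi> x0} = card {x \<in> X. \<phi> x = 0}"
proof -
  have "bij_betw (\<lambda>x. x + x0) {x \<in> X. \<phi> x = 0} {x \<in> X. \<phi> x = \<phi> x0}"
  proof (rule bij_betw_byWitness[where f' = "\<lambda>x. x - x0"])
    have "\<phi> (x - x0) = \<phi> x - \<phi> x0" for x
      using add[of "x - x0" x0] by simp
    then show "(\<lambda>x. x - x0) ` {x \<in> X. \<phi> x = \<phi> x0} \<subseteq> {x \<in> X. \<phi> x = 0}"
      using vec.subspace_diff[OF X _ x0] by auto
    show "(\<lambda>x. x + x0) ` {x \<in> X. \<phi> x = 0} \<subseteq> {x \<in> X. \<phi> x = \<phi> x0}"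
      using vec.subspace_add[OF X _ x0] by (auto simp: add)
  qed auto
  from bij_betw_same_card[OF this] show ?thesis by (rule sym)
qed

text \<open>Multiples of \<open>x0\<close> attain every value, so all fibres are translates of the
  kernel and equally large.\<close>

lemma card_fiber_linear:
  fixes X :: "('a::{field,finite} ^ 'd) set" and \<phi> :: "'a ^ 'd \<Rightarrow> 'a"
  assumes X: "vec.subspace X" and add: "\<And>x y. \<phi> (x + y) = \<phi> x + \<phi> y"
    and scale: "\<And>c x. \<phi> (c *s x) = c * \<phi> x" and x0: "x0 \<in> X" "\<phi> x0 \<noteq> 0"
  shows "card {x \<in> X. \<phi> x = c} * CARD('a) = card X"
proof -
  have k: "card {x \<in> X. \<phi> x = c} = card {x \<in> X. \<phi> x = 0}" for c
    using card_fiber[OF X, of \<phi> "(c / \<phi> x0) *s x0"] add scale x0 X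
    by (simp add: vec.subspace_scale)
  have "card X = (\<Sum>c\<in>UNIV. card {x \<in> X. \<phi> x = c})"
    using sum.group[of X UNIV \<phi> "\<lambda>_. 1::nat"] by simp
  also have "\<dots> = CARD('a) * card {x \<in> X. \<phi> x = 0}"
    by (subst k) simp
  finally show ?thesis using k[of c] by simp
qed

lemma card_kernel_ge:
  fixes X :: "('a::{field,finite} ^ 'd) set" and \<phi> :: "'a ^ 'd \<Rightarrow> 'a"
  assumes X: "vec.subspace X" and add: "\<And>x y. \<phi> (x + y) = \<phi> x + \<phi> y"
    and scale: "\<And>c x. \<phi> (c *s x) = c * \<phi> x"
  shows "card X \<le> CARD('a) * card {x \<in> X. \<phi> x = 0}"
proof (cases "\<exists>x0\<in>X. \<phi> x0 \<noteq> 0")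
  case True
  then show ?thesis using card_fiber_linear[OF X add scale, of _ 0] by (auto simp: mult.commute)
next
  case False
  then have "{x \<in> X. \<phi> x = 0} = X" by auto
  then show ?thesis by simp
qed

lemma card_Sigma_swap:
  assumes "finite A" "finite C"
  shows "(\<Sum>a\<in>A. card {c \<in> C. R a c}) = (\<Sum>c\<in>C. card {a \<in> A. R a c})"
proof -
  have "(\<Sum>a\<in>A. card {c \<in> C. R a c}) = (\<Sum>a\<in>A. \<Sum>c\<in>C. if R a c then 1 else 0)"
    using assms by (simp add: sum.If_cases Int_def)
  also have "\<dots> = (\<Sum>c\<in>C. \<Sum>a\<in>A. if R a c then 1 else 0)" by (rule sum.swap)
  also have "\<dots> = (\<Sum>c\<in>C. card {a \<in> A. R a c})"
    using assms by (simp add: sum.If_cases Int_def)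
  finally show ?thesis .
qed

text \<open>Equality case of the pigeonhole bound. It turns root counts, which are only upper
  bounds, into exact fibre sizes once the total is known.\<close>

lemma eq_of_sum_ge:
  fixes f :: "'b \<Rightarrow> nat"
  assumes "finite A" "\<And>x. x \<in> A \<Longrightarrow> f x \<le> M" "card A * M \<le> sum f A" "x \<in> A"
  shows "f x = M"
proof (rule ccontr)
  assume "f x \<noteq> M"
  then have "sum f A < (\<Sum>x\<in>A. M)"
    using assms by (intro sum_strict_mono_ex1) (auto simp: le_less)
  then show False using assms(3) by simp
qed

text \<open>One polynomial shape serves several equations: norms and squares (\<open>c = 0\<close>),
  the fixed field of the involution (\<open>c = 1\<close>) and the kernel of the trace
  (\<open>c = -1\<close>).\<close>

lemma card_power_eq_linear_le:
  fixes c t :: "'a::field"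
  assumes "n > 1"
  shows "card {x. x ^ n = c * x + t} \<le> n"
proof -
  let ?p = "Polynomial.monom 1 n - [:t, c:]"
  have "Polynomial.coeff ?p n = 1" using assms by (simp add: coeff_pCons split: nat.splits)
  then have "?p \<noteq> 0" by (intro notI) (simp only: Polynomial.coeff_0 zero_neq_one)
  moreover have "Polynomial.degree ?p \<le> n"
    using assms by (intro degree_diff_le) (auto intro: degree_monom_le)
  moreover have "{x. x ^ n = c * x + t} = {x. poly ?p x = 0}"
    by (simp add: poly_monom mult.commute add.commute)
  ultimately show ?thesis using card_poly_roots_bound[of ?p] by simp
qed

lemma span_pair: "vec.span {e, f :: 'a::field ^ 'd} = {x *s e + y *s f |x y. True}"
proof -
  have "vec.span {e, f} = {v. \<exists>x y. v - x *s e = y *s f}"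
    by (auto simp: vec.span_insert vec.span_singleton)
  also have "\<dots> = {x *s e + y *s f |x y. True}"
    by (auto simp: diff_eq_eq add.commute)
  finally show ?thesis .
qed

lemma span_pair_subset:
  fixes X :: "('a::field ^ 'd) set"
  assumes "vec.subspace X" "e \<in> X" "f \<in> X"
  shows "vec.span {e, f} \<subseteq> X"
  using assms by (intro vec.span_minimal) auto

lemma subset_sum_left: "vec.subspace Y \<Longrightarrow> Z \<subseteq> {z + y |z y. z \<in> Z \<and> y \<in> Y}"
  using vec.subspace_0 by (fastforce intro: add_0_right[symmetric])

lemma subset_sum_right: "vec.subspace Z \<Longrightarrow> Y \<subseteq> {z + y |z y. z \<in> Z \<and> y \<in> Y}"
  using vec.subspace_0 by (fastforce intro: add_0_left[symmetric])

text \<open>Common ground of the three kinds of form. In the second argument only additivity is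
  assumed, because a hermitian form is merely semilinear there; reflexivity makes orthogonality
  symmetric.\<close>

locale reflexive_form =
  fixes B :: "'a::{field,finite} ^ 'd \<Rightarrow> 'a ^ 'd \<Rightarrow> 'a"
  assumes add_left: "B (u + v) w = B u w + B v w"
    and scale_left: "B (c *s u) w = c * B u w"
    and add_right: "B u (v + w) = B u v + B u w"
    and reflexive: "B u v = 0 \<Longrightarrow> B v u = 0"
begin

lemma zero_left [simp]: "B 0 v = 0"
  using scale_left[of 0 0 v] by simp

lemma zero_right [simp]: "B v 0 = 0"
  using reflexive[of 0 v] by simp

lemma eq_0_commute: "B u v = 0 \<longleftrightarrow> B v u = 0"
  using reflexive by blast

lemma minus_left: "B (- u) v = - B u v"
  using scale_left[of "-1" u v] by simp

lemma diff_left: "B (u - v) w = B u w - B v w"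
  using add_left[of "u - v" v w] by simp

lemma diff_right: "B u (v - w) = B u v - B u w"
  using add_right[of u "v - w" w] by simp

lemma minus_right: "B u (- v) = - B u v"
  using diff_right[of u 0 v] by simp

text \<open>The ambient space is an argument because the inductions descend into orthogonal
  complements.\<close>

definition orth :: "('a ^ 'd) set \<Rightarrow> ('a ^ 'd) set \<Rightarrow> ('a ^ 'd) set" where
  "orth X Z = {x \<in> X. \<forall>z\<in>Z. B x z = 0}"

lemma orth_subset: "orth X Z \<subseteq> X"
  by (auto simp: orth_def)

lemma orthI: "x \<in> X \<Longrightarrow> (\<And>z. z \<in> Z \<Longrightarrow> B x z = 0) \<Longrightarrow> x \<in> orth X Z"
  by (simp add: orth_def)

lemma orthD:
  assumes "x \<in> orth X Z"
  shows "x \<in> X" "z \<in> Z \<Longrightarrow> B x z = 0"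
  using assms by (simp_all add: orth_def)

lemma subspace_orth:
  assumes "vec.subspace X"
  shows "vec.subspace (orth X Z)"
  using assms by (auto simp: orth_def vec.subspace_def add_left scale_left)

lemma orth_span: "orth X (vec.span S) = orth X S"
proof
  show "orth X (vec.span S) \<subseteq> orth X S"
    using vec.span_superset[of S] by (auto simp: orth_def)
  show "orth X S \<subseteq> orth X (vec.span S)"
  proof
    fix x assume x: "x \<in> orth X S"
    have "vec.span S \<subseteq> {v. B x v = 0}"
    proof (rule vec.span_minimal)
      show "S \<subseteq> {v. B x v = 0}" using x by (auto simp: orth_def)
      \<comment> \<open>Linearity is available on the left only, so the two arguments are exchanged
        by reflexivity.\<close>
      have "{v. B x v = 0} = {v. B v x = 0}" using eq_0_commute by blast
      then show "vec.subspace {v. B x v = 0}"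
        by (auto simp: vec.subspace_def add_left scale_left)
    qed
    then show "x \<in> orth X (vec.span S)" using x by (auto simp: orth_def)
  qed
qed

lemma card_orth_ge:
  assumes "finite S" "vec.subspace X"
  shows "card X \<le> CARD('a) ^ card S * card (orth X S)"
  using assms
proof (induction S arbitrary: X rule: finite_induct)
  case empty
  then show ?case by (simp add: orth_def)
next
  case (insert a S)
  let ?Y = "{x \<in> X. B x a = 0}"
  have "vec.subspace ?Y"
    using insert.prems by (auto simp: vec.subspace_def add_left scale_left)
  then have "card ?Y \<le> CARD('a) ^ card S * card (orth ?Y S)"
    by (rule insert.IH)
  moreover have "orth ?Y S = orth X (insert a S)" by (auto simp: orth_def)
  moreover have "card X \<le> CARD('a) * card ?Y"
    by (rule card_kernel_ge[OF insert.prems]) (simp_all add: add_left scale_left)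
  ultimately have "card X \<le> CARD('a) * (CARD('a) ^ card S * card (orth X (insert a S)))"
    using mult_le_mono2[of "card ?Y" _ "CARD('a)"] by (metis (no_types, lifting) order_trans)
  then show ?case using insert.hyps by (simp add: mult.assoc)
qed

lemma Int_orth:
  assumes "nondegenerate_on B Z"
  shows "Z \<inter> orth X Z \<subseteq> {0}"
  using assms unfolding nondegenerate_on_def orth_def by blast

text \<open>Uniqueness of the components is nondegeneracy of \<open>Z\<close>. Existence is a count:
  the conditions from a basis of \<open>Z\<close> leave at least \<open>card X / card Z\<close>
  vectors in \<open>orth X Z\<close>, so the image of the injective sum map fills
  \<open>X\<close>.\<close>

lemma orth_decomposition:
  assumes X: "vec.subspace X" and Z: "vec.subspace Z" "Z \<subseteq> X" "nondegenerate_on B Z"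
  shows "bij_betw (\<lambda>(z, y). z + y) (Z \<times> orth X Z) X"
proof -
  let ?f = "\<lambda>(z, y). z + y"
  have inj: "inj_on ?f (Z \<times> orth X Z)"
  proof (clarsimp simp: inj_on_def)
    fix z y z' y' assume h: "z \<in> Z" "z' \<in> Z" "y \<in> orth X Z" "y' \<in> orth X Z" "z + y = z' + y'"
    then have "z - z' = y' - y" by (simp add: algebra_simps)
    moreover have "z - z' \<in> Z" using h Z by (simp add: vec.subspace_diff)
    moreover have "y' - y \<in> orth X Z" using h subspace_orth[OF X] by (simp add: vec.subspace_diff)
    ultimately have "z - z' = 0" using Int_orth[OF Z(3)] by fastforce
    then show "z = z' \<and> y = y'" using h by simp
  qed
  have sub: "?f ` (Z \<times> orth X Z) \<subseteq> X"
    using Z(2) X orth_subset[of X Z] by (auto intro!: vec.subspace_add)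
  obtain S where S: "S \<subseteq> Z" "vec.independent S" "Z \<subseteq> vec.span S" "card S = vec.dim Z"
    using vec.basis_exists by blast
  have ZS: "vec.span S = Z" using S Z(1) vec.span_minimal by blast
  have fS: "finite S" using S vec.finiteI_independent by blast
  have "card X \<le> card Z * card (orth X Z)"
    using card_orth_ge[OF fS X] card_subspace[OF Z(1)] S(4) ZS orth_span by metis
  also have "\<dots> = card (?f ` (Z \<times> orth X Z))"
    using card_image[OF inj] by (simp add: card_cartesian_product)
  finally have "?f ` (Z \<times> orth X Z) = X"
    using sub by (metis card_seteq finite)
  then show ?thesis using inj by (simp add: bij_betw_def)
qed

lemma orth_decompose:
  assumes "vec.subspace X" "vec.subspace Z" "Z \<subseteq> X" "nondegenerate_on B Z" "x \<in> X"
  obtains z y where "z \<in> Z" "y \<in> orth X Z" "x = z + y"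
proof -
  have "x \<in> (\<lambda>(z, y). z + y) ` (Z \<times> orth X Z)"
    using bij_betw_imp_surj_on[OF orth_decomposition[OF assms(1-4)]] assms(5) by simp
  then show ?thesis using that by auto
qed

lemma dim_orth:
  assumes X: "vec.subspace X" and Z: "vec.subspace Z" "Z \<subseteq> X" "nondegenerate_on B Z"
  shows "vec.dim X = vec.dim Z + vec.dim (orth X Z)"
proof -
  have "card X = card Z * card (orth X Z)"
    using bij_betw_same_card[OF orth_decomposition[OF assms]] by (simp add: card_cartesian_product)
  then have "card X = CARD('a) ^ (vec.dim Z + vec.dim (orth X Z))"
    using card_subspace[OF Z(1)] card_subspace[OF subspace_orth[OF X]] by (simp add: power_add)
  then show ?thesis using dim_eq_of_card_eq[OF X] by blast
qed

lemma nondegenerate_onI: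
  assumes "vec.subspace X" "\<And>u. u \<in> X \<Longrightarrow> (\<And>v. v \<in> X \<Longrightarrow> B u v = 0) \<Longrightarrow> u = 0"
  shows "nondegenerate_on B X"
  using assms vec.subspace_0 unfolding nondegenerate_on_def by auto

lemma nondegenerate_onD:
  assumes "nondegenerate_on B X" "u \<in> X" "\<And>v. v \<in> X \<Longrightarrow> B u v = 0"
  shows "u = 0"
  using assms unfolding nondegenerate_on_def by blast

lemma nondegenerate_orth:
  assumes X: "vec.subspace X" "nondegenerate_on B X"
    and Z: "vec.subspace Z" "Z \<subseteq> X" "nondegenerate_on B Z"
  shows "nondegenerate_on B (orth X Z)"
proof (rule nondegenerate_onI[OF subspace_orth[OF X(1)]])
  fix u assume u: "u \<in> orth X Z" "\<And>v. v \<in> orth X Z \<Longrightarrow> B u v = 0"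
  show "u = 0"
  proof (rule nondegenerate_onD[OF X(2)])
    show "u \<in> X" using u orth_subset by blast
    fix v assume "v \<in> X"
    then obtain z y where "z \<in> Z" "y \<in> orth X Z" "v = z + y"
      using orth_decompose[OF X(1) Z] by blast
    then show "B u v = 0" using u by (simp add: add_right orth_def)
  qed
qed

lemma dim_sum_orthogonal:
  assumes Z: "vec.subspace Z" "nondegenerate_on B Z" and Y: "vec.subspace Y"
    and orth: "\<And>y z. y \<in> Y \<Longrightarrow> z \<in> Z \<Longrightarrow> B y z = 0"
  shows "vec.dim {z + y |z y. z \<in> Z \<and> y \<in> Y} = vec.dim Z + vec.dim Y"
proof -
  have "Z \<inter> Y \<subseteq> {0}"
    using nondegenerate_onD[OF Z(2)] orth by blast
  then have "vec.dim (Z \<inter> Y) = 0" using vec.dim_eq_0 by blast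
  then show ?thesis using vec.dim_sums_Int[OF Z(1) Y] by linarith
qed

lemma nondegenerate_sum_orthogonal:
  assumes Z: "vec.subspace Z" "nondegenerate_on B Z" and Y: "vec.subspace Y" "nondegenerate_on B Y"
    and orth: "\<And>y z. y \<in> Y \<Longrightarrow> z \<in> Z \<Longrightarrow> B y z = 0"
  shows "nondegenerate_on B {z + y |z y. z \<in> Z \<and> y \<in> Y}" (is "nondegenerate_on B ?W")
proof (rule nondegenerate_onI)
  show "vec.subspace ?W" using vec.subspace_sums Z Y by blast
  fix u assume "u \<in> ?W" and u: "\<And>v. v \<in> ?W \<Longrightarrow> B u v = 0"
  then obtain z y where zy: "z \<in> Z" "y \<in> Y" "u = z + y" by blast
  have W: "Z \<subseteq> ?W" "Y \<subseteq> ?W"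
    using subset_sum_left[OF Y(1)] subset_sum_right[OF Z(1)] by blast+
  have "B u v = 0" if "v \<in> Z \<or> v \<in> Y" for v
    by (rule u) (use that W in \<open>meson subsetD\<close>)
  moreover have "B u v = B z v" if "v \<in> Z" for v using orth[OF zy(2) that] zy(3) by (simp add: add_left)
  moreover have "B u v = B y v" if "v \<in> Y" for v
    using reflexive[OF orth[OF that zy(1)]] zy(3) by (simp add: add_left)
  ultimately have "z = 0" "y = 0"
    using nondegenerate_onD[OF Z(2) zy(1)] nondegenerate_onD[OF Y(2) zy(2)] by auto
  then show "u = 0" using zy by simp
qed

lemma nondegenerate_span_singleton:
  assumes "B u u \<noteq> 0"
  shows "nondegenerate_on B (vec.span {u})"
proof (rule nondegenerate_onI)
  fix v assume v: "v \<in> vec.span {u}" "\<And>w. w \<in> vec.span {u} \<Longrightarrow> B v w = 0"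
  then obtain k where "v = k *s u" by (auto simp: vec.span_singleton)
  then show "v = 0" using v(2)[of u] assms by (simp add: scale_left vec.span_base)
qed simp

lemma dim_span_singleton: "u \<noteq> 0 \<Longrightarrow> vec.dim (vec.span {u}) = 1"
  using vec.dim_span_eq_card_independent[of "{u}"] by simp

lemma form_nonzero_of_dim_1:
  assumes U: "vec.subspace U" "vec.dim U = 1" "nondegenerate_on B U" and x: "x \<in> U" "x \<noteq> 0"
  shows "B x x \<noteq> 0"
proof
  assume xx: "B x x = 0"
  have span: "vec.span {x} = U"
    using U x dim_span_singleton[OF x(2)] vec.span_minimal[of "{x}" U]
    by (intro vec.subspace_dim_equal) auto
  have "B x v = 0" if v: "v \<in> U" for v
  proof -
    obtain k where "v = k *s x" using v span by (auto simp: vec.span_singleton)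
    then show ?thesis using xx reflexive[of v x] by (simp add: scale_left)
  qed
  then show False using nondegenerate_onD[OF U(3) x(1)] x(2) by blast
qed

section \<open>Isometries and hyperbolic planes of a reflexive form\<close>

definition isometry :: "('a ^ 'd \<Rightarrow> 'a ^ 'd) \<Rightarrow> bool" where
  "isometry g \<longleftrightarrow> (\<forall>x y. g (x + y) = g x + g y) \<and> (\<forall>c x. g (c *s x) = c *s g x) \<and> inj g \<and>
    (\<forall>u v. B (g u) (g v) = B u v)"

lemma isometry_compose:
  assumes "isometry g" "isometry h"
  shows "isometry (g \<circ> h)"
  using assms by (auto simp: isometry_def intro: inj_compose)

lemma isometry_subspace:
  assumes g: "isometry g" and U: "vec.subspace U"
  shows "vec.subspace (g ` U)" "vec.dim (g ` U) = vec.dim U"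
    "nondegenerate_on B U \<Longrightarrow> nondegenerate_on B (g ` U)"
proof -
  have add: "g (x + y) = g x + g y" and scale: "g (c *s x) = c *s g x" and B: "B (g u) (g v) = B u v"
    for x y c u v using g by (simp_all add: isometry_def)
  have inj: "inj g" using g by (simp add: isometry_def)
  have g0: "g 0 = 0" using scale[of 0 0] by simp
  show sub: "vec.subspace (g ` U)"
  proof (rule vec.subspaceI)
    show "0 \<in> g ` U" using g0 vec.subspace_0[OF U] by force
  qed (auto simp flip: add scale intro!: imageI vec.subspace_add[OF U] vec.subspace_scale[OF U])
  have "card (g ` U) = card U" using inj by (simp add: card_image inj_on_subset)
  then show "vec.dim (g ` U) = vec.dim U" using card_subspace[OF U] by (intro dim_eq_of_card_eq[OF sub]) simp
  assume U: "nondegenerate_on B U"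
  show "nondegenerate_on B (g ` U)"
  proof (rule nondegenerate_onI[OF sub])
    fix v assume "v \<in> g ` U" and v: "\<And>w. w \<in> g ` U \<Longrightarrow> B v w = 0"
    then obtain u where u: "u \<in> U" "v = g u" by blast
    have "u = 0"
    proof (rule nondegenerate_onD[OF U u(1)])
      show "B u w = 0" if "w \<in> U" for w using v[of "g w"] that u(2) B by simp
    qed
    then show "v = 0" using u g0 by simp
  qed
qed

text \<open>A vector mapped to 0 is orthogonal to everything, so preserving a nondegenerate form
  gives injectivity.\<close>

lemma isometryI:
  assumes nd: "nondegenerate_on B UNIV" and add: "\<And>x y. g (x + y) = g x + g y"
    and scale: "\<And>c x. g (c *s x) = c *s g x" and B: "\<And>u v. B (g u) (g v) = B u v"
  shows "isometry g"
proof -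
  have "inj g"
  proof (rule injI)
    fix x y assume "g x = g y"
    moreover have "g (x - y) + g y = g x" using add[of "x - y" y] by simp
    ultimately have "g (x - y) = 0" by simp
    then have "B (x - y) w = 0" for w using B[of "x - y" w] by simp
    then have "x - y = 0" using nd by (intro nondegenerate_onD[OF nd]) auto
    then show "x = y" by simp
  qed
  then show ?thesis using add scale B by (simp add: isometry_def)
qed

text \<open>Two hyperplanes do not cover the space: one of \<open>x\<close>, \<open>y\<close>,
  \<open>x + y\<close> avoids both.\<close>

lemma common_nonorthogonal:
  assumes nd: "nondegenerate_on B UNIV" and "u \<noteq> 0" "v \<noteq> 0"
  obtains z where "B u z \<noteq> 0" "B v z \<noteq> 0"
proof -
  obtain x y where xy: "B u x \<noteq> 0" "B v y \<noteq> 0"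
    using nondegenerate_onD[OF nd, of u] nondegenerate_onD[OF nd, of v] assms by blast
  show ?thesis
  proof (cases "B v x = 0 \<and> B u y = 0")
    case True
    then have "B u (x + y) \<noteq> 0" "B v (x + y) \<noteq> 0" using xy by (simp_all add: add_right)
    then show ?thesis by (rule that)
  next
    case False
    then show ?thesis using that[of x] that[of y] xy by auto
  qed
qed

lemma nondegenerate_isotropic_pair:
  assumes "B e e = 0" "B f f = 0" "B e f \<noteq> 0"
  shows "nondegenerate_on B (vec.span {e, f})"
proof (rule nondegenerate_onI)
  fix u assume "u \<in> vec.span {e, f}" and u: "\<And>v. v \<in> vec.span {e, f} \<Longrightarrow> B u v = 0"
  then obtain x y where xy: "u = x *s e + y *s f" by (auto simp: span_pair)
  have "B u e = y * B f e" "B u f = x * B e f"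
    unfolding xy using assms by (simp_all add: add_left scale_left)
  then show "u = 0"
    using u[of e] u[of f] assms(3) eq_0_commute[of e f] by (simp add: vec.span_base xy)
qed simp

lemma dim_isotropic_pair:
  assumes "B f f = 0" "B e f \<noteq> 0"
  shows "vec.dim (vec.span {e, f}) = 2"
proof -
  have "e \<noteq> f" using assms by auto
  moreover have "vec.independent {e, f}"
  proof -
    have "f \<noteq> 0" using assms by auto
    moreover have "e \<notin> vec.span {f}"
    proof
      assume "e \<in> vec.span {f}"
      then obtain k where "e = k *s f" by (auto simp: vec.span_singleton)
      then show False using assms by (simp add: scale_left)
    qed
    ultimately show ?thesis using \<open>e \<noteq> f\<close> by (simp add: vec.independent_insert)
  qed
  ultimately show ?thesis using vec.dim_span_eq_card_independent[of "{e, f}"] by simp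
qed

end

lemma nondegenerate_on_zero: "nondegenerate_on B {0} \<longleftrightarrow> B 0 0 = 0"
proof -
  have "{u \<in> {0}. \<forall>v\<in>{0}. B u v = 0} = (if B 0 0 = 0 then {0} else {})" by auto
  then show ?thesis unfolding nondegenerate_on_def by (simp only:) simp
qed

section \<open>The union bound\<close>

lemma set_sum_UNIV_iff:
  fixes U U' :: "('a::{field,finite} ^ 'd) set"
  assumes U: "vec.subspace U" "vec.subspace U'" and dim: "vec.dim U + vec.dim U' = CARD('d)"
  shows "U + U' = UNIV \<longleftrightarrow> U \<inter> U' = {0}"
proof -
  let ?S = "{x + y |x y. x \<in> U \<and> y \<in> U'}"
  have S: "U + U' = ?S" by (auto simp: set_plus_def)
  have sub: "vec.subspace ?S" using U by (rule vec.subspace_sums)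
  have d: "vec.dim ?S + vec.dim (U \<inter> U') = CARD('d)"
    using vec.dim_sums_Int[OF U] dim by linarith
  have UN: "vec.dim (UNIV :: ('a ^ 'd) set) = CARD('d)" by (rule vec_dim_card)
  have "?S = UNIV \<longleftrightarrow> vec.dim ?S = CARD('d)"
  proof
    assume "vec.dim ?S = CARD('d)"
    then show "?S = UNIV"
      using UN by (intro vec.subspace_dim_equal[OF sub vec.subspace_UNIV]) auto
  next
    assume "?S = UNIV"
    then show "vec.dim ?S = CARD('d)" using UN by (simp only:)
  qed
  also have "\<dots> \<longleftrightarrow> vec.dim (U \<inter> U') = 0" using d by linarith
  also have "\<dots> \<longleftrightarrow> U \<inter> U' = {0}"
    using vec.dim_eq_0[of "U \<inter> U'"] vec.subspace_0[OF U(1)] vec.subspace_0[OF U(2)] by blast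
  finally show ?thesis unfolding S .
qed

text \<open>Union bound over the nonzero vectors of \<open>U \<inter> U'\<close>. Transitivity on the level sets of \<open>f\<close> makes
  the number of members of \<open>S'\<close> through \<open>x\<close> depend on \<open>f x\<close> only, so that it can be averaged.\<close>

lemma card_intersecting_pairs_le:
  fixes S S' :: "('a::{field,finite} ^ 'd) set set" and f :: "'a ^ 'd \<Rightarrow> 'b" and c :: real
  defines "q \<equiv> CARD('a)"
  assumes l: "l \<ge> 1"
    and S: "\<And>U. U \<in> S \<Longrightarrow> vec.subspace U \<and> vec.dim U = l" and S': "\<And>U. U \<in> S' \<Longrightarrow> vec.subspace U"
    and trans: "\<And>x y. x \<noteq> 0 \<Longrightarrow> y \<noteq> 0 \<Longrightarrow> f x = f y \<Longrightarrow>
      \<exists>g. inj g \<and> g x = y \<and> (\<forall>U\<in>S'. g ` U \<in> S')"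
    and bound: "\<And>U U' x. U \<in> S \<Longrightarrow> U' \<in> S' \<Longrightarrow> x \<in> U \<Longrightarrow> x \<noteq> 0 \<Longrightarrow>
      real q * real (card {y \<in> U'. y \<noteq> 0 \<and> f y = f x}) * (real q ^ l - 1)
        \<le> c * (real q - 1) * real (card {y. y \<noteq> 0 \<and> f y = f x})"
  shows "real q * real (card {(U, U'). (U, U') \<in> S \<times> S' \<and> U \<inter> U' \<noteq> {0}}) \<le> c * real (card S) * real (card S')"
proof -
  define N N' where "N x = card {U \<in> S. x \<in> U}" and "N' x = card {U \<in> S'. x \<in> U}" for x
  have q: "real q > 1" using one_less_CARD_field[where 'a='a] by (simp add: q_def)
  then have ql: "real q ^ l - 1 > 0" using l by (simp add: one_less_power)
  have N'_le: "N' x \<le> N' y" if xy: "x \<noteq> 0" "y \<noteq> 0" "f x = f y" for x y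
  proof -
    obtain g where g: "inj g" "g x = y" "\<forall>U\<in>S'. g ` U \<in> S'" using trans[OF xy] by blast
    have "inj_on ((`) g) {U \<in> S'. x \<in> U}"
      using g(1) by (simp add: inj_on_def inj_image_eq_iff)
    moreover have "((`) g) ` {U \<in> S'. x \<in> U} \<subseteq> {U \<in> S'. y \<in> U}" using g by auto
    ultimately show ?thesis unfolding N'_def by (intro card_inj_on_le) auto
  qed
  \<comment> \<open>A vector on no member of \<open>S\<close> contributes nothing to the final sum,
    so some \<open>U\<close> through \<open>x\<close> may be assumed, as \<open>bound\<close>
    requires.\<close>
  have N': "real q * (real q ^ l - 1) * real (N' x) \<le> c * (real q - 1) * real (card S')"
    if x: "x \<noteq> 0" "N x \<noteq> 0" for x
  proof -
    define D where "D = {y. y \<noteq> 0 \<and> f y = f x}"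
    have D: "card D > 0" using x by (auto simp: D_def card_gt_0_iff)
    obtain U where U: "U \<in> S" "x \<in> U" using x(2) by (auto simp: N_def card_eq_0_iff)
    have eq: "N' y = N' x" if "y \<in> D" for y
    proof (rule antisym)
      have "y \<noteq> 0" "f y = f x" using that by (auto simp: D_def)
      then show "N' y \<le> N' x" "N' x \<le> N' y" using N'_le x(1) by simp_all
    qed
    have "(\<Sum>y\<in>D. N' y) = (\<Sum>y\<in>D. N' x)" by (rule sum.cong[OF refl eq])
    then have "N' x * card D = (\<Sum>y\<in>D. N' y)" by (simp only: sum_constant of_nat_id mult.commute)
    also have "\<dots> = (\<Sum>U\<in>S'. card {y \<in> D. y \<in> U})"
      unfolding N'_def by (rule card_Sigma_swap) auto
    also have "\<dots> = (\<Sum>U\<in>S'. card {y \<in> U. y \<noteq> 0 \<and> f y = f x})"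
      by (intro sum.cong arg_cong[where f = card]) (auto simp: D_def)
    finally have "real (N' x * card D) = real (\<Sum>U\<in>S'. card {y \<in> U. y \<noteq> 0 \<and> f y = f x})"
      by (rule arg_cong)
    then have N'D: "real (N' x) * real (card D) = (\<Sum>U\<in>S'. real (card {y \<in> U. y \<noteq> 0 \<and> f y = f x}))"
      by (simp only: of_nat_mult of_nat_sum)
    have "real q * (real q ^ l - 1) * real (N' x) * real (card D)
        = real q * (real (N' x) * real (card D)) * (real q ^ l - 1)" by (simp only: mult_ac)
    also have "\<dots> = (\<Sum>U'\<in>S'. real q * real (card {y \<in> U'. y \<noteq> 0 \<and> f y = f x}) * (real q ^ l - 1))"
      unfolding N'D by (simp only: sum_distrib_left sum_distrib_right)
    also have "\<dots> \<le> (\<Sum>U'\<in>S'. c * (real q - 1) * real (card D))"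
      unfolding D_def by (rule sum_mono) (rule bound[OF U(1) _ U(2) x(1)])
    also have "\<dots> = c * (real q - 1) * real (card S') * real (card D)" by simp
    finally show ?thesis using D by simp
  qed
  define bad where "bad = {(U, U'). (U, U') \<in> S \<times> S' \<and> U \<inter> U' \<noteq> {0}}"
  \<comment> \<open>An intersecting pair shares at least \<open>q - 1\<close> nonzero vectors;
    counting these vectors instead of pairs gains the factor \<open>q - 1\<close>.\<close>
  have "card bad * (q - 1) = (\<Sum>p\<in>bad. q - 1)" by simp
  also have "\<dots> \<le> (\<Sum>p\<in>bad. card (fst p \<inter> snd p - {0}))"
  proof (rule sum_mono)
    fix p assume "p \<in> bad"
    then obtain U U' where p: "p = (U, U')" "U \<in> S" "U' \<in> S'" "U \<inter> U' \<noteq> {0}"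
      by (auto simp: bad_def)
    have sub: "vec.subspace (U \<inter> U')" using S S' p by (simp add: vec.subspace_inter)
    have "vec.dim (U \<inter> U') \<noteq> 0" using subspace_eq_zero_of_dim[OF sub] p by blast
    then have "q ^ 1 \<le> q ^ vec.dim (U \<inter> U')"
      using q by (intro power_increasing) linarith+
    then show "q - 1 \<le> card (fst p \<inter> snd p - {0})"
      using card_nonzero_subspace[OF sub] p by (simp add: q_def)
  qed
  also have "\<dots> \<le> (\<Sum>p\<in>S\<times>S'. card (fst p \<inter> snd p - {0}))"
    by (rule sum_mono2) (auto simp: bad_def)
  also have "\<dots> = (\<Sum>p\<in>S\<times>S'. card {x \<in> -{0}. x \<in> fst p \<and> x \<in> snd p})"
    by (intro sum.cong arg_cong[where f = card]) auto
  also have "\<dots> = (\<Sum>x\<in>-{0}. card {p \<in> S\<times>S'. x \<in> fst p \<and> x \<in> snd p})"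
    by (rule card_Sigma_swap) auto
  also have "\<dots> = (\<Sum>x\<in>-{0}. N x * N' x)"
  proof (rule sum.cong)
    fix x :: "'a ^ 'd"
    have "{p \<in> S\<times>S'. x \<in> fst p \<and> x \<in> snd p} = {U \<in> S. x \<in> U} \<times> {U \<in> S'. x \<in> U}" by auto
    then show "card {p \<in> S\<times>S'. x \<in> fst p \<and> x \<in> snd p} = N x * N' x"
      by (simp add: N_def N'_def card_cartesian_product)
  qed simp
  finally have "real (card bad * (q - 1)) \<le> real (\<Sum>x\<in>-{0}. N x * N' x)"
    by (simp only: of_nat_le_iff)
  then have "real (card bad) * (real q - 1) \<le> (\<Sum>x\<in>-{0}. real (N x) * real (N' x))"
    using q by (simp add: of_nat_diff)
  then have "real q * (real q ^ l - 1) * (real (card bad) * (real q - 1))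
      \<le> real q * (real q ^ l - 1) * (\<Sum>x\<in>-{0}. real (N x) * real (N' x))"
    using q ql by (intro mult_left_mono) auto
  also have "\<dots> = (\<Sum>x\<in>-{0}. real (N x) * (real q * (real q ^ l - 1) * real (N' x)))"
    by (simp add: sum_distrib_left mult_ac)
  also have "\<dots> \<le> (\<Sum>x\<in>-{0}. real (N x) * (c * (real q - 1) * real (card S')))"
  proof (rule sum_mono)
    fix x :: "'a ^ 'd" assume "x \<in> - {0}"
    then show "real (N x) * (real q * (real q ^ l - 1) * real (N' x))
        \<le> real (N x) * (c * (real q - 1) * real (card S'))"
      using N'[of x] by (cases "N x = 0") (auto intro!: mult_left_mono)
  qed
  also have "\<dots> = real (\<Sum>x\<in>-{0}. N x) * (c * (real q - 1) * real (card S'))"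
    by (simp add: sum_distrib_right)
  also have "(\<Sum>x\<in>-{0}. N x) = (\<Sum>U\<in>S. card {x \<in> -{0}. x \<in> U})"
    unfolding N_def by (rule card_Sigma_swap) auto
  also have "\<dots> = (\<Sum>U\<in>S. q ^ l - 1)"
  proof (rule sum.cong)
    fix U assume "U \<in> S"
    moreover have "{x \<in> -{0}. x \<in> U} = U - {0}" by auto
    ultimately show "card {x \<in> -{0}. x \<in> U} = q ^ l - 1"
      using card_nonzero_subspace[of U] S by (simp add: q_def)
  qed simp
  also have "real (\<Sum>U\<in>S. q ^ l - 1) = real (card S) * (real q ^ l - 1)"
    using q by (simp add: of_nat_diff)
  finally have "((real q ^ l - 1) * (real q - 1)) * (real q * real (card bad))
      \<le> ((real q ^ l - 1) * (real q - 1)) * (c * real (card S) * real (card S'))"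
    by (simp only: mult_ac)
  moreover have "(real q ^ l - 1) * (real q - 1) > 0" using q ql by simp
  ultimately show ?thesis unfolding bad_def by (simp only: mult_le_cancel_left_pos)
qed

lemma proportion_bound:
  fixes S S' :: "'b::plus set set" and c F :: real
  assumes "finite S" "finite S'" "S \<noteq> {}" "S' \<noteq> {}" "0 < F" "c < F"
    and bad: "F * real (card {(U, U'). (U, U') \<in> S \<times> S' \<and> U + U' \<noteq> T}) \<le> c * real (card S) * real (card S')"
  shows "let proportion = real (card {(U, U'). (U, U') \<in> S \<times> S' \<and> U + U' = T}) / real (card (S \<times> S'))
    in proportion > 0 \<and> proportion \<ge> 1 - c / F"
proof -
  let ?g = "{(U, U'). (U, U') \<in> S \<times> S' \<and> U + U' = T}"
  let ?b = "{(U, U'). (U, U') \<in> S \<times> S' \<and> U + U' \<noteq> T}"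
  have sub: "?g \<subseteq> S \<times> S'" "?b \<subseteq> S \<times> S'" by auto
  have fin: "finite (S \<times> S')" using assms(1,2) by (rule finite_cartesian_product)
  have Un: "S \<times> S' = ?g \<union> ?b" "?g \<inter> ?b = {}" by auto
  have "card (S \<times> S') = card (?g \<union> ?b)" by (rule arg_cong[OF Un(1)])
  also have "\<dots> = card ?g + card ?b"
    by (rule card_Un_disjoint[OF finite_subset[OF sub(1) fin] finite_subset[OF sub(2) fin] Un(2)])
  finally have sum: "real (card (S \<times> S')) = real (card ?g) + real (card ?b)" by (simp only: of_nat_add)
  have p: "real (card (S \<times> S')) > 0"
    using assms by (simp add: card_gt_0_iff)
  have "real (card ?b) \<le> c / F * real (card (S \<times> S'))"
    using bad \<open>0 < F\<close> by (simp add: field_simps card_cartesian_product)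
  then have "(1 - c / F) * real (card (S \<times> S')) \<le> real (card ?g)"
    using sum by (simp add: algebra_simps)
  then have "1 - c / F \<le> real (card ?g) / real (card (S \<times> S'))"
    using p by (simp add: pos_le_divide_eq)
  moreover have "1 - c / F > 0" using assms by simp
  ultimately show ?thesis unfolding Let_def by linarith
qed

section \<open>Symplectic spaces\<close>

text \<open>These are the first terms of Euler's expansion 1 - x - x^2 + x^5 + x^7 - ... of the
  infinite product.\<close>

lemma prod_one_minus_power_ge:
  fixes x :: real
  assumes "0 \<le> x" "x \<le> 1"
  shows "1 - x - x\<^sup>2 \<le> (\<Prod>i=1..m. 1 - x ^ i)"
proof -
  \<comment> \<open>The bare bound is not inductive, since each step multiplies by a factor below 1;
    the extra summand absorbs this loss. There is equality at \<open>m = 1\<close>, and in later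
    steps \<open>x ^ (m + 1) \<le> x ^ 2\<close> is available.\<close>
  have "1 - x - x\<^sup>2 + x ^ (m + 1) \<le> (\<Prod>i=1..m. 1 - x ^ i)"
  proof (induction m)
    case (Suc m)
    show ?case
    proof (cases "m = 0")
      case False
      then have le: "x ^ (m + 1) \<le> x ^ 2" using assms by (intro power_decreasing) auto
      have "1 - x - x\<^sup>2 + x ^ (Suc m + 1) \<le> 1 - x - x\<^sup>2 + x ^ (m + 1) * (x + (x\<^sup>2 - x ^ (m + 1)))"
        using le assms mult_nonneg_nonneg[of "x ^ (m + 1)" "x\<^sup>2 - x ^ (m + 1)"]
        by (simp add: algebra_simps)
      also have "\<dots> = (1 - x - x\<^sup>2 + x ^ (m + 1)) * (1 - x ^ (m + 1))"
        by (simp add: algebra_simps power2_eq_square)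
      also have "\<dots> \<le> (\<Prod>i=1..m. 1 - x ^ i) * (1 - x ^ (m + 1))"
        using Suc.IH assms by (intro mult_right_mono) (simp_all add: power_le_one del: power_Suc)
      finally show ?thesis by (simp del: power_Suc)
    qed (simp add: power2_eq_square)
  qed (simp add: algebra_simps)
  moreover have "0 \<le> x ^ (m + 1)" using assms by simp
  ultimately show ?thesis by linarith
qed

locale symplectic_form = reflexive_form B for B :: "'a::{field,finite} ^ 'd \<Rightarrow> 'a ^ 'd \<Rightarrow> 'a" +
  assumes alternating: "B u u = 0"
begin

lemma antisym: "B u v = - B v u"
proof -
  have "B (u + v) (u + v) = B u v + B v u"
    using alternating[of u] alternating[of v] by (simp add: add_left add_right)
  then show ?thesis using alternating[of "u + v"] by (simp add: eq_neg_iff_add_eq_0)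
qed

lemma scale_right: "B u (c *s v) = c * B u v"
  using antisym[of u] scale_left by simp

section \<open>Counting nondegenerate subspaces through hyperbolic pairs\<close>

definition subspaces_in :: "('a ^ 'd) set \<Rightarrow> nat \<Rightarrow> ('a ^ 'd) set set" where
  "subspaces_in X k = {U. vec.subspace U \<and> U \<subseteq> X \<and> vec.dim U = k \<and> nondegenerate_on B U}"

definition pairs :: "('a ^ 'd) set \<Rightarrow> (('a ^ 'd) \<times> ('a ^ 'd)) set" where
  "pairs X = {(e, f). e \<in> X \<and> f \<in> X \<and> B e f = 1}"

lemma nondegenerate_pair: "B e f = 1 \<Longrightarrow> nondegenerate_on B (vec.span {e, f})"
  by (simp add: nondegenerate_isotropic_pair alternating)

lemma dim_pair: "B e f = 1 \<Longrightarrow> vec.dim (vec.span {e, f}) = 2"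
  by (rule dim_isotropic_pair) (simp_all add: alternating)

text \<open>The partners of a nonzero \<open>e\<close> form a coset of a hyperplane. In dimension 0
  the truncated exponent does no harm, as the first factor vanishes.\<close>

lemma card_pairs:
  assumes X: "vec.subspace X" "nondegenerate_on B X"
  shows "card (pairs X) = (CARD('a) ^ vec.dim X - 1) * CARD('a) ^ (vec.dim X - 1)"
proof -
  let ?q = "CARD('a)"
  have "card {f \<in> X. B e f = 1} = ?q ^ (vec.dim X - 1)" if e: "e \<in> X - {0}" for e
  proof -
    obtain f where f: "f \<in> X" "B e f \<noteq> 0" using nondegenerate_onD[OF X(2), of e] e by blast
    then have "vec.dim X \<noteq> 0"
      using subspace_eq_zero_of_dim[OF X(1)] by fastforce
    moreover have "card {f \<in> X. B e f = 1} * ?q = ?q ^ vec.dim X"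
      using card_fiber_linear[OF X(1), of "B e" f 1] f card_subspace[OF X(1)]
      by (simp add: add_right scale_right)
    ultimately show ?thesis by (cases "vec.dim X") auto
  qed
  moreover have "pairs X = (SIGMA e:X - {0}. {f \<in> X. B e f = 1})"
    by (auto simp: pairs_def)
  ultimately show ?thesis
    using card_nonzero_subspace[OF X(1)] by (simp add: card_SigmaI)
qed

lemma orth_pair: "orth X {e, f} = orth X (vec.span {e, f})"
  by (simp add: orth_span)

lemma nondegenerate_orth_pair:
  assumes X: "vec.subspace X" "nondegenerate_on B X" and ef: "(e, f) \<in> pairs X"
  shows "nondegenerate_on B (orth X {e, f})" "vec.dim X = vec.dim (orth X {e, f}) + 2"
proof -
  have ef: "e \<in> X" "f \<in> X" "B e f = 1" using ef by (auto simp: pairs_def)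
  note P = vec.subspace_span span_pair_subset[OF X(1) ef(1,2)] nondegenerate_pair[OF ef(3)]
  show "nondegenerate_on B (orth X {e, f})"
    using nondegenerate_orth[OF X P] by (simp add: orth_pair)
  show "vec.dim X = vec.dim (orth X {e, f}) + 2"
    using dim_orth[OF X(1) P] dim_pair[OF ef(3)] by (simp add: orth_pair)
qed

text \<open>A nondegenerate subspace containing the pair splits off the plane, and what remains is a
  nondegenerate subspace of the plane's orthogonal complement. Counting subspaces through a pair is
  thereby reduced to a space of dimension two less.\<close>

lemma bij_betw_extend_by_pair:
  assumes X: "vec.subspace X" and ef: "(e, f) \<in> pairs X"
  shows "bij_betw (\<lambda>Z. {h + z |h z. h \<in> vec.span {e, f} \<and> z \<in> Z})
    (subspaces_in (orth X {e, f}) k) {U \<in> subspaces_in X (k + 2). (e, f) \<in> pairs U}"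
    (is "bij_betw ?ext ?A ?C")
proof (rule bij_betw_byWitness[where f' = "\<lambda>U. orth U {e, f}"])
  have ef: "e \<in> X" "f \<in> X" "B e f = 1" using ef by (auto simp: pairs_def)
  let ?P = "vec.span {e, f}"
  have PX: "?P \<subseteq> X" using span_pair_subset X ef by blast
  note P = vec.subspace_span[of "{e, f}"] nondegenerate_pair[OF ef(3)]
  have "{e, f} \<subseteq> ?P" by (rule vec.span_superset)
  have ZD: "vec.subspace Z" "Z \<subseteq> X" "vec.dim Z = k" "nondegenerate_on B Z"
      "\<And>z h. z \<in> Z \<Longrightarrow> h \<in> ?P \<Longrightarrow> B z h = 0" if "Z \<in> ?A" for Z
    using that orth_pair[of X e f] by (auto simp: subspaces_in_def orth_def)
  have UD: "vec.subspace U" "U \<subseteq> X" "vec.dim U = k + 2" "nondegenerate_on B U" "?P \<subseteq> U" "(e, f) \<in> pairs U"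
    if "U \<in> ?C" for U
    using that span_pair_subset[of U e f] by (auto simp: subspaces_in_def pairs_def)
  show "\<forall>Z\<in>?A. orth (?ext Z) {e, f} = Z"
  proof
    fix Z assume Z: "Z \<in> ?A"
    note D = ZD[OF Z]
    show "orth (?ext Z) {e, f} = Z"
    proof (intro equalityI subsetI)
      fix v assume "v \<in> orth (?ext Z) {e, f}"
      then have v: "v \<in> orth (?ext Z) ?P" by (simp only: orth_pair)
      from orthD(1)[OF v] obtain h z where hz: "h \<in> ?P" "z \<in> Z" "v = h + z" by blast
      have "B h w = 0" if "w \<in> ?P" for w using orthD(2)[OF v that] D(5)[OF hz(2) that] hz(3) by (simp add: add_left)
      then have "h = 0" using nondegenerate_onD[OF P(2) hz(1)] by blast
      then show "v \<in> Z" using hz by simp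
    next
      fix v assume v: "v \<in> Z"
      then have "v \<in> ?ext Z" using subset_sum_right[OF P(1), of Z] by (rule rev_subsetD)
      then show "v \<in> orth (?ext Z) {e, f}"
        unfolding orth_pair by (rule orthI) (rule D(5)[OF v])
    qed
  qed
  show "\<forall>U\<in>?C. ?ext (orth U {e, f}) = U"
  proof
    fix U assume "U \<in> ?C"
    note D = UD[OF this]
    show "?ext (orth U {e, f}) = U"
    proof (intro equalityI subsetI)
      fix v assume "v \<in> ?ext (orth U {e, f})"
      then show "v \<in> U" using D(1,5) orth_subset[of U "{e, f}"] by (auto intro!: vec.subspace_add)
    next
      fix v assume "v \<in> U"
      from orth_decompose[OF D(1) P(1) D(5) P(2) this]
      show "v \<in> ?ext (orth U {e, f})" unfolding orth_pair by blast
    qed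
  qed
  show "?ext ` ?A \<subseteq> ?C"
  proof
    fix U assume "U \<in> ?ext ` ?A"
    then obtain Z where Z: "Z \<in> ?A" and U: "U = ?ext Z" by blast
    note D = ZD[OF Z]
    have s: "vec.subspace U" unfolding U by (rule vec.subspace_sums) (simp_all add: D)
    have "vec.dim U = vec.dim ?P + vec.dim Z"
      unfolding U by (rule dim_sum_orthogonal[OF P D(1,5)])
    then have d: "vec.dim U = k + 2" using D dim_pair[OF ef(3)] by simp
    have n: "nondegenerate_on B U"
      unfolding U by (rule nondegenerate_sum_orthogonal[OF P D(1,4,5)])
    have "U \<subseteq> X" using PX D(2) X unfolding U by (auto intro!: vec.subspace_add)
    moreover have "?P \<subseteq> U" using subset_sum_left[OF D(1)] unfolding U by blast
    ultimately show "U \<in> ?C"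
      using s d n ef \<open>{e, f} \<subseteq> ?P\<close> unfolding subspaces_in_def pairs_def by blast
  qed
  show "(\<lambda>U. orth U {e, f}) ` ?C \<subseteq> ?A"
  proof
    fix Z assume "Z \<in> (\<lambda>U. orth U {e, f}) ` ?C"
    then obtain U where U: "U \<in> ?C" and Z: "Z = orth U {e, f}" by blast
    note D = UD[OF U]
    have "Z \<subseteq> orth X {e, f}" using D(2) unfolding Z orth_def by blast
    then show "Z \<in> ?A"
      using nondegenerate_orth_pair[OF D(1,4,6)] D(3) subspace_orth[OF D(1)]
      unfolding Z subspaces_in_def by simp
  qed
qed

text \<open>All nondegenerate subspaces of a given dimension contain equally many hyperbolic pairs.
  The predicate \<open>R\<close> covers both the total count and the count of subspaces that avoid
  \<open>W\<close>.\<close>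

lemma double_count_pairs:
  assumes X: "vec.subspace X"
  shows "card {U \<in> subspaces_in X (k + 2). R U} * ((CARD('a) ^ (k + 2) - 1) * CARD('a) ^ (k + 1))
    = (\<Sum>(e, f)\<in>pairs X. card {U \<in> subspaces_in X (k + 2). R U \<and> (e, f) \<in> pairs U})"
proof -
  let ?C = "{U \<in> subspaces_in X (k + 2). R U}"
  have "card ?C * ((CARD('a) ^ (k + 2) - 1) * CARD('a) ^ (k + 1)) = (\<Sum>U\<in>?C. card (pairs U))"
    by (simp add: subspaces_in_def card_pairs)
  also have "\<dots> = (\<Sum>U\<in>?C. card {p \<in> pairs X. p \<in> pairs U})"
    by (intro sum.cong arg_cong[where f = card]) (auto simp: subspaces_in_def pairs_def)
  also have "\<dots> = (\<Sum>p\<in>pairs X. card {U \<in> ?C. p \<in> pairs U})"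
    by (rule card_Sigma_swap) auto
  also have "\<dots> = (\<Sum>(e, f)\<in>pairs X. card {U \<in> subspaces_in X (k + 2). R U \<and> (e, f) \<in> pairs U})"
    by (intro sum.cong refl) (auto intro!: arg_cong[where f = card])
  finally show ?thesis .
qed

text \<open>The projection of \<open>W\<close> to \<open>\<langle>e, f\<rangle>\<^sup>\<bottom>\<close> along \<open>\<langle>e, f\<rangle>\<close>.\<close>

definition shadow :: "('a ^ 'd) set \<Rightarrow> 'a ^ 'd \<Rightarrow> 'a ^ 'd \<Rightarrow> ('a ^ 'd) set \<Rightarrow> ('a ^ 'd) set" where
  "shadow X e f W = {y \<in> orth X {e, f}. \<exists>h\<in>vec.span {e, f}. h + y \<in> W}"

lemma subspace_shadow:
  assumes "vec.subspace X" "vec.subspace W"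
  shows "vec.subspace (shadow X e f W)"
proof (rule vec.subspaceI)
  note O = subspace_orth[OF assms(1), of "{e, f}"]
  show "0 \<in> shadow X e f W"
    using vec.subspace_0[OF O] vec.subspace_0[OF assms(2)] vec.span_zero[of "{e, f}"]
    unfolding shadow_def by (auto intro!: bexI[of _ 0])
next
  fix x y assume "x \<in> shadow X e f W" "y \<in> shadow X e f W"
  then obtain h k where h: "x \<in> orth X {e, f}" "y \<in> orth X {e, f}" "h \<in> vec.span {e, f}" "h + x \<in> W"
      "k \<in> vec.span {e, f}" "k + y \<in> W" unfolding shadow_def by blast
  have "(h + k) + (x + y) \<in> W" using vec.subspace_add[OF assms(2) h(4,6)] by (simp add: add_ac)
  then show "x + y \<in> shadow X e f W"
    using vec.subspace_add[OF subspace_orth[OF assms(1)] h(1,2)] vec.span_add[OF h(3,5)]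
    unfolding shadow_def by blast
next
  fix c x assume "x \<in> shadow X e f W"
  then obtain h where h: "x \<in> orth X {e, f}" "h \<in> vec.span {e, f}" "h + x \<in> W"
    unfolding shadow_def by blast
  have "c *s h + c *s x \<in> W"
    using vec.subspace_scale[OF assms(2) h(3), of c] by (simp add: vec.scale_right_distrib)
  then show "c *s x \<in> shadow X e f W"
    using vec.subspace_scale[OF subspace_orth[OF assms(1)] h(1)] vec.span_scale[OF h(2)]
    unfolding shadow_def by blast
qed

text \<open>Lifts of distinct shadow vectors to \<open>W\<close> are distinct, because a
  nondegenerate plane meets its orthogonal complement trivially. The bound on the dimension of the
  avoided subspace thus survives the passage to the smaller space.\<close>

lemma dim_shadow_le:
  assumes X: "vec.subspace X" and W: "vec.subspace W" and ef: "B e f = 1"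
  shows "vec.dim (shadow X e f W) \<le> vec.dim W"
proof -
  let ?P = "vec.span {e, f}"
  have "\<forall>y\<in>shadow X e f W. \<exists>w. w \<in> W \<and> w - y \<in> ?P"
  proof
    fix y assume "y \<in> shadow X e f W"
    then obtain h where "h \<in> ?P" "h + y \<in> W" unfolding shadow_def by blast
    then show "\<exists>w. w \<in> W \<and> w - y \<in> ?P" by (intro exI[of _ "h + y"]) simp
  qed
  then obtain g where g: "\<And>y. y \<in> shadow X e f W \<Longrightarrow> g y \<in> W \<and> g y - y \<in> ?P" by metis
  have "inj_on g (shadow X e f W)"
  proof (rule inj_onI)
    fix y y' assume y: "y \<in> shadow X e f W" "y' \<in> shadow X e f W" "g y = g y'"
    have "(g y' - y') - (g y - y) \<in> ?P" using g[OF y(1)] g[OF y(2)] vec.span_diff by blast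
    then have "y - y' \<in> ?P" using y(3) by simp
    moreover have "y - y' \<in> orth X ?P"
      using y(1,2) vec.subspace_diff[OF subspace_orth[OF X, of "{e, f}"]]
      unfolding shadow_def orth_pair by blast
    ultimately have "y - y' = 0" using Int_orth[OF nondegenerate_pair[OF ef], of X] by blast
    then show "y = y'" by simp
  qed
  then have "card (shadow X e f W) \<le> card W"
    using g by (intro card_inj_on_le) auto
  then show ?thesis
    using card_subspace[OF W] card_subspace[OF subspace_shadow[OF X W]] one_less_CARD_field[where 'a='a]
    by simp
qed

text \<open>For a vector common to the extension and \<open>W\<close>, the component outside the
  plane lies in both \<open>Z\<close> and the shadow and hence vanishes; the component in the plane
  vanishes because \<open>e\<close> and \<open>f\<close> are independent modulo
  \<open>W\<close>.\<close>

lemma extension_avoids: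
  assumes W: "vec.subspace W" and e: "e \<notin> W" and f: "f \<notin> vec.span (insert e W)"
    and Z: "Z \<subseteq> orth X {e, f}" "Z \<inter> shadow X e f W = {0}"
  shows "{h + z |h z. h \<in> vec.span {e, f} \<and> z \<in> Z} \<inter> W = {0}"
proof (intro equalityI subsetI)
  fix w assume "w \<in> {h + z |h z. h \<in> vec.span {e, f} \<and> z \<in> Z} \<inter> W"
  then obtain h z where hz: "h \<in> vec.span {e, f}" "z \<in> Z" "w = h + z" "w \<in> W" by blast
  then have "z \<in> shadow X e f W" using Z(1) unfolding shadow_def by blast
  then have "z = 0" using hz Z(2) by blast
  obtain x y where h: "h = x *s e + y *s f" using hz(1) unfolding span_pair by blast
  have wh: "x *s e + y *s f \<in> W" using hz \<open>z = 0\<close> h by simp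
  have "y = 0"
  proof (rule ccontr)
    assume y: "y \<noteq> 0"
    have "(x *s e + y *s f) - x *s e \<in> vec.span (insert e W)"
      using wh by (intro vec.span_diff vec.span_scale vec.span_base) auto
    then have "y *s f \<in> vec.span (insert e W)" by simp
    then have "inverse y *s (y *s f) \<in> vec.span (insert e W)" by (rule vec.span_scale)
    then show False using f y by simp
  qed
  moreover have "x = 0"
  proof (rule ccontr)
    assume x: "x \<noteq> 0"
    have "x *s e \<in> W" using wh \<open>y = 0\<close> by simp
    then have "inverse x *s (x *s e) \<in> W" by (rule vec.subspace_scale[OF W])
    then show False using e x by simp
  qed
  ultimately show "w \<in> {0}" using hz \<open>z = 0\<close> h by simp
next
  fix w :: "'a ^ 'd" assume "w \<in> {0}"
  moreover have "0 \<in> Z" using Z(2) by blast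
  ultimately show "w \<in> {h + z |h z. h \<in> vec.span {e, f} \<and> z \<in> Z} \<inter> W"
    using vec.span_zero[of "{e, f}"] vec.subspace_0[OF W] by force
qed

lemma card_avoiding_pairs_ge:
  assumes X: "vec.subspace X" "nondegenerate_on B X" and W: "vec.subspace W" "vec.dim W \<le> n"
    and n: "n < vec.dim X"
  defines "q \<equiv> real CARD('a)" and "d \<equiv> vec.dim X"
  shows "(q ^ d - q ^ n) * (q ^ (d - 1) - q ^ n)
    \<le> real (card {(e, f) \<in> pairs X. e \<notin> W \<and> f \<notin> vec.span (insert e W)})"
proof -
  have q: "q > 1" using one_less_CARD_field[where 'a='a] by (simp add: q_def)
  have cW: "real (card W) \<le> q ^ n"
    using card_subspace[OF W(1)] W(2) q by (simp add: q_def power_increasing)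
  have step: "q ^ (d - 1) - q ^ n \<le> real (card {f \<in> X. B e f = 1 \<and> f \<notin> vec.span (insert e W)})"
    if e: "e \<in> X - W" for e
  proof -
    let ?W = "vec.span (insert e W)"
    have "e \<noteq> 0" using e vec.subspace_0[OF W(1)] by blast
    then obtain f where f: "f \<in> X" "B e f \<noteq> 0" using nondegenerate_onD[OF X(2), of e] e by blast
    have "real (card {f \<in> X. B e f = 1}) * q = q ^ d"
      using arg_cong[OF card_fiber_linear[OF X(1), of "B e" f 1], of real] f card_subspace[OF X(1)]
      by (simp add: add_right scale_right q_def d_def)
    also have "\<dots> = q ^ (d - 1) * q" using n power_minus_mult[of d q] by (simp add: d_def)
    finally have 1: "real (card {f \<in> X. B e f = 1}) = q ^ (d - 1)" using q by simp
    \<comment> \<open>The span of \<open>e\<close> and \<open>W\<close> may have dimension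
      \<open>n + 1\<close>, but the condition \<open>B e f = 1\<close> is either unsolvable in it or
      cuts out a coset of a hyperplane. The forbidden \<open>f\<close> therefore number at most
      \<open>q ^ n\<close>.\<close>
    have "real (card {f \<in> ?W. B e f = 1}) \<le> q ^ n"
    proof (cases "\<exists>f\<in>?W. B e f \<noteq> 0")
      case True
      then obtain g where g: "g \<in> ?W" "B e g \<noteq> 0" by blast
      have "vec.dim ?W \<le> Suc (vec.dim W)" by (simp add: vec.dim_insert)
      then have "card ?W \<le> CARD('a) ^ Suc n"
        using card_subspace[of ?W] W(2) one_less_CARD_field[where 'a='a]
        by (simp add: power_increasing del: power_Suc)
      moreover have "card {f \<in> ?W. B e f = 1} * CARD('a) = card ?W"
        using g by (intro card_fiber_linear[of _ _ g]) (auto simp: add_right scale_right)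
      ultimately have "card {f \<in> ?W. B e f = 1} * CARD('a) \<le> CARD('a) ^ n * CARD('a)"
        by (simp add: mult.commute)
      then have "card {f \<in> ?W. B e f = 1} \<le> CARD('a) ^ n" by simp
      then have "real (card {f \<in> ?W. B e f = 1}) \<le> real (CARD('a) ^ n)" by (simp only: of_nat_le_iff)
      then show ?thesis by (simp only: q_def of_nat_power)
    next
      case False
      then have "{f \<in> ?W. B e f = 1} = {}" by auto
      then have "card {f \<in> ?W. B e f = 1} = 0" by (simp only: card.empty)
      moreover have "0 \<le> q ^ n" using q by simp
      ultimately show ?thesis by (simp only: of_nat_0)
    qed
    moreover have "card {f \<in> X. B e f = 1} \<le>
        card {f \<in> X. B e f = 1 \<and> f \<notin> ?W} + card {f \<in> ?W. B e f = 1}"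
      by (rule order_trans[OF card_mono card_Un_le]) auto
    ultimately show ?thesis using 1 by linarith
  qed
  have nd: "q ^ n \<le> q ^ (d - 1)" using n q by (intro power_increasing) (auto simp: d_def)
  have "card X \<le> card (X - W) + card W"
    by (rule order_trans[OF card_mono card_Un_le]) auto
  then have "real (card X) \<le> real (card (X - W)) + real (card W)" by linarith
  moreover have "real (card X) = q ^ d" using card_subspace[OF X(1)] by (simp add: q_def d_def)
  ultimately have "q ^ d - q ^ n \<le> real (card (X - W))" using cW by linarith
  then have "(q ^ d - q ^ n) * (q ^ (d - 1) - q ^ n) \<le> real (card (X - W)) * (q ^ (d - 1) - q ^ n)"
    using nd by (intro mult_right_mono) auto
  also have "\<dots> = (\<Sum>e\<in>X - W. q ^ (d - 1) - q ^ n)" by simp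
  also have "\<dots> \<le> (\<Sum>e\<in>X - W. real (card {f \<in> X. B e f = 1 \<and> f \<notin> vec.span (insert e W)}))"
    by (rule sum_mono) (rule step)
  also have "\<dots> = real (card (SIGMA e:X - W. {f \<in> X. B e f = 1 \<and> f \<notin> vec.span (insert e W)}))"
    by (simp add: card_SigmaI)
  also have "(SIGMA e:X - W. {f \<in> X. B e f = 1 \<and> f \<notin> vec.span (insert e W)})
      = {(e, f) \<in> pairs X. e \<notin> W \<and> f \<notin> vec.span (insert e W)}"
    by (auto simp: pairs_def)
  finally show ?thesis .
qed

text \<open>Build a random nondegenerate subspace from mutually orthogonal hyperbolic pairs \<open>(e, f)\<close>. The span
  meets \<open>W\<close> trivially if \<open>e \<notin> W\<close>, \<open>f \<notin> \<langle>e, W\<rangle>\<close> and the remaining pairs, chosen in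
  \<open>\<langle>e, f\<rangle>\<^sup>\<bottom>\<close>, avoid the shadow of \<open>W\<close>. The two conditions on \<open>(e, f)\<close> contribute the two factors
  with the largest exponents to the product. \<open>K\<close> must not depend on \<open>X\<close> for the induction to work.\<close>

lemma avoiding_subspaces:
  fixes n k :: nat
  shows "\<exists>K>0. \<forall>X. vec.subspace X \<longrightarrow> nondegenerate_on B X \<longrightarrow> vec.dim X = n + 2 * k \<longrightarrow>
    card (subspaces_in X (2 * k)) = K \<and>
    (\<forall>W. vec.subspace W \<longrightarrow> vec.dim W \<le> n \<longrightarrow>
      (\<Prod>i=1..2 * k. 1 - (1 / real CARD('a)) ^ i) * real K
        \<le> real (card {U \<in> subspaces_in X (2 * k). U \<inter> W = {0}}))"
proof (induction k)
  case 0
  have "subspaces_in X 0 = {{0}}" if "vec.subspace X" for X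
    using that subspace_eq_zero_of_dim vec.subspace_0[OF that]
    by (auto simp: subspaces_in_def nondegenerate_on_zero)
  then have S: "subspaces_in X (2 * 0) = {{0}}" if "vec.subspace X" for X using that by simp
  have "{U \<in> {{0}}. U \<inter> W = {0}} = {{0}}" if "vec.subspace W" for W :: "('a ^ 'd) set"
    using vec.subspace_0[OF that] by auto
  from arg_cong[OF this, of _ card] have "card {U \<in> {{0}}. U \<inter> W = {0}} = 1" if "vec.subspace W" for W :: "('a ^ 'd) set"
    using that by simp
  then show ?case
    by (intro exI[of _ 1] conjI allI impI) (simp_all only: S, simp_all only: mult_0_right, simp_all)
next
  case (Suc k)
  define q where "q = real CARD('a)"
  have q: "q > 1" using one_less_CARD_field[where 'a='a] by (simp add: q_def)
  define g where "g m = (\<Prod>i=1..m. 1 - (1 / q) ^ i)" for m :: nat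
  have g0: "g m \<ge> 0" for m
    unfolding g_def using q by (intro prod_nonneg) (simp add: power_le_one)
  obtain K where K: "K > 0"
    and KX: "\<And>X. vec.subspace X \<Longrightarrow> nondegenerate_on B X \<Longrightarrow> vec.dim X = n + 2 * k \<Longrightarrow>
      card (subspaces_in X (2 * k)) = K"
    and KW: "\<And>X W. vec.subspace X \<Longrightarrow> nondegenerate_on B X \<Longrightarrow> vec.dim X = n + 2 * k \<Longrightarrow>
      vec.subspace W \<Longrightarrow> vec.dim W \<le> n \<Longrightarrow>
      g (2 * k) * real K \<le> real (card {U \<in> subspaces_in X (2 * k). U \<inter> W = {0}})"
    using Suc.IH unfolding q_def g_def by blast
  define d where "d = n + 2 * Suc k"
  define hX where "hX = (CARD('a) ^ d - 1) * CARD('a) ^ (d - 1)"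
  define h where "h = (CARD('a) ^ (2 * k + 2) - 1) * CARD('a) ^ (2 * k + 1)"
  have h0: "h > 0"
    using one_less_CARD_field[where 'a='a] one_less_power[of "CARD('a)" "2 * k + 2"] by (simp add: h_def)
  have hX: "h \<le> hX"
    unfolding h_def hX_def using one_less_CARD_field[where 'a='a]
    by (intro mult_le_mono diff_le_mono power_increasing) (simp_all add: d_def)
  have fib: "card {U \<in> subspaces_in X (2 * k + 2). (e, f) \<in> pairs U} = K"
    if X: "vec.subspace X" "nondegenerate_on B X" "vec.dim X = d" and ef: "(e, f) \<in> pairs X" for X e f
  proof -
    have "card (subspaces_in (orth X {e, f}) (2 * k)) = K"
      using nondegenerate_orth_pair[OF X(1,2) ef] X(3)
      by (intro KX subspace_orth X) (simp_all add: d_def)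
    then show ?thesis using bij_betw_same_card[OF bij_betw_extend_by_pair[OF X(1) ef, of "2 * k"]] by simp
  qed
  have count: "card (subspaces_in X (2 * k + 2)) * h = hX * K"
    if X: "vec.subspace X" "nondegenerate_on B X" "vec.dim X = d" for X
  proof -
    have "card (subspaces_in X (2 * k + 2)) * h
        = (\<Sum>(e, f)\<in>pairs X. card {U \<in> subspaces_in X (2 * k + 2). (e, f) \<in> pairs U})"
      using double_count_pairs[OF X(1), of "2 * k" "\<lambda>_. True"] by (simp add: h_def)
    also have "\<dots> = (\<Sum>(e, f)\<in>pairs X. K)"
    proof (rule sum.cong[OF refl], clarify)
      fix e f assume "(e, f) \<in> pairs X"
      then show "card {U \<in> subspaces_in X (2 * k + 2). (e, f) \<in> pairs U} = K" by (rule fib[OF X])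
    qed
    also have "\<dots> = hX * K" using card_pairs[OF X(1,2)] by (simp add: hX_def X(3) case_prod_unfold)
    finally show ?thesis .
  qed
  have Suc2: "2 * Suc k = 2 * k + 2" by simp
  \<comment> \<open>The next constant is \<open>hX * K div h\<close>. It does not refer to
    \<open>X\<close>, and the division is exact by \<open>count\<close>.\<close>
  have main: "card (subspaces_in X (2 * Suc k)) = hX * K div h \<and>
      (\<forall>W. vec.subspace W \<longrightarrow> vec.dim W \<le> n \<longrightarrow>
        g (2 * Suc k) * real (hX * K div h) \<le> real (card {U \<in> subspaces_in X (2 * Suc k). U \<inter> W = {0}}))"
    if X: "vec.subspace X" "nondegenerate_on B X" "vec.dim X = d" for X
  proof (intro conjI allI impI)
    have "hX * K div h = card (subspaces_in X (2 * k + 2)) * h div h" by (simp only: count[OF X])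
    then show K': "card (subspaces_in X (2 * Suc k)) = hX * K div h"
      using h0 unfolding Suc2 by simp
    fix W :: "('a ^ 'd) set" assume W: "vec.subspace W" "vec.dim W \<le> n"
    define P where "P = {(e, f) \<in> pairs X. e \<notin> W \<and> f \<notin> vec.span (insert e W)}"
    define c where "c = card {U \<in> subspaces_in X (2 * k + 2). U \<inter> W = {0}}"
    define C where "C p = {U \<in> subspaces_in X (2 * k + 2). U \<inter> W = {0} \<and> p \<in> pairs U}" for p
    have step: "g (2 * k) * real K \<le> real (card (C (e, f)))" if "(e, f) \<in> P" for e f
    proof -
      have ef: "(e, f) \<in> pairs X" "e \<notin> W" "f \<notin> vec.span (insert e W)" "B e f = 1"
        using that by (auto simp: P_def pairs_def)
      let ?Y = "orth X {e, f}" and ?ext = "\<lambda>Z. {h + z |h z. h \<in> vec.span {e, f} \<and> z \<in> Z}"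
      note bij = bij_betw_extend_by_pair[OF X(1) ef(1), of "2 * k"]
      let ?A = "{Z \<in> subspaces_in ?Y (2 * k). Z \<inter> shadow X e f W = {0}}"
      have "g (2 * k) * real K \<le> real (card ?A)"
        using nondegenerate_orth_pair[OF X(1,2) ef(1)] X(3) dim_shadow_le[OF X(1) W(1) ef(4)] W(2)
        by (intro KW subspace_orth subspace_shadow X W) (simp_all add: d_def)
      also have "card ?A \<le> card (C (e, f))"
      proof (rule card_inj_on_le)
        show "inj_on ?ext ?A"
          using bij_betw_imp_inj_on[OF bij] by (rule inj_on_subset) blast
        show "?ext ` ?A \<subseteq> C (e, f)"
        proof
          fix U assume "U \<in> ?ext ` ?A"
          then obtain Z where Z: "Z \<in> ?A" "U = ?ext Z" by blast
          then have Z': "Z \<in> subspaces_in ?Y (2 * k)" "Z \<inter> shadow X e f W = {0}" "Z \<subseteq> ?Y"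
            by (simp_all add: subspaces_in_def)
          have "U \<in> {U \<in> subspaces_in X (2 * k + 2). (e, f) \<in> pairs U}"
            using bij_betw_apply[OF bij Z'(1)] Z(2) by simp
          moreover have "U \<inter> W = {0}"
            unfolding Z(2) by (rule extension_avoids[OF W(1) ef(2,3) Z'(3,2)])
          ultimately show "U \<in> C (e, f)" by (simp add: C_def)
        qed
      qed simp
      finally show ?thesis by simp
    qed
    have "real (card P) * (g (2 * k) * real K) = (\<Sum>p\<in>P. g (2 * k) * real K)" by simp
    also have "\<dots> \<le> (\<Sum>p\<in>P. real (card (C p)))"
      using step by (intro sum_mono) auto
    also have "\<dots> \<le> (\<Sum>p\<in>pairs X. real (card (C p)))"
      by (rule sum_mono2) (auto simp: P_def)
    also have "\<dots> = real (c * h)"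
      using double_count_pairs[OF X(1), of "2 * k" "\<lambda>U. U \<inter> W = {0}"]
      by (simp add: c_def h_def C_def case_prod_unfold)
    finally have 1: "real (card P) * (g (2 * k) * real K) \<le> real c * real h" by simp
    define a b where "a = 1 - (1 / q) ^ (2 * k + 1)" and "b = 1 - (1 / q) ^ (2 * k + 2)"
    \<comment> \<open>Dropping the 1 from \<open>hX\<close> only enlarges it, so
      \<open>a * b\<close> is a lower bound for the fraction of hyperbolic pairs that satisfy both
      conditions.\<close>
    have "real hX * (a * b) \<le> (q ^ d * q ^ (d - 1)) * (a * b)"
    proof (rule mult_right_mono)
      have "real hX \<le> real (CARD('a) ^ d * CARD('a) ^ (d - 1))"
        unfolding hX_def of_nat_le_iff by simp
      then show "real hX \<le> q ^ d * q ^ (d - 1)" by (simp add: q_def)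
      have "(1 / q) ^ i \<le> 1" for i using q by (simp add: power_le_one)
      then show "0 \<le> a * b"
        unfolding a_def b_def by (intro mult_nonneg_nonneg) (simp_all only: diff_ge_0_iff_ge)
    qed
    also have "\<dots> = (q ^ d - q ^ n) * (q ^ (d - 1) - q ^ n)"
    proof -
      have e: "d = n + (2 * k + 2)" "d - 1 = n + (2 * k + 1)" by (simp_all add: d_def)
      have i: "q ^ (n + i) * (1 - (1 / q) ^ i) = q ^ (n + i) - q ^ n" for i
        using q by (simp add: power_add power_divide right_diff_distrib)
      have "q ^ d * b = q ^ d - q ^ n"
        using i[of "2 * k + 2"] by (simp only: e(1)[symmetric] b_def)
      moreover have "q ^ (d - 1) * a = q ^ (d - 1) - q ^ n"
        using i[of "2 * k + 1"] by (simp only: e(2)[symmetric] a_def)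
      moreover have "(q ^ d * q ^ (d - 1)) * (a * b) = (q ^ d * b) * (q ^ (d - 1) * a)"
        by (simp only: mult_ac)
      ultimately show ?thesis by (simp only:)
    qed
    also have "\<dots> \<le> real (card P)"
      unfolding P_def q_def X(3)[symmetric] by (rule card_avoiding_pairs_ge[OF X(1,2) W]) (simp add: X(3) d_def)
    finally have 2: "real hX * (a * b) \<le> real (card P)" .
    have gS: "g (2 * Suc k) = g (2 * k) * (a * b)"
      by (simp add: g_def a_def b_def)
    have "real (hX * K div h) * real h = real hX * real K"
      using arg_cong[OF count[OF X], of real] K' unfolding Suc2 by simp
    then have "g (2 * Suc k) * real (hX * K div h) * real h = (real hX * (a * b)) * (g (2 * k) * real K)"
      unfolding gS by (simp add: mult.assoc)
    also have "\<dots> \<le> real (card P) * (g (2 * k) * real K)"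
      using 2 g0[of "2 * k"] by (intro mult_right_mono) simp_all
    also have "\<dots> \<le> real c * real h" by (rule 1)
    finally have "g (2 * Suc k) * real (hX * K div h) \<le> real c"
      using h0 by simp
    then show "g (2 * Suc k) * real (hX * K div h) \<le> real (card {U \<in> subspaces_in X (2 * Suc k). U \<inter> W = {0}})"
      unfolding c_def Suc2 .
  qed
  have "h \<le> hX * K" using hX K by (metis Suc_leI mult.right_neutral mult_le_mono One_nat_def)
  then have "0 < hX * K div h" using h0 by (simp add: div_greater_zero_iff)
  then show ?case
    using main unfolding g_def q_def d_def by blast
qed

end

section \<open>Hermitian spaces\<close>

text \<open>The two properties of \<open>x ^ q\<close> are assumptions here, which keeps the
  characteristic out of the counting; \<open>hermitian_spaceI\<close> supplies them.\<close>

locale hermitian_space =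
  fixes B :: "'a::{field,finite} ^ 'd \<Rightarrow> 'a ^ 'd \<Rightarrow> 'a" and q :: nat
  assumes q: "q \<ge> 2" and card_field: "CARD('a) = q\<^sup>2"
    and frob: "(x + y :: 'a) ^ q = x ^ q + y ^ q" and involution: "((x :: 'a) ^ q) ^ q = x"
    and add_l: "B (u + v) w = B u w + B v w" and scale_l: "B (c *s u) w = c * B u w"
    and hermitian: "B v u = B u v ^ q" and nondeg: "nondegenerate_on B UNIV"

sublocale hermitian_space \<subseteq> reflexive_form B
proof
  show "B u (v + w) = B u v + B u w" for u v w
    by (metis add_l frob hermitian)
  show "B u v = 0 \<Longrightarrow> B v u = 0" for u v using hermitian[of v u] q by simp
qed (fact add_l scale_l)+

context hermitian_space
begin

section \<open>Norm and trace to the fixed field, and the sizes of the norm levels\<close>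

lemma scale_right: "B u (c *s v) = c ^ q * B u v"
  by (metis hermitian power_mult_distrib scale_l)

lemma frob_minus: "(- x :: 'a) ^ q = - (x ^ q)"
proof -
  have "(- x) ^ q + x ^ q = (- x + x) ^ q" by (rule frob[symmetric])
  also have "\<dots> = 0" using q by (simp add: zero_power)
  finally have "(- x) ^ q + x ^ q = 0" .
  then show ?thesis by (simp add: eq_neg_iff_add_eq_0)
qed

lemma frob_diff: "(x - y :: 'a) ^ q = x ^ q - y ^ q"
  using frob[of x "- y"] frob_minus by simp

text \<open>The subfield of order \<open>q\<close>; norms, traces and all values
  \<open>B v v\<close> lie in it.\<close>

definition fixed :: "'a set" where "fixed = {t. t ^ q = t}"

lemma norm_fixed: "(x :: 'a) ^ (q + 1) \<in> fixed"
  using involution[of x] by (simp add: fixed_def power_mult_distrib mult.commute)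

lemma form_fixed: "B v v \<in> fixed"
  using hermitian[of v v] by (simp add: fixed_def)

text \<open>The norm map sends the \<open>q^2 - 1\<close> nonzero scalars to at most
  \<open>q - 1\<close> values with at most \<open>q + 1\<close> preimages each, so both bounds are
  attained.\<close>

lemma card_norm_fiber:
  assumes "t \<in> fixed" "t \<noteq> 0"
  shows "card {x :: 'a. x ^ (q + 1) = t} = q + 1"
proof (rule eq_of_sum_ge[where A = "fixed - {0}"])
  show "card {x. x ^ (q + 1) = t} \<le> q + 1" for t :: 'a
    using card_power_eq_linear_le[of "q + 1" 0 t] q by (simp del: power_Suc)
  have "card fixed \<le> q"
    using card_power_eq_linear_le[of q 1 0] q by (simp add: fixed_def)
  moreover have "0 \<in> fixed" using q by (simp add: fixed_def)
  ultimately have "card (fixed - {0}) \<le> q - 1" by simp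
  then have "card (fixed - {0}) * (q + 1) \<le> (q - 1) * (q + 1)" by (rule mult_le_mono1)
  also have "\<dots> = card (- {0 :: 'a})"
    using card_field q by (simp add: Compl_eq_Diff_UNIV algebra_simps power2_eq_square)
  also have "\<dots> = (\<Sum>x\<in>- {0 :: 'a}. 1)" by simp
  also have "\<dots> = (\<Sum>t\<in>fixed - {0}. \<Sum>x\<in>{x \<in> - {0}. x ^ (q + 1) = t}. 1)"
    by (rule sum.group[symmetric]) (use norm_fixed in \<open>auto simp del: power_Suc\<close>)
  also have "\<dots> = (\<Sum>t\<in>fixed - {0}. card {x \<in> - {0}. x ^ (q + 1) = t})" by (simp only: card_eq_sum)
  also have "\<dots> = (\<Sum>t\<in>fixed - {0}. card {x. x ^ (q + 1) = t})"
    by (intro sum.cong arg_cong[where f = card]) auto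
  finally show "card (fixed - {0}) * (q + 1) \<le> (\<Sum>t\<in>fixed - {0}. card {x. x ^ (q + 1) = t})" .
qed (use assms in auto)

text \<open>The trace is not identically 0, since its kernel has at most \<open>q\<close> elements.
  It is linear over the fixed field, so one nonzero value yields all others.\<close>

lemma trace_surj:
  assumes "s \<in> fixed"
  obtains x where "x + x ^ q = s"
proof -
  have "card {x :: 'a. x ^ q = -1 * x + 0} \<le> q" using q by (intro card_power_eq_linear_le) simp
  also have "q < CARD('a)" using q card_field by (simp add: power2_eq_square)
  finally have "{x :: 'a. x ^ q = -1 * x + 0} \<noteq> UNIV" by (intro notI) (simp only: less_irrefl)
  then obtain x :: 'a where "x ^ q \<noteq> - x" by auto
  then have r: "x + x ^ q \<noteq> 0" by (simp add: add_eq_0_iff)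
  define r where "r = x + x ^ q"
  have "r ^ q = r" by (simp add: r_def frob involution add.commute)
  then have "(s / r) ^ q = s / r" using assms by (simp add: fixed_def power_divide)
  then have "(x * (s / r)) + (x * (s / r)) ^ q = r * (s / r)"
    unfolding r_def by (simp only: power_mult_distrib distrib_right)
  then show ?thesis using that r by (simp add: r_def)
qed

text \<open>If all vectors were isotropic, \<open>B w v + B v w\<close> would vanish for all
  \<open>w\<close> and \<open>v\<close>, contradicting surjectivity of the trace. The norm map then
  rescales the value to 1.\<close>

lemma nonisotropic_vector:
  assumes X: "vec.subspace X" "nondegenerate_on B X" "vec.dim X > 0"
  obtains u where "u \<in> X" "B u u = 1"
proof -
  have "\<exists>u\<in>X. B u u \<noteq> 0"
  proof (rule ccontr)
    assume "\<not> ?thesis"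
    then have 0: "B u u = 0" if "u \<in> X" for u using that by blast
    have "\<not> X \<subseteq> {0}" using X(3) vec.dim_eq_0[of X] by linarith
    then obtain u where u: "u \<in> X" "u \<noteq> 0" by blast
    obtain v where v: "v \<in> X" "B u v \<noteq> 0" using nondegenerate_onD[OF X(2)] u by blast
    obtain x where x: "x + x ^ q = (1 :: 'a)" using trace_surj[of 1] by (auto simp: fixed_def)
    define w where "w = (x / B u v) *s u"
    have w: "w \<in> X" "B w v = x" using u v X by (simp_all add: w_def scale_left vec.subspace_scale)
    have "B (w + v) (w + v) = B w v + B v w"
      using 0[OF w(1)] 0[OF v(1)] by (simp add: add_left add_right)
    then show False
      using 0[of "w + v"] w v X x hermitian[of v w] by (simp add: vec.subspace_add)
  qed
  then obtain u where u: "u \<in> X" "B u u \<noteq> 0" by blast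
  have "inverse (B u u) \<in> fixed"
    using form_fixed[of u] by (simp add: fixed_def power_inverse)
  then have "card {x :: 'a. x ^ (q + 1) = inverse (B u u)} = q + 1"
    using u by (intro card_norm_fiber) auto
  then have "{x :: 'a. x ^ (q + 1) = inverse (B u u)} \<noteq> {}"
    by (intro notI) (simp only: card.empty)
  then obtain x where "x ^ (q + 1) = inverse (B u u)" by blast
  then have "x * x ^ q * B u u = 1" using u by simp
  then have "B (x *s u) (x *s u) = 1" by (simp only: scale_left scale_right mult_ac)
  then show ?thesis by (rule that[OF vec.subspace_scale[OF X(1) u(1)]])
qed

text \<open>Over a fixed \<open>y\<close> in \<open>Y\<close> the coordinate \<open>x\<close> along
  \<open>u\<close> satisfies \<open>x ^ (q + 1) = a - B y y\<close>, with one solution if the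
  right-hand side is 0 and \<open>q + 1\<close> solutions otherwise.\<close>

lemma card_norm_step:
  assumes X: "vec.subspace X" "nondegenerate_on B X" and u: "u \<in> X" "B u u = 1" and a: "a \<in> fixed"
  defines "Y \<equiv> orth X (vec.span {u})"
  shows "card {v \<in> X. B v v = a} + q * card {y \<in> Y. B y y = a} = (q + 1) * card Y"
proof -
  let ?P = "vec.span {u}"
  have P: "vec.subspace ?P" "?P \<subseteq> X" "nondegenerate_on B ?P"
    using u X nondegenerate_span_singleton[of u] vec.span_minimal[of "{u}" X] by simp_all
  have "bij_betw (\<lambda>x. x *s u) UNIV ?P"
    using u(2) by (intro bij_betw_imageI) (auto simp: inj_on_def vec.span_singleton)
  then have "bij_betw (map_prod (\<lambda>x. x *s u) id) (UNIV \<times> Y) (?P \<times> Y)"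
    by (intro bij_betw_map_prod) auto
  from bij_betw_trans[OF this orth_decomposition[OF X(1) P, folded Y_def]]
  have bij: "bij_betw (\<lambda>(x, y). x *s u + y) (UNIV \<times> Y) X"
    by (simp add: comp_def map_prod_def case_prod_unfold)
  have val: "B (x *s u + y) (x *s u + y) = x ^ (q + 1) + B y y" if "y \<in> Y" for x y
  proof -
    have "B y u = 0" using that vec.span_base[of u "{u}"] by (auto simp: Y_def orth_def)
    then show ?thesis
      using u eq_0_commute by (simp add: add_left add_right scale_left scale_right)
  qed
  have "bij_betw (\<lambda>(x, y). x *s u + y) {(x, y) \<in> UNIV \<times> Y. x ^ (q + 1) + B y y = a} {v \<in> X. B v v = a}"
  proof (rule bij_betw_subset[OF bij])
    show "(\<lambda>(x, y). x *s u + y) ` {(x, y) \<in> UNIV \<times> Y. x ^ (q + 1) + B y y = a} = {v \<in> X. B v v = a}"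
      using bij_betw_imp_surj_on[OF bij] val by (auto simp del: power_Suc)
  qed auto
  from bij_betw_same_card[OF this]
  have "card {v \<in> X. B v v = a} = card {(x, y) \<in> UNIV \<times> Y. x ^ (q + 1) + B y y = a}" by simp
  also have "\<dots> = card (SIGMA y:Y. {x. x ^ (q + 1) = a - B y y})"
    by (rule bij_betw_same_card[of prod.swap]) (auto simp: bij_betw_def image_iff eq_diff_eq simp del: power_Suc)
  also have "\<dots> = (\<Sum>y\<in>Y. card {x. x ^ (q + 1) = a - B y y})" by (simp add: card_SigmaI)
  also have "\<dots> = (\<Sum>y\<in>Y. if B y y = a then 1 else q + 1)"
  proof (rule sum.cong[OF refl])
    fix y
    have "a - B y y \<in> fixed" using a form_fixed[of y] by (simp add: fixed_def frob_diff)
    then show "card {x. x ^ (q + 1) = a - B y y} = (if B y y = a then 1 else q + 1)"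
      using card_norm_fiber[of "a - B y y"] by (simp del: power_Suc)
  qed
  also have "\<dots> = card {y \<in> Y. B y y = a} + (q + 1) * card {y \<in> Y. B y y \<noteq> a}"
    by (subst sum.If_cases) (simp_all add: Int_def Collect_neg_eq[symmetric])
  finally have 1: "card {v \<in> X. B v v = a} = \<dots>" .
  have "card Y = card ({y \<in> Y. B y y = a} \<union> {y \<in> Y. B y y \<noteq> a})"
    by (rule arg_cong[where f = card]) auto
  also have "\<dots> = card {y \<in> Y. B y y = a} + card {y \<in> Y. B y y \<noteq> a}"
    by (rule card_Un_disjoint) auto
  finally show ?thesis unfolding 1 by (simp add: algebra_simps)
qed

text \<open>Splitting off a nonisotropic line multiplies the deviation from the main term by
  \<open>- q\<close>, hence the power of \<open>- q\<close>. The equation is scaled by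
  \<open>q\<close> so that it also makes sense in dimension 0.\<close>

lemma card_norm:
  assumes "vec.subspace X" "nondegenerate_on B X" and a: "a \<in> fixed"
  shows "int q * int (card {v \<in> X. B v v = a})
    = int q ^ (2 * vec.dim X) + (- int q) ^ vec.dim X * (if a = 0 then int q - 1 else - 1)"
  using assms(1,2)
proof (induction "vec.dim X" arbitrary: X)
  case 0
  then have "X = {0}" using subspace_eq_zero_of_dim by metis
  moreover have "{v \<in> {0}. B v v = a} = (if a = 0 then {0} else {})" by auto
  ultimately show ?case by simp
next
  case (Suc m)
  obtain u where u: "u \<in> X" "B u u = 1" using nonisotropic_vector Suc.prems Suc.hyps(2) by (metis zero_less_Suc)
  let ?P = "vec.span {u}" and ?Y = "orth X (vec.span {u})"
  have P: "vec.subspace ?P" "?P \<subseteq> X" "nondegenerate_on B ?P"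
    using u Suc.prems nondegenerate_span_singleton[of u] vec.span_minimal[of "{u}" X] by simp_all
  have sub: "vec.subspace ?Y" using Suc.prems by (intro subspace_orth)
  have "u \<noteq> 0" using u(2) by auto
  then have dY: "vec.dim ?Y = m"
    using dim_orth[OF Suc.prems(1) P] Suc.hyps(2) by (simp add: dim_span_singleton)
  define d where "d = (if a = 0 then int q - 1 else - 1)"
  have IH: "int q * int (card {v \<in> ?Y. B v v = a}) = int q ^ (2 * m) + (- int q) ^ m * d"
    using Suc.hyps(1)[of ?Y] dY sub nondegenerate_orth[OF Suc.prems P] by (simp add: d_def)
  have "card ?Y = q ^ (2 * m)" using card_subspace[OF sub] dY card_field by (simp add: power_mult)
  then have "int (card {v \<in> X. B v v = a}) + int q * int (card {y \<in> ?Y. B y y = a})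
      = (int q + 1) * int q ^ (2 * m)"
    using arg_cong[OF card_norm_step[OF Suc.prems u a], of int] by (simp add: distrib_right)
  then have "int (card {v \<in> X. B v v = a}) = int q * int q ^ (2 * m) - (- int q) ^ m * d"
    using IH by (simp add: algebra_simps)
  from arg_cong[OF this, of "(*) (int q)"]
  have "int q * int (card {v \<in> X. B v v = a}) = int q ^ (2 * Suc m) + (- int q) ^ Suc m * d"
    by (simp add: algebra_simps)
  then show ?case unfolding Suc.hyps(2)[symmetric] d_def .
qed

text \<open>The map is \<open>x \<mapsto> x - B x w / B u w \<cdot> w\<close> with \<open>w = u - v\<close>; if \<open>w\<close> is isotropic it is a transvection.\<close>

lemma reflection:
  assumes eq: "B u u = B v v" and ne: "B u v \<noteq> B u u"
  obtains g where "isometry g" "g u = v"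
proof -
  define w where "w = u - v"
  define b where "b = B u w"
  have b: "b \<noteq> 0" using ne by (simp add: b_def w_def diff_right)
  define g where "g x = x - (B x w / b) *s w" for x
  have bq: "b ^ q = B w u" unfolding b_def by (rule hermitian[symmetric])
  \<comment> \<open>Equality of the norms enters here: it makes \<open>B w w\<close> the trace of
    \<open>b\<close>, which is exactly what cancels the mixed terms below.\<close>
  have "B w w = b + B w u"
    unfolding b_def w_def using eq by (simp add: diff_left diff_right)
  then have ww: "B w w = b + b ^ q" by (simp only: bq)
  have "isometry g"
  proof (rule isometryI[OF nondeg])
    show "g (x + y) = g x + g y" "g (c *s x) = c *s g x" for x y c
      by (simp_all add: g_def add_left scale_left add_divide_distrib vec.scale_left_distrib vec.scale_right_diff_distrib)
    fix x y
    have "(B y w / b) ^ q = B w y / b ^ q" using hermitian[of w y] by (simp add: power_divide)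
    then have "B (g x) (g y) = B x y - B x w * B w y / b ^ q - B x w / b * B w y + B x w / b * (B w y / b ^ q) * B w w"
      by (simp add: g_def diff_left diff_right scale_left scale_right algebra_simps)
    also have "\<dots> = B x y" unfolding ww using b by (simp add: field_simps)
    finally show "B (g x) (g y) = B x y" .
  qed
  moreover have "g u = v" using b by (simp add: g_def b_def[symmetric]) (simp add: w_def)
  ultimately show ?thesis using that by blast
qed

text \<open>One such map moves \<open>u\<close> to \<open>v\<close> unless
  \<open>B u v = B u u\<close>. In that case two of them are composed through an intermediate vector
  \<open>w\<close> of the same norm.\<close>

lemma isometry_transitive:
  assumes uv: "u \<noteq> 0" "v \<noteq> 0" and eq: "B u u = B v v"
  obtains g where "isometry g" "g u = v"
proof (cases "B u v = B u u")
  case False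
  then show ?thesis using reflection[OF eq] that by blast
next
  case True
  have "\<exists>w. B w w = B u u \<and> B u w \<noteq> B u u \<and> B w v \<noteq> B w w"
  proof (cases "B u u = 0")
    case False
    \<comment> \<open>There are \<open>q + 1\<close> scalars of norm 1; any of them other than 1
      gives a suitable multiple \<open>w\<close> of \<open>u\<close>.\<close>
    have "1 < card {x :: 'a. x ^ (q + 1) = 1}" using card_norm_fiber[of 1] q by (simp add: fixed_def)
    then have "{x :: 'a. x ^ (q + 1) = 1} \<noteq> {1}" by auto
    then obtain z :: 'a where z: "z ^ (q + 1) = 1" "z \<noteq> 1" by auto
    then have "z ^ q \<noteq> 1" by auto
    moreover have "z * z ^ q = 1" "z ^ q * z = 1" using z by (simp_all add: mult.commute)
    ultimately show ?thesis
      using z False True by (intro exI[of _ "z *s u"]) (simp add: scale_left scale_right mult.assoc[symmetric])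
  next
    case z: True
    obtain x where x: "B u x \<noteq> 0" "B v x \<noteq> 0" using common_nonorthogonal[OF nondeg uv] .
    have "- B x x \<in> fixed" using form_fixed[of x] by (simp add: fixed_def frob_minus)
    then obtain s where s: "s + s ^ q = - B x x" using trace_surj by blast
    \<comment> \<open>The trace of \<open>s\<close> cancels \<open>B x x\<close>, so
      \<open>w\<close> is isotropic. Adding a multiple of \<open>u\<close> leaves the products with
      \<open>u\<close> and \<open>v\<close> unchanged, as \<open>u\<close> is orthogonal to
      both.\<close>
    define w where "w = x + (s / B u x) *s u"
    have "B w w = B x x + ((s / B u x) * B u x + ((s / B u x) * B u x) ^ q)"
      using z hermitian[of x u] by (simp add: w_def add_left add_right scale_left scale_right power_divide)
    then have "B w w = 0" using s x by simp
    moreover have "B u w = B u x" using z by (simp add: w_def add_right scale_right)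
    moreover have "B w v = B x v" using z True by (simp add: w_def add_left scale_left)
    ultimately show ?thesis using x z eq_0_commute by metis
  qed
  then obtain w where w: "B w w = B u u" "B u w \<noteq> B u u" "B w v \<noteq> B w w" by blast
  obtain g where "isometry g" "g u = w" using reflection[of u w] w by metis
  moreover obtain h where "isometry h" "h w = v" using reflection[of w v] w eq by metis
  ultimately show ?thesis using that[of "h \<circ> g"] isometry_compose by simp
qed

lemma nondegenerate_subspace_exists:
  assumes "n \<le> CARD('d)"
  shows "nondegenerate_subspaces B n \<noteq> {}"
  using assms
proof (induction n)
  case 0
  have "{0} \<in> nondegenerate_subspaces B 0" by (simp add: nondegenerate_subspaces_def nondegenerate_on_zero)
  then show ?case by blast
next
  case (Suc n)
  then obtain U where U: "vec.subspace U" "vec.dim U = n" "nondegenerate_on B U"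
    by (auto simp: nondegenerate_subspaces_def)
  have "vec.dim (orth UNIV U) > 0"
    using dim_orth[OF vec.subspace_UNIV U(1) _ U(3)] U(2) Suc.prems vec_dim_card[where 'a='a and 'n='d] by simp
  then obtain u where u: "u \<in> orth UNIV U" "B u u = 1"
    using nonisotropic_vector[OF subspace_orth[OF vec.subspace_UNIV] nondegenerate_orth[OF vec.subspace_UNIV nondeg U(1) _ U(3)]]
    by auto
  have u0: "u \<noteq> 0" using u by auto
  let ?W = "{z + y |z y. z \<in> U \<and> y \<in> vec.span {u}}"
  have o: "B y z = 0" if "y \<in> vec.span {u}" "z \<in> U" for y z
    using that u by (auto simp: vec.span_singleton orth_def scale_left)
  have "vec.subspace ?W" using U by (intro vec.subspace_sums) auto
  moreover have "vec.dim ?W = Suc n"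
    using dim_sum_orthogonal[OF U(1,3) vec.subspace_span o] U(2) dim_span_singleton[OF u0] by simp
  moreover have "nondegenerate_on B ?W"
    using u by (intro nondegenerate_sum_orthogonal[OF U(1,3) _ _ o] nondegenerate_span_singleton) auto
  ultimately have "?W \<in> nondegenerate_subspaces B (Suc n)" by (simp add: nondegenerate_subspaces_def)
  then show ?case by blast
qed

end

section \<open>Level sets of quadratic forms\<close>

lemma exists_nonzero:
  assumes "vec.dim X \<noteq> 0"
  obtains w where "w \<in> X" "w \<noteq> 0"
proof -
  have "\<not> X \<subseteq> {0}" using assms vec.dim_eq_0[of X] by simp
  then show ?thesis using that by blast
qed

text \<open>Every line through the point \<open>(1, 0)\<close> of the conic meets it in at most one further point.\<close>

lemma card_conic_le:
  fixes a b c :: "'a::{field,finite}"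
  assumes a: "a \<noteq> 0" and irred: "\<And>s. a * s\<^sup>2 + b * s + c \<noteq> 0"
  shows "card {(y, z). a * y\<^sup>2 + b * y * z + c * z\<^sup>2 = a} \<le> CARD('a) + 1"
proof -
  \<comment> \<open>A point is coded by the direction of its line to \<open>(1, 0)\<close>. The
    point \<open>(1, 0)\<close> itself receives the tangent direction. The horizontal direction is
    \<open>None\<close>; it belongs to \<open>(-1, 0)\<close>, which in characteristic 2 is the same
    as \<open>(1, 0)\<close>.\<close>
  define f where "f = (\<lambda>(y, z). if z \<noteq> 0 then Some ((y - 1) / z)
    else if y = 1 \<and> (2 :: 'a) \<noteq> 0 then Some (- b / (2 * a)) else None)"
  let ?A = "{(y, z). a * y\<^sup>2 + b * y * z + c * z\<^sup>2 = a}"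
  \<comment> \<open>Substituting \<open>y = 1 + s * z\<close> and dividing by \<open>z\<close>
    leaves an equation linear in \<open>z\<close>. The coefficient of \<open>z\<close> never
    vanishes by \<open>irred\<close>, so the direction determines the point.\<close>
  have slope: "2 * a * s + b + z * (a * s\<^sup>2 + b * s + c) = 0"
    if "(y, z) \<in> ?A" "z \<noteq> 0" "s = (y - 1) / z" for y z s
  proof -
    have y: "y = 1 + s * z" using that by simp
    have "z * (2 * a * s + b + z * (a * s\<^sup>2 + b * s + c)) = a * y\<^sup>2 + b * y * z + c * z\<^sup>2 - a"
      unfolding y by (simp add: power2_eq_square algebra_simps)
    also have "\<dots> = 0" using that by simp
    finally show ?thesis using that(2) by simp
  qed
  have y1: "y = 1 \<or> y = - 1" if "(y, 0) \<in> ?A" for y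
  proof -
    have "a * y\<^sup>2 = a" using that by simp
    then have "y\<^sup>2 = 1" using a by simp
    then show ?thesis by (simp add: power2_eq_1_iff)
  qed
  have "inj_on f ?A"
  proof (rule inj_onI)
    fix p p' assume pp: "p \<in> ?A" "p' \<in> ?A" "f p = f p'"
    obtain y z y' z' where p: "p = (y, z)" "p' = (y', z')" by (cases p, cases p')
    have A: "(y, z) \<in> ?A" "(y', z') \<in> ?A" and eq: "f (y, z) = f (y', z')"
      using pp unfolding p by simp_all
    have no: "\<not> (z \<noteq> 0 \<and> z' = 0)" if "(y, z) \<in> ?A" "(y', z') \<in> ?A" "f (y, z) = f (y', z')" for y z y' z'
    proof
      assume z: "z \<noteq> 0 \<and> z' = 0"
      then have 2: "(2 :: 'a) \<noteq> 0" "(y - 1) / z = - b / (2 * a)"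
        using that(3) by (auto simp: f_def split: if_splits)
      define s where "s = (y - 1) / z"
      have "2 * a * s + b = 0" using 2 a by (simp add: s_def)
      then have "z * (a * s\<^sup>2 + b * s + c) = 0" using slope[OF that(1) _ s_def] z by simp
      then show False using irred[of s] z by simp
    qed
    have no1: "\<not> (z \<noteq> 0 \<and> z' = 0)" by (rule no[OF A eq])
    have no2: "\<not> (z' \<noteq> 0 \<and> z = 0)" by (rule no[OF A(2,1) eq[symmetric]])
    have "y = y' \<and> z = z'"
    proof (cases "z = 0")
      case True
      then have z': "z' = 0" using no2 by blast
      have "y = 1 \<or> y = - 1" "y' = 1 \<or> y' = - 1" using y1 A True z' by blast+
      moreover have "(1 :: 'a) = - 1 \<longleftrightarrow> (2 :: 'a) = 0"
        by (metis add.inverse_inverse eq_neg_iff_add_eq_0 one_add_one)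
      ultimately show ?thesis using eq True z' by (auto simp: f_def split: if_splits)
    next
      case False
      then have z': "z' \<noteq> 0" using no1 by blast
      define s where "s = (y - 1) / z"
      have s': "s = (y' - 1) / z'" using eq False z' by (simp add: f_def s_def)
      have "z * (a * s\<^sup>2 + b * s + c) = z' * (a * s\<^sup>2 + b * s + c)"
        using slope[OF A(1) False s_def] slope[OF A(2) z' s'] by (metis add_left_cancel)
      then have "z = z'" using irred[of s] by simp
      moreover have "y = 1 + s * z" using False by (simp add: s_def)
      moreover have "y' = 1 + s * z'" using z' by (simp add: s')
      ultimately show ?thesis by simp
    qed
    then show "p = p'" by (simp add: p)
  qed
  then have "card ?A \<le> card (UNIV :: 'a option set)" by (rule card_inj_on_le) auto
  then show ?thesis by (simp add: card_UNIV_option)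
qed

lemma card_mult_eq:
  fixes c :: "'a::{field,finite}"
  shows "card {(x, y). x * y = c} = CARD('a) - 1 + (if c = 0 then CARD('a) else 0)"
proof -
  have 1: "card {y. x * y = c} = (if x = 0 then if c = 0 then CARD('a) else 0 else 1)" for x
  proof (cases "x = 0")
    case False
    then have "{y. x * y = c} = {c / x}" by (auto simp: field_simps)
    then show ?thesis using False by simp
  qed auto
  have "card {(x, y). x * y = c} = card (SIGMA x:UNIV. {y. x * y = c})"
    by (rule arg_cong[where f = card]) auto
  also have "\<dots> = (\<Sum>x\<in>(UNIV :: 'a set). if x = 0 then if c = 0 then CARD('a) else 0 else 1)"
    by (simp add: card_SigmaI 1)
  also have "\<dots> = (if c = 0 then CARD('a) else 0) + (\<Sum>x\<in>UNIV - {0 :: 'a}. 1)"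
    by (subst sum.remove[of _ 0]) (auto intro!: sum.cong)
  finally show ?thesis by simp
qed

locale quadratic_space =
  fixes Q :: "'a::{field,finite} ^ 'd \<Rightarrow> 'a"
  assumes quadratic: "quadratic_form Q" and nondeg: "nondegenerate_on (polar_form Q) UNIV"
begin

abbreviation "\<beta> \<equiv> polar_form Q"

lemma polar_commute: "\<beta> u v = \<beta> v u"
  by (simp add: polar_form_def add.commute)

lemma polar_add_left: "\<beta> (u + v) w = \<beta> u w + \<beta> v w"
  and polar_scale_left: "\<beta> (c *s u) w = c * \<beta> u w"
proof -
  have "Vector_Spaces.linear (*s) (*) (\<lambda>u. \<beta> u w)"
    using quadratic by (simp add: quadratic_form_def bilinear_form_def)
  then interpret l: Vector_Spaces.linear "(*s)" "(*)" "\<lambda>u. \<beta> u w" .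
  show "\<beta> (u + v) w = \<beta> u w + \<beta> v w" "\<beta> (c *s u) w = c * \<beta> u w"
    by (rule l.add l.scale)+
qed

end

sublocale quadratic_space \<subseteq> reflexive_form "polar_form Q"
  by standard (metis polar_add_left polar_scale_left polar_commute)+

context quadratic_space
begin

lemma scale_right: "\<beta> u (c *s v) = c * \<beta> u v"
  by (metis polar_commute scale_left)

lemma Q_scale: "Q (c *s u) = c\<^sup>2 * Q u"
  using quadratic by (simp add: quadratic_form_def)

lemma Q_zero [simp]: "Q 0 = 0"
  using Q_scale[of 0 0] by simp

lemma Q_add: "Q (u + v) = Q u + Q v + \<beta> u v"
  by (simp add: polar_form_def)

lemma polar_self: "\<beta> u u = 2 * Q u"
proof -
  have "u + u = 2 *s u" by (metis one_add_one vec.scale_left_distrib vec.scale_one)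
  then show ?thesis using Q_scale[of 2 u] by (simp add: polar_form_def power2_eq_square)
qed

lemma Q_minus: "Q (- u) = Q u"
  using Q_scale[of "- 1" u] by simp

lemma Q_diff: "Q (u - v) = Q u + Q v - \<beta> u v"
  using Q_add[of u "- v"] by (simp add: Q_minus minus_right)

definition level :: "('a ^ 'd) set \<Rightarrow> 'a \<Rightarrow> ('a ^ 'd) set" where
  "level X a = {x \<in> X. Q x = a}"

lemma hyperbolic_partner:
  assumes X: "vec.subspace X" "nondegenerate_on \<beta> X" and e: "e \<in> X" "e \<noteq> 0" "Q e = 0"
  obtains f where "f \<in> X" "Q f = 0" "\<beta> e f = 1"
proof -
  obtain f where f: "f \<in> X" "\<beta> e f \<noteq> 0" using nondegenerate_onD[OF X(2) e(1)] e(2) by blast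
  define g where "g = (1 / \<beta> e f) *s f"
  have g: "g \<in> X" "\<beta> e g = 1" using f X by (simp_all add: g_def scale_right vec.subspace_scale)
  have "g - Q g *s e \<in> X" using g e X by (simp add: vec.subspace_diff vec.subspace_scale)
  moreover have "Q (g - Q g *s e) = 0"
    using g e polar_commute[of g e] by (simp add: Q_diff Q_scale scale_right)
  moreover have "\<beta> e (g - Q g *s e) = 1" using g e by (simp add: diff_right scale_right polar_self)
  ultimately show ?thesis using that by blast
qed

lemma hyperbolic_pair:
  assumes X: "vec.subspace X" "nondegenerate_on \<beta> X"
    and ef: "e \<in> X" "f \<in> X" "Q e = 0" "Q f = 0" "\<beta> e f = 1"
  defines "Y \<equiv> orth X (vec.span {e, f})"
  shows "vec.subspace (vec.span {e, f})" "vec.span {e, f} \<subseteq> X" "nondegenerate_on \<beta> (vec.span {e, f})"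
    and "vec.subspace Y" "nondegenerate_on \<beta> Y" "vec.dim X = vec.dim Y + 2"
proof -
  let ?P = "vec.span {e, f}"
  show s: "vec.subspace ?P" by simp
  show PX: "?P \<subseteq> X" using span_pair_subset[OF X(1)] ef by blast
  show n: "nondegenerate_on \<beta> ?P" using ef by (intro nondegenerate_isotropic_pair) (simp_all add: polar_self)
  have "vec.dim ?P = 2" using ef by (intro dim_isotropic_pair) (simp_all add: polar_self)
  then show "vec.dim X = vec.dim Y + 2" using dim_orth[OF X(1) s PX n] by (simp add: Y_def)
  show "vec.subspace Y" "nondegenerate_on \<beta> Y"
    using subspace_orth[OF X(1)] nondegenerate_orth[OF X s PX n] by (simp_all add: Y_def)
qed

text \<open>Over a fixed \<open>z\<close> in \<open>Y\<close> the two coordinates satisfy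
  \<open>x * y = a - Q z\<close>, which has \<open>CARD('a) - 1\<close> solutions, and
  \<open>CARD('a)\<close> more if the right-hand side is 0.\<close>

lemma card_level_hyperbolic:
  assumes X: "vec.subspace X" "nondegenerate_on \<beta> X"
    and ef: "e \<in> X" "f \<in> X" "Q e = 0" "Q f = 0" "\<beta> e f = 1"
  defines "Y \<equiv> orth X (vec.span {e, f})"
  shows "card (level X a) = (CARD('a) - 1) * card Y + CARD('a) * card (level Y a)"
proof -
  let ?P = "vec.span {e, f}"
  note P = hyperbolic_pair(1-3)[OF X ef]
  have fe: "\<beta> f e = 1" using ef polar_commute by metis
  have "inj_on (\<lambda>(x, y). x *s e + y *s f) UNIV"
  proof (rule inj_onI, clarify)
    fix x y x' y' assume eq: "x *s e + y *s f = x' *s e + y' *s f"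
    from arg_cong[OF eq, of "\<lambda>v. \<beta> v f"] arg_cong[OF eq, of "\<lambda>v. \<beta> v e"] show "x = x' \<and> y = y'"
      using ef fe by (simp add: add_left scale_left polar_self)
  qed
  then have "bij_betw (\<lambda>(x, y). x *s e + y *s f) UNIV ?P"
    by (rule bij_betw_imageI) (auto simp: span_pair image_iff)
  then have "bij_betw (map_prod (\<lambda>(x, y). x *s e + y *s f) id) (UNIV \<times> Y) (?P \<times> Y)"
    by (intro bij_betw_map_prod) auto
  from bij_betw_trans[OF this orth_decomposition[OF X(1) P, folded Y_def]]
  have bij: "bij_betw (\<lambda>((x, y), z). x *s e + y *s f + z) (UNIV \<times> Y) X"
    by (simp add: comp_def map_prod_def case_prod_unfold)
  have val: "Q (x *s e + y *s f + z) = x * y + Q z" if "z \<in> Y" for x y z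
  proof -
    have "x *s e + y *s f \<in> ?P" by (auto simp: span_pair)
    then have "\<beta> (x *s e + y *s f) z = 0" using orthD(2) that eq_0_commute unfolding Y_def by blast
    then show ?thesis using ef by (simp add: Q_add Q_scale scale_left scale_right)
  qed
  let ?f = "\<lambda>((x, y), z). x *s e + y *s f + z"
  have "level X a = ?f ` {p \<in> UNIV \<times> Y. Q (?f p) = a}"
    unfolding level_def bij_betw_imp_surj_on[OF bij, symmetric] by blast
  moreover have "{p \<in> UNIV \<times> Y. Q (?f p) = a} = {((x, y), z). z \<in> Y \<and> x * y + Q z = a}"
    using val by auto
  ultimately have "bij_betw ?f {((x, y), z). z \<in> Y \<and> x * y + Q z = a} (level X a)"
    by (intro bij_betw_subset[OF bij]) auto
  from bij_betw_same_card[OF this]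
  have "card (level X a) = card {((x, y), z). z \<in> Y \<and> x * y + Q z = a}" by simp
  also have "\<dots> = card (SIGMA z:Y. {(x, y). x * y = a - Q z})"
    by (rule bij_betw_same_card[of prod.swap]) (auto simp: bij_betw_def image_iff eq_diff_eq)
  also have "\<dots> = (\<Sum>z\<in>Y. CARD('a) - 1 + (if Q z = a then CARD('a) else 0))"
    by (subst card_SigmaI) (auto simp: card_mult_eq intro!: sum.cong)
  also have "\<dots> = (\<Sum>z\<in>Y. CARD('a) - 1) + (\<Sum>z\<in>Y. if Q z = a then CARD('a) else 0)"
    by (rule sum.distrib)
  also have "\<dots> = (CARD('a) - 1) * card Y + CARD('a) * card (level Y a)"
    by (simp add: sum.If_cases level_def Int_def)
  finally show ?thesis .
qed

lemma level_zero_anisotropic: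
  assumes "vec.subspace X" "\<And>x. x \<in> X \<Longrightarrow> Q x = 0 \<Longrightarrow> x = 0"
  shows "level X 0 = {0}"
  using assms vec.subspace_0 by (auto simp: level_def)

lemma card_eq_sum_level: "card X = (\<Sum>a\<in>UNIV. card (level X a))"
  using sum.group[of X UNIV Q "\<lambda>_. 1 :: nat"] by (simp add: level_def)

text \<open>With \<open>q\<close> the order of the field, each of the \<open>q - 1\<close> nonzero
  levels has at most \<open>q + 1\<close> points by the conic bound, and together they contain all
  \<open>q^2 - 1\<close> nonzero vectors. So every bound is attained.\<close>

lemma card_level_anisotropic_plane:
  assumes X: "vec.subspace X" "vec.dim X = 2" and aniso: "\<And>x. x \<in> X \<Longrightarrow> Q x = 0 \<Longrightarrow> x = 0" and a: "a \<noteq> 0"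
  shows "card (level X a) = CARD('a) + 1"
proof (rule eq_of_sum_ge[where A = "- {0}" and x = a and f = "\<lambda>a. card (level X a)"])
  fix a :: 'a assume a: "a \<in> - {0}"
  show "card (level X a) \<le> CARD('a) + 1"
  proof (cases "level X a = {}")
    case False
    then obtain u where u: "u \<in> X" "Q u = a" by (auto simp: level_def)
    have u0: "u \<noteq> 0" using u a by auto
    have "\<not> X \<subseteq> vec.span {u}"
      using vec.dim_subset[of X "vec.span {u}"] dim_span_singleton[OF u0] X(2) by auto
    then obtain v where v: "v \<in> X" "v \<notin> vec.span {u}" by blast
    have uv: "u \<notin> vec.span {v}"
    proof
      assume "u \<in> vec.span {v}"
      then obtain k where k: "u = k *s v" by (auto simp: vec.span_singleton)
      then have "k \<noteq> 0" using u0 by auto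
      then have "v = (1 / k) *s u" by (simp add: k)
      then show False using v(2) by (auto simp: vec.span_singleton)
    qed
    have "v \<noteq> 0" using v(2) vec.span_zero by metis
    then have ind: "vec.independent {u, v}" using uv by (simp add: vec.independent_insert)
    have "u \<noteq> v" using v(2) vec.span_base[of u "{u}"] by auto
    then have "vec.dim (vec.span {u, v}) = 2"
      using vec.dim_span_eq_card_independent[OF ind] by simp
    then have span: "vec.span {u, v} = X"
      using span_pair_subset[OF X(1) u(1) v(1)] X by (intro vec.subspace_dim_equal) auto
    have Q: "Q (y *s u + z *s v) = a * y\<^sup>2 + \<beta> u v * y * z + Q v * z\<^sup>2" for y z
      using u(2) by (simp add: Q_add Q_scale scale_left scale_right mult_ac)
    have irred: "a * s\<^sup>2 + \<beta> u v * s + Q v \<noteq> 0" for s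
    proof
      assume "a * s\<^sup>2 + \<beta> u v * s + Q v = 0"
      then have "Q (s *s u + 1 *s v) = 0" using Q[of s 1] by simp
      moreover have "s *s u + 1 *s v \<in> X" using u v X by (intro vec.subspace_add vec.subspace_scale)
      ultimately have "s *s u + v = 0" using aniso by simp
      then have "v = (- s) *s u" by (simp add: eq_neg_iff_add_eq_0 add.commute)
      moreover have "(- s) *s u \<in> vec.span {u}" by (intro vec.span_scale vec.span_base) simp
      ultimately have "v \<in> vec.span {u}" by (simp only:)
      with v(2) show False by blast
    qed
    have "level X a \<subseteq> (\<lambda>(y, z). y *s u + z *s v) ` {(y, z). a * y\<^sup>2 + \<beta> u v * y * z + Q v * z\<^sup>2 = a}"
    proof
      fix x assume "x \<in> level X a"
      then obtain y z where "x = y *s u + z *s v" "Q x = a" using span span_pair[of u v] by (auto simp: level_def)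
      then show "x \<in> (\<lambda>(y, z). y *s u + z *s v) ` {(y, z). a * y\<^sup>2 + \<beta> u v * y * z + Q v * z\<^sup>2 = a}"
        using Q by (intro image_eqI[of _ _ "(y, z)"]) auto
    qed
    then have "card (level X a) \<le> card {(y, z). a * y\<^sup>2 + \<beta> u v * y * z + Q v * z\<^sup>2 = a}"
      by (rule surj_card_le[rotated]) simp
    also have "\<dots> \<le> CARD('a) + 1" using a irred by (intro card_conic_le) auto
    finally show ?thesis .
  qed simp
next
  have "CARD('a) ^ 2 = (\<Sum>a\<in>UNIV. card (level X a))"
    using card_eq_sum_level[of X] card_subspace[OF X(1)] X(2) by simp
  also have "\<dots> = card (level X 0) + (\<Sum>a\<in>UNIV - {0}. card (level X a))"
    by (subst sum.remove[of _ 0]) auto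
  also have "card (level X 0) = 1" using level_zero_anisotropic[OF X(1)] aniso by simp
  also have "UNIV - {0 :: 'a} = - {0}" by auto
  finally have "CARD('a) ^ 2 = 1 + (\<Sum>a\<in>- {0}. card (level X a))" .
  moreover have "card (- {0 :: 'a}) * (CARD('a) + 1) + 1 = CARD('a) ^ 2"
    using one_less_CARD_field[where 'a='a]
    by (simp add: Compl_eq_Diff_UNIV algebra_simps power2_eq_square)
  ultimately show "card (- {0 :: 'a}) * (CARD('a) + 1) \<le> (\<Sum>a\<in>- {0}. card (level X a))" by linarith
qed (use a in auto)

text \<open>In characteristic 2 the polar form is alternating and any nonorthogonal pair spans such
  a plane. Otherwise \<open>\<beta> x x = 2 * Q x\<close> is nonzero for nonzero \<open>x\<close> in
  \<open>X\<close>, and two orthogonal vectors serve.\<close>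

lemma nondegenerate_plane_exists:
  assumes X: "vec.subspace X" "nondegenerate_on \<beta> X" "vec.dim X \<ge> 2"
    and aniso: "\<And>x. x \<in> X \<Longrightarrow> Q x = 0 \<Longrightarrow> x = 0"
  obtains P where "vec.subspace P" "P \<subseteq> X" "vec.dim P = 2" "nondegenerate_on \<beta> P"
proof -
  obtain u where u: "u \<in> X" "u \<noteq> 0" using X(3) by (auto intro: exists_nonzero[of X])
  obtain v where v: "v \<in> X" "\<beta> u v \<noteq> 0" using nondegenerate_onD[OF X(2) u(1)] u(2) by blast
  show ?thesis
  proof (cases "(2 :: 'a) = 0")
    case True
    then have "\<beta> u u = 0" "\<beta> v v = 0" by (simp_all add: polar_self)
    then show ?thesis
      using v u X span_pair_subset[OF X(1) u(1) v(1)]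
      by (intro that[of "vec.span {u, v}"] dim_isotropic_pair nondegenerate_isotropic_pair) simp_all
  next
    case False
    have ne: "\<beta> x x \<noteq> 0" if "x \<in> X" "x \<noteq> 0" for x using aniso that False by (auto simp: polar_self)
    note U = vec.subspace_span[of "{u}"] vec.span_minimal[of "{u}" X] nondegenerate_span_singleton[OF ne[OF u]]
    have UX: "vec.span {u} \<subseteq> X" using U(2) u X by simp
    have "vec.dim (orth X (vec.span {u})) \<noteq> 0"
      using dim_orth[OF X(1) U(1) UX U(3)] dim_span_singleton[OF u(2)] X(3) by linarith
    then obtain w where w: "w \<in> orth X (vec.span {u})" "w \<noteq> 0" by (rule exists_nonzero)
    then have wX: "w \<in> X" using orth_subset by blast
    have o: "\<beta> y z = 0" if yz: "y \<in> vec.span {w}" "z \<in> vec.span {u}" for y z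
    proof -
      obtain k where "y = k *s w" using yz(1) by (auto simp: vec.span_singleton)
      then show ?thesis using orthD(2)[OF w(1) yz(2)] by (simp add: scale_left)
    qed
    let ?P = "{z + y |z y. z \<in> vec.span {u} \<and> y \<in> vec.span {w}}"
    show ?thesis
    proof (rule that[of ?P])
      show "vec.subspace ?P" by (intro vec.subspace_sums) auto
      have "vec.span {w} \<subseteq> X" using wX X(1) by (intro vec.span_minimal) auto
      then show "?P \<subseteq> X" using UX vec.subspace_add[OF X(1)] by blast
      show "vec.dim ?P = 2"
        using dim_sum_orthogonal[OF U(1,3) vec.subspace_span o] dim_span_singleton u w by simp
      show "nondegenerate_on \<beta> ?P"
        by (intro nondegenerate_sum_orthogonal[OF U(1,3) _ _ o] nondegenerate_span_singleton ne wX w) simp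
    qed
  qed
qed

text \<open>An anisotropic plane takes every nonzero value, in particular \<open>- Q w\<close> for a
  vector \<open>w\<close> orthogonal to it; the sum of the two vectors is then singular and
  nonzero.\<close>

lemma singular_vector_exists:
  assumes X: "vec.subspace X" "nondegenerate_on \<beta> X" "vec.dim X \<ge> 3"
  shows "\<exists>e. e \<in> X \<and> e \<noteq> 0 \<and> Q e = 0"
proof (rule ccontr)
  assume "\<not> ?thesis"
  then have aniso: "x = 0" if "x \<in> X" "Q x = 0" for x using that by blast
  have "vec.dim X \<ge> 2" using X(3) by simp
  then obtain P where P: "vec.subspace P" "P \<subseteq> X" "vec.dim P = 2" "nondegenerate_on \<beta> P"
    by (rule nondegenerate_plane_exists[OF X(1,2) _ aniso])
  have "vec.dim (orth X P) \<noteq> 0" using dim_orth[OF X(1) P(1,2,4)] P(3) X(3) by linarith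
  then obtain w where w: "w \<in> orth X P" "w \<noteq> 0" by (rule exists_nonzero)
  have wX: "w \<in> X" using w orth_subset by blast
  then have Qw: "Q w \<noteq> 0" using aniso w by blast
  have "card (level P (- Q w)) = CARD('a) + 1"
    using Qw P aniso by (intro card_level_anisotropic_plane) auto
  then have "level P (- Q w) \<noteq> {}" by (intro notI) simp
  then obtain p where p: "p \<in> P" "Q p = - Q w" by (auto simp: level_def)
  have "Q (p + w) = 0" using p orthD(2)[OF w(1) p(1)] polar_commute[of p w] by (simp add: Q_add)
  moreover have "p + w \<in> X" using p P(2) wX X(1) by (auto intro: vec.subspace_add)
  ultimately have "p + w = 0" using aniso by blast
  then have "w = - p" by (simp add: eq_neg_iff_add_eq_0 add.commute)
  then have "w \<in> P" using p P(1) by (simp add: vec.subspace_neg)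
  then show False using Int_orth[OF P(4), of X] w by blast
qed

text \<open>Splitting off a hyperbolic plane multiplies the deviation of a level set from its expected size
  \<open>q ^ (m - 1)\<close> by \<open>q\<close>, whence these bounds from \<open>m = 1, 2\<close>.\<close>

definition level_error :: "nat \<Rightarrow> 'a \<Rightarrow> int" where
  "level_error m a = (if a \<noteq> 0 then int CARD('a) ^ ((m - 1) div 2)
     else if odd m then 0 else (int CARD('a) - 1) * int CARD('a) ^ ((m - 1) div 2))"

lemma card_level:
  assumes "vec.subspace X" "nondegenerate_on \<beta> X" "vec.dim X = m" "m \<ge> 1"
  shows "\<bar>int (card (level X a)) - int CARD('a) ^ (m - 1)\<bar> \<le> level_error m a"
  using assms
proof (induction m arbitrary: X rule: less_induct)
  case (less m)
  note X = less.prems(1,2)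
  let ?q = "int CARD('a)"
  have q: "?q > 1" using one_less_CARD_field[where 'a='a] by simp
  \<comment> \<open>Dimension at least 3 forces a singular vector, so without one only dimensions 1
    and 2 remain.\<close>
  consider "m = 1" | "m = 2" "\<And>x. x \<in> X \<Longrightarrow> Q x = 0 \<Longrightarrow> x = 0"
    | e where "m \<ge> 2" "e \<in> X" "e \<noteq> 0" "Q e = 0"
  proof -
    have "m = 1 \<or> m = 2 \<or> (\<exists>e. e \<in> X \<and> e \<noteq> 0 \<and> Q e = 0)"
      using singular_vector_exists[OF X] less.prems(3,4) by (cases "m \<ge> 3") auto
    then show ?thesis using that less.prems(4) by (cases "m = 1") (blast, fastforce)
  qed
  then show ?case
  proof cases
    case 1
    have "vec.dim X \<noteq> 0" using less.prems(3) 1 by simp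
    then obtain u where u: "u \<in> X" "u \<noteq> 0" by (rule exists_nonzero)
    have span: "vec.span {u} = X"
      using u X dim_span_singleton[OF u(2)] less.prems(3) 1 vec.span_minimal[of "{u}" X]
      by (intro vec.subspace_dim_equal) auto
    have "Q u \<noteq> 0"
      using form_nonzero_of_dim_1[OF X(1) _ X(2) u] less.prems(3) 1 by (auto simp: polar_self)
    have lev: "level X a = (\<lambda>k. k *s u) ` {k. k ^ 2 = a / Q u}"
      using \<open>Q u \<noteq> 0\<close> by (auto simp: level_def span[symmetric] vec.span_singleton Q_scale field_simps)
    have "card (level X a) \<le> card {k. k ^ 2 = 0 * k + a / Q u}"
      unfolding lev by (simp add: card_image_le)
    also have "\<dots> \<le> 2" by (rule card_power_eq_linear_le) simp
    finally have le: "card (level X a) \<le> 2" .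
    show ?thesis
    proof (cases "a = 0")
      case True
      then have "level X a = {0}" unfolding lev by auto
      then show ?thesis using 1 by (simp add: level_error_def)
    next
      case False
      then show ?thesis using le 1 by (simp add: level_error_def)
    qed
  next
    case 2
    have "level X 0 = {0}" using level_zero_anisotropic[OF X(1)] 2 by blast
    moreover have "card (level X a) = CARD('a) + 1" if "a \<noteq> 0"
      using card_level_anisotropic_plane[OF X(1)] that 2 less.prems(3) by blast
    ultimately show ?thesis using 2(1) q by (cases "a = 0") (simp_all add: level_error_def)
  next
    case 3
    obtain f where f: "f \<in> X" "Q f = 0" "\<beta> e f = 1" using hyperbolic_partner[OF X 3(2-4)] by blast
    define Y where "Y = orth X (vec.span {e, f})"
    note Y = hyperbolic_pair(4-6)[OF X 3(2) f(1) 3(4) f(2,3), folded Y_def]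
    have dY: "vec.dim Y = m - 2" using Y(3) less.prems(3) by simp
    have "int (card (level X a)) = int ((CARD('a) - 1) * card Y + CARD('a) * card (level Y a))"
      using card_level_hyperbolic[OF X 3(2) f(1) 3(4) f(2,3), folded Y_def, of a] by simp
    also have "\<dots> = (?q - 1) * ?q ^ (m - 2) + ?q * int (card (level Y a))"
      using card_subspace[OF Y(1)] dY q by (simp add: of_nat_diff)
    finally have rec: "int (card (level X a)) = \<dots>" .
    show ?thesis
    \<comment> \<open>For \<open>m = 2\<close> the complement \<open>Y\<close> has dimension 0,
      outside the range of the induction hypothesis.\<close>
    proof (cases "m = 2")
      case True
      then have "Y = {0}" using subspace_eq_zero_of_dim[OF Y(1)] dY by simp
      then have "level Y a = (if a = 0 then {0} else {})" by (auto simp: level_def)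
      then show ?thesis using True rec q by (simp add: level_error_def)
    next
      case False
      then have m: "m = Suc (Suc (Suc (m - 3)))" using 3(1) by simp
      have IH: "\<bar>int (card (level Y a)) - ?q ^ (m - 2 - 1)\<bar> \<le> level_error (m - 2) a"
        using False 3(1) by (intro less.IH Y dY) auto
      have "int (card (level X a)) - ?q ^ (m - 1) = ?q * (int (card (level Y a)) - ?q ^ (m - 2 - 1))"
        unfolding rec by (subst (1 2 3) m) (simp add: algebra_simps)
      then have "\<bar>int (card (level X a)) - ?q ^ (m - 1)\<bar> = ?q * \<bar>int (card (level Y a)) - ?q ^ (m - 2 - 1)\<bar>"
        by (simp add: abs_mult)
      also have "\<dots> \<le> ?q * level_error (m - 2) a" using IH q by (intro mult_left_mono) auto
      also have "\<dots> = level_error m a"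
        by (subst (1 2) m) (simp add: level_error_def)
      finally show ?thesis .
    qed
  qed
qed

end

section \<open>Proportions in symplectic and unitary spaces\<close>

lemma linear_form_add: "Vector_Spaces.linear (*s) (*) f \<Longrightarrow> f (x + y) = f x + f y"
  and linear_form_scale: "Vector_Spaces.linear (*s) (*) f \<Longrightarrow> f (c *s x) = c * f x"
  by (auto simp: Vector_Spaces.linear_iff)

lemma symplectic_formI:
  fixes B :: "'a::{field,finite} ^ 'd \<Rightarrow> 'a ^ 'd \<Rightarrow> 'a"
  assumes "alternating_form B"
  shows "symplectic_form B"
proof -
  have lin: "Vector_Spaces.linear (*s) (*) (\<lambda>u. B u v)" "Vector_Spaces.linear (*s) (*) (B u)" for u v
    using assms by (simp_all add: alternating_form_def bilinear_form_def)
  have alt: "B u u = 0" for u using assms by (simp add: alternating_form_def)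
  have addl: "B (u + v) w = B u w + B v w" and addr: "B u (v + w) = B u v + B u w" for u v w
    using linear_form_add[OF lin(1)[of w], of u v] linear_form_add[OF lin(2)] by simp_all
  show ?thesis
  proof
    fix u v assume "B u v = 0"
    moreover have "B u v + B v u = 0" using alt[of "u + v"] alt[of u] alt[of v] by (simp add: addl addr add.commute)
    ultimately show "B v u = 0" by simp
  qed (use linear_form_scale[OF lin(1)] in \<open>simp_all add: addl addr alt\<close>)
qed

text \<open>\<open>U\<close> plays the part of the avoided subspace. The estimate holds for every
  single \<open>U\<close> and is then summed.\<close>

lemma symplectic_proportion:
  fixes B :: "'a::{field,finite} ^ 'd \<Rightarrow> 'a ^ 'd \<Rightarrow> 'a"
  assumes alt: "alternating_form B" and nd: "nondegenerate_on B UNIV"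
    and dim: "CARD('d) = n + n'" and even: "even n" "even n'"
  shows "nondegenerate_subspaces B n' \<noteq> {}"
    and "real CARD('a) * real (card {(U, U'). (U, U') \<in> nondegenerate_subspaces B n \<times> nondegenerate_subspaces B n' \<and>
        U \<inter> U' \<noteq> {0}})
      \<le> 5 / 3 * real (card (nondegenerate_subspaces B n)) * real (card (nondegenerate_subspaces B n'))"
proof -
  interpret symplectic_form B using alt by (rule symplectic_formI)
  obtain k where k: "n' = 2 * k" using even(2) by blast
  have eq: "nondegenerate_subspaces B i = subspaces_in UNIV i" for i
    by (simp add: nondegenerate_subspaces_def subspaces_in_def)
  define q where "q = real CARD('a)"
  have q: "q \<ge> 2" using one_less_CARD_field[where 'a='a] by (simp add: q_def)
  let ?S = "nondegenerate_subspaces B n" and ?S' = "nondegenerate_subspaces B n'"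
  have "vec.dim (UNIV :: ('a ^ 'd) set) = n + 2 * k"
    using vec_dim_card[where 'a='a and 'n='d] dim k by simp
  then obtain K where K: "K > 0" "card ?S' = K"
    and KW: "\<And>W. vec.subspace W \<Longrightarrow> vec.dim W \<le> n \<Longrightarrow>
      (\<Prod>i=1..2 * k. 1 - (1 / q) ^ i) * real K \<le> real (card {U \<in> ?S'. U \<inter> W = {0}})"
    using avoiding_subspaces[of n k] nd vec.subspace_UNIV unfolding eq k q_def by blast
  show "?S' \<noteq> {}" using K by auto
  \<comment> \<open>For \<open>q \<ge> 2\<close> the sum of \<open>1 / q\<close> and its square is
    at most \<open>3 / (2 * q)\<close>, which is below \<open>5 / (3 * q)\<close>.\<close>
  have "1 - 5 / (3 * q) \<le> 1 - 1 / q - (1 / q)\<^sup>2"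
    using q by (simp add: power2_eq_square field_simps)
  also have "\<dots> \<le> (\<Prod>i=1..2 * k. 1 - (1 / q) ^ i)"
    using q by (intro prod_one_minus_power_ge) auto
  finally have P: "1 - 5 / (3 * q) \<le> (\<Prod>i=1..2 * k. 1 - (1 / q) ^ i)" .
  have bad: "q * real (card {U' \<in> ?S'. U \<inter> U' \<noteq> {0}}) \<le> 5 / 3 * real K" if U: "U \<in> ?S" for U
  proof -
    have "(1 - 5 / (3 * q)) * real K \<le> (\<Prod>i=1..2 * k. 1 - (1 / q) ^ i) * real K"
      using P by (intro mult_right_mono) auto
    also have "\<dots> \<le> real (card {U' \<in> ?S'. U' \<inter> U = {0}})"
      using U by (intro KW) (auto simp: nondegenerate_subspaces_def)
    finally have 1: "(1 - 5 / (3 * q)) * real K \<le> real (card {U' \<in> ?S'. U' \<inter> U = {0}})" .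
    have "card {U' \<in> ?S'. U' \<inter> U = {0}} + card {U' \<in> ?S'. U \<inter> U' \<noteq> {0}}
        = card ({U' \<in> ?S'. U' \<inter> U = {0}} \<union> {U' \<in> ?S'. U \<inter> U' \<noteq> {0}})"
      by (rule card_Un_disjoint[symmetric]) (auto simp: Int_commute)
    also have "{U' \<in> ?S'. U' \<inter> U = {0}} \<union> {U' \<in> ?S'. U \<inter> U' \<noteq> {0}} = ?S'"
      by (auto simp: Int_commute)
    finally have "real (card {U' \<in> ?S'. U' \<inter> U = {0}}) + real (card {U' \<in> ?S'. U \<inter> U' \<noteq> {0}}) = real K"
      using K by linarith
    then have "real (card {U' \<in> ?S'. U \<inter> U' \<noteq> {0}}) \<le> 5 / (3 * q) * real K"
      using 1 by (simp add: algebra_simps)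
    then show ?thesis using q by (simp add: field_simps)
  qed
  have "{(U, U'). (U, U') \<in> ?S \<times> ?S' \<and> U \<inter> U' \<noteq> {0}} = (SIGMA U:?S. {U' \<in> ?S'. U \<inter> U' \<noteq> {0}})"
    by auto
  then have "q * real (card {(U, U'). (U, U') \<in> ?S \<times> ?S' \<and> U \<inter> U' \<noteq> {0}})
      = (\<Sum>U\<in>?S. q * real (card {U' \<in> ?S'. U \<inter> U' \<noteq> {0}}))"
    by (simp add: card_SigmaI sum_distrib_left)
  also have "\<dots> \<le> (\<Sum>U\<in>?S. 5 / 3 * real K)" using bad by (rule sum_mono)
  finally show "real CARD('a) * real (card {(U, U'). (U, U') \<in> ?S \<times> ?S' \<and> U \<inter> U' \<noteq> {0}})
      \<le> 5 / 3 * real (card ?S) * real (card ?S')"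
    using K by (simp add: q_def)
qed

text \<open>The characteristic divides \<open>q ^ k\<close>, so it is the prime of which
  \<open>q\<close> is a power.\<close>

lemma frobenius_additive:
  fixes x y :: "'a::{field,finite}"
  assumes "primepow q" "CARD('a) = q ^ k"
  shows "(x + y) ^ q = x ^ q + y ^ q"
proof -
  obtain p n where p: "prime p" "q = p ^ n" using assms(1) by (auto simp: primepow_def)
  have prime: "prime CHAR('a)" by (simp add: prime_CHAR_semidom finite_imp_CHAR_pos)
  have "CHAR('a) dvd p ^ (n * k)" using CHAR_dvd_CARD[where 'a='a] assms(2) p(2) by (simp add: power_mult)
  then have "CHAR('a) = p" using prime p(1) prime_dvd_power primes_dvd_imp_eq by blast
  then show ?thesis using freshmans_dream'[OF prime, of q n] p by simp
qed

lemma hermitian_spaceI: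
  fixes B :: "'a::{field,finite} ^ 'd \<Rightarrow> 'a ^ 'd \<Rightarrow> 'a"
  assumes q: "primepow q" "CARD('a) = q\<^sup>2" and herm: "hermitian_form q B" and nd: "nondegenerate_on B UNIV"
  shows "hermitian_space B q"
proof
  have lin: "Vector_Spaces.linear (*s) (*) (\<lambda>u. B u v)" and h: "B v u = B u v ^ q" for u v
    using herm unfolding hermitian_form_def by blast+
  have scale: "B (c *s u) w = c * B u w" for c u w using linear_form_scale[OF lin[of w]] .
  show "B (u + v) w = B u w + B v w" for u v w using linear_form_add[OF lin[of w]] .
  show "B (c *s u) w = c * B u w" for c u w by (rule scale)
  show "B v u = B u v ^ q" for u v by (rule h)
  show "(x + y) ^ q = x ^ q + y ^ q" for x y :: 'a using q by (rule frobenius_additive)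
  show "2 \<le> q" using primepow_gt_Suc_0[OF q(1)] by simp
  have "vec.dim (UNIV :: ('a ^ 'd) set) \<noteq> 0" using vec_dim_card[where 'a='a and 'n='d] by simp
  then have "\<not> (UNIV :: ('a ^ 'd) set) \<subseteq> {0}" using vec.dim_eq_0[of "UNIV :: ('a ^ 'd) set"] by simp
  then obtain u :: "'a ^ 'd" where "u \<noteq> 0" by blast
  then obtain v where v: "B u v \<noteq> 0" using nd unfolding nondegenerate_on_def by blast
  \<comment> \<open>Every scalar is a value of the form, so the claim is conjugate symmetry applied
    twice.\<close>
  show "(x ^ q) ^ q = x" for x :: 'a
  proof -
    define w where "w = (x / B u v) *s u"
    have 1: "B w v = x" using v by (simp add: w_def scale)
    have "B w v = B v w ^ q" "B v w = B w v ^ q" by (rule h)+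
    then show ?thesis by (simp only: 1)
  qed
qed (use q nd in simp_all)

text \<open>\<open>d\<close> and \<open>z\<close> encode the norm: \<open>d = -1\<close>,
  \<open>z = 0\<close> for nonzero norm, and \<open>d = q - 1\<close>, \<open>z = q\<close> for
  isotropic vectors with the zero vector removed. For \<open>m = 1\<close> the critical quotient is
  \<open>q / (q - 1)\<close>, which is at most 9/5 exactly for \<open>q \<ge> 9/4\<close>; this
  explains \<open>ex\<close>. For \<open>m \<ge> 2\<close> the bound \<open>up'\<close> is attained
  by the isotropic vectors of a plane and \<open>lo'\<close> by nonzero norms in dimension 4.
  Together they lead to \<open>q ^ 3 * (q + 1) / (q ^ 4 - 1)\<close>, which is 8/5 at
  \<open>q = 2\<close> and smaller beyond.\<close>

lemma unitary_estimate:
  fixes q t T d z :: real and l m :: nat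
  assumes q: "q \<ge> 2" and l: "1 \<le> l" "l \<le> m" and ex: "m = 1 \<Longrightarrow> q \<ge> 3" and T0: "T \<ge> 0"
    and dz: "d = -1 \<and> z = 0 \<or> d = q - 1 \<and> z = q \<and> l \<ge> 2"
    and t: "q * t = q ^ (2 * m) + (- q) ^ m * d - z"
    and T: "q * T = q ^ (2 * (l + m)) + (- q) ^ (l + m) * d - z"
    and t0: "t \<ge> 0"
  shows "q\<^sup>2 * t * ((q\<^sup>2) ^ l - 1) \<le> 9 / 5 * (q\<^sup>2 - 1) * T"
proof (cases "m = 1")
  case True
  then have l1: "l = 1" and d: "d = -1" "z = 0" using l dz by auto
  have "q * t = q * (q + 1)" using t True d by (simp add: power2_eq_square algebra_simps)
  then have t': "t = q + 1" using q by simp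
  have "q * T = q * (q ^ 3 - q)" using T True l1 d by (simp add: numeral_eq_Suc algebra_simps)
  then have T': "T = q ^ 3 - q" using q by simp
  have "9 / 5 * (q\<^sup>2 - 1) * T - q\<^sup>2 * t * ((q\<^sup>2) ^ l - 1) = q * (q\<^sup>2 - 1) * (q + 1) * (4 * q - 9) / 5"
    unfolding t' T' l1 by (simp add: power2_eq_square power3_eq_cube field_simps)
  moreover have "\<dots> \<ge> 0" using ex[OF True] one_le_power[of q 2] by simp
  ultimately show ?thesis by linarith
next
  case False
  then have m: "m \<ge> 2" using l by simp
  define N where "N = l + m"
  have N: "N \<ge> 3" "d = q - 1 \<Longrightarrow> d \<noteq> -1 \<Longrightarrow> N \<ge> 4" using dz m l q by (auto simp: N_def)
  have pw: "q ^ i \<le> q ^ j" if "i \<le> j" for i j using q that by (simp add: power_increasing)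
  have pos: "q ^ i > 0" for i using q by simp
  have r: "q\<^sup>2 - q - 1 \<ge> 1" using mult_mono[of 2 q 1 "q - 1"] q by (simp add: power2_eq_square algebra_simps)
  have neg: "(- q) ^ i = (if even i then q ^ i else - (q ^ i))" for i by (simp add: power_minus_odd)
  \<comment> \<open>The sign of the deviation alternates with the parity of the dimension, so in
    \<open>up\<close> and in \<open>lo\<close> only one parity needs an estimate.\<close>
  have up: "((- q) ^ m * d - z) * q ^ 3 \<le> q ^ (2 * m) * (q\<^sup>2 - q - 1)"
    using dz
  proof
    assume d: "d = -1 \<and> z = 0"
    show ?thesis
    proof (cases "even m")
      case True
      have "((- q) ^ m * d - z) * q ^ 3 \<le> 0" using d True q by (simp add: neg)
      moreover have "0 \<le> q ^ (2 * m) * (q\<^sup>2 - q - 1)" using r q by (intro mult_nonneg_nonneg) auto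
      ultimately show ?thesis by linarith
    next
      case False
      then have "m \<noteq> 2" by auto
      then have "q ^ (m + 3) \<le> q ^ (2 * m) * 1" using m pw[of "m + 3" "2 * m"] by simp
      also have "\<dots> \<le> q ^ (2 * m) * (q\<^sup>2 - q - 1)" using r q by (intro mult_left_mono) auto
      finally show ?thesis using d False by (simp add: neg power_add)
    qed
  next
    assume d: "d = q - 1 \<and> z = q \<and> l \<ge> 2"
    consider "odd m" | "m = 2" | "even m" "m \<ge> 4" using m by (cases "m = 2"; cases "m = 3") auto
    then show ?thesis
    proof cases
      case 1
      have "((- q) ^ m * d - z) * q ^ 3 \<le> 0"
      proof (rule mult_nonpos_nonneg)
        have "q ^ m * (q - 1) \<ge> 0" using q by (intro mult_nonneg_nonneg) auto
        moreover have "(- q) ^ m * d - z = - (q ^ m * (q - 1)) - q" using d 1 by (simp add: neg)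
        ultimately show "(- q) ^ m * d - z \<le> 0" using q by linarith
      qed (use q in simp)
      moreover have "0 \<le> q ^ (2 * m) * (q\<^sup>2 - q - 1)" using r q by (intro mult_nonneg_nonneg) auto
      ultimately show ?thesis by linarith
    next
      \<comment> \<open>Equality holds here; this case dictates the factor
        \<open>q^2 - q - 1\<close>.\<close>
      case 2
      have d': "d = q - 1" "z = q" using d by auto
      show ?thesis unfolding 2 d' by (simp add: power2_eq_square power3_eq_cube numeral_eq_Suc algebra_simps)
    next
      case 3
      have d': "d = q - 1" "z = q" using d by auto
      have "(- q) ^ m * d - z = q ^ m * q - q ^ m - q" unfolding d' by (simp add: neg 3 right_diff_distrib)
      then have "(- q) ^ m * d - z \<le> q ^ m * q" using pos[of m] q by linarith
      then have "((- q) ^ m * d - z) * q ^ 3 \<le> (q ^ m * q) * q ^ 3"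
        using q by (intro mult_right_mono) auto
      also have "\<dots> = q ^ (m + 4)" by (simp add: power_add numeral_eq_Suc)
      also have "\<dots> \<le> q ^ (2 * m) * 1" using 3 pw[of "m + 4" "2 * m"] by simp
      also have "\<dots> \<le> q ^ (2 * m) * (q\<^sup>2 - q - 1)" using r q by (intro mult_left_mono) auto
      finally show ?thesis .
    qed
  qed
  have lo: "- ((- q) ^ N * d - z) * q ^ 4 \<le> q ^ (2 * N)"
    using dz
  proof
    assume d: "d = -1 \<and> z = 0"
    show ?thesis
    proof (cases "even N")
      case True
      then have "N \<noteq> 3" by auto
      then have "q ^ (N + 4) \<le> q ^ (2 * N)" using N by (intro pw) auto
      then show ?thesis using d True by (simp add: neg power_add)
    next
      case False
      have "- ((- q) ^ N * d - z) * q ^ 4 \<le> 0" using d False q by (simp add: neg)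
      then show ?thesis using pos[of "2 * N"] by linarith
    qed
  next
    assume d: "d = q - 1 \<and> z = q \<and> l \<ge> 2"
    then have N4: "N \<ge> 4" using m by (simp add: N_def)
    have qN: "q \<le> q ^ N" using pw[of 1 N] N by simp
    show ?thesis
    proof (cases "even N")
      case True
      have "q ^ N * 1 \<le> q ^ N * (q - 1)" using q by (intro mult_left_mono) auto
      then have "- ((- q) ^ N * d - z) \<le> 0" using d True qN by (simp add: neg)
      then have "- ((- q) ^ N * d - z) * q ^ 4 \<le> 0" using q by (intro mult_nonpos_nonneg) auto
      then show ?thesis using pos[of "2 * N"] by linarith
    next
      case False
      then have "N \<noteq> 4" by auto
      have d': "d = q - 1" "z = q" using d by auto
      have "- ((- q) ^ N * d - z) = q ^ N * q - q ^ N + q"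
        unfolding d' using False by (simp add: neg right_diff_distrib)
      then have "- ((- q) ^ N * d - z) \<le> q ^ N * q" using qN by linarith
      then have "- ((- q) ^ N * d - z) * q ^ 4 \<le> (q ^ N * q) * q ^ 4"
        using q by (intro mult_right_mono) auto
      also have "\<dots> = q ^ (N + 5)" by (simp add: power_add numeral_eq_Suc)
      also have "\<dots> \<le> q ^ (2 * N)" using N4 \<open>N \<noteq> 4\<close> by (intro pw) auto
      finally show ?thesis .
    qed
  qed
  have up': "t * q ^ 4 \<le> q ^ (2 * m) * ((q + 1) * (q\<^sup>2 - 1))"
  proof -
    have "t * q ^ 4 = (q * t) * q ^ 3" by (simp add: numeral_eq_Suc)
    also have "\<dots> = q ^ (2 * m) * q ^ 3 + ((- q) ^ m * d - z) * q ^ 3" unfolding t by (simp add: algebra_simps)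
    also have "\<dots> \<le> q ^ (2 * m) * q ^ 3 + q ^ (2 * m) * (q\<^sup>2 - q - 1)" using up by simp
    finally show ?thesis by (simp add: power2_eq_square power3_eq_cube algebra_simps)
  qed
  have lo': "q ^ (2 * N) * (q ^ 4 - 1) \<le> T * q ^ 5"
  proof -
    have "T * q ^ 5 = (q * T) * q ^ 4" by (simp add: numeral_eq_Suc)
    also have "\<dots> = q ^ (2 * N) * q ^ 4 + ((- q) ^ N * d - z) * q ^ 4" unfolding T N_def by (simp add: algebra_simps)
    finally show ?thesis using lo by (simp add: algebra_simps)
  qed
  have key: "q ^ 3 * (q + 1) \<le> 9 / 5 * (q ^ 4 - 1)"
  proof -
    have "2 ^ 3 * 3 \<le> q ^ 3 * (4 * q - 5)" using q by (intro mult_mono power_mono) auto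
    then show ?thesis by (simp add: power3_eq_cube numeral_eq_Suc algebra_simps)
  qed
  have q21: "q\<^sup>2 - 1 \<ge> 0" using q one_le_power[of q 2] by simp
  have "q\<^sup>2 * t * ((q\<^sup>2) ^ l - 1) * q ^ 5 \<le> q\<^sup>2 * t * (q\<^sup>2) ^ l * q ^ 5"
    using q t0 by (intro mult_right_mono mult_left_mono) auto
  also have "\<dots> = q ^ (2 * l) * q ^ 3 * (t * q ^ 4)"
    unfolding power_mult[symmetric] by (simp add: numeral_eq_Suc)
  also have "\<dots> \<le> q ^ (2 * l) * q ^ 3 * (q ^ (2 * m) * ((q + 1) * (q\<^sup>2 - 1)))"
    using up' q by (intro mult_left_mono) auto
  also have "\<dots> = q ^ (2 * N) * (q\<^sup>2 - 1) * (q ^ 3 * (q + 1))"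
    by (simp add: N_def power_add algebra_simps)
  also have "\<dots> \<le> q ^ (2 * N) * (q\<^sup>2 - 1) * (9 / 5 * (q ^ 4 - 1))"
    using key q q21 by (intro mult_left_mono) auto
  also have "\<dots> = 9 / 5 * (q\<^sup>2 - 1) * (q ^ (2 * N) * (q ^ 4 - 1))" by (simp add: algebra_simps)
  also have "\<dots> \<le> 9 / 5 * (q\<^sup>2 - 1) * (T * q ^ 5)" using lo' q21 by (intro mult_left_mono) auto
  finally have "q\<^sup>2 * t * ((q\<^sup>2) ^ l - 1) * q ^ 5 \<le> 9 / 5 * (q\<^sup>2 - 1) * T * q ^ 5" by (simp add: mult_ac)
  then show ?thesis by (rule mult_right_le_imp_le) (rule pos)
qed

context hermitian_space
begin

lemma card_norm_nonzero:
  assumes X: "vec.subspace X" "nondegenerate_on B X" and a: "a \<in> fixed"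
  defines "d \<equiv> if a = 0 then real q - 1 else - 1" and "z \<equiv> if a = 0 then real q else 0"
  shows "real q * real (card {v \<in> X. v \<noteq> 0 \<and> B v v = a}) = real q ^ (2 * vec.dim X) + (- real q) ^ vec.dim X * d - z"
proof -
  have "{v \<in> X. v \<noteq> 0 \<and> B v v = a} = {v \<in> X. B v v = a} - {0}" by auto
  then have "card {v \<in> X. B v v = a} = card {v \<in> X. v \<noteq> 0 \<and> B v v = a} + (if a = 0 then 1 else 0)"
    using vec.subspace_0[OF X(1)] card_Suc_Diff1[of "{v \<in> X. B v v = a}" 0] by auto
  then have "real q * real (card {v \<in> X. v \<noteq> 0 \<and> B v v = a}) = real q * real (card {v \<in> X. B v v = a}) - z"
    by (simp add: z_def algebra_simps)
  also have "real q * real (card {v \<in> X. B v v = a}) = of_int (int q * int (card {v \<in> X. B v v = a}))" by simp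
  also have "\<dots> = real q ^ (2 * vec.dim X) + (- real q) ^ vec.dim X * d"
    unfolding card_norm[OF X a] by (simp add: d_def)
  finally show ?thesis .
qed

lemma unitary_intersecting_le:
  assumes lm: "1 \<le> l" "l \<le> m" "l + m = CARD('d)" "m = 1 \<longrightarrow> q \<ge> 3"
  shows "real CARD('a) * real (card {(U, U'). (U, U') \<in> nondegenerate_subspaces B l \<times> nondegenerate_subspaces B m \<and>
      U \<inter> U' \<noteq> {0}})
    \<le> 9 / 5 * real (card (nondegenerate_subspaces B l)) * real (card (nondegenerate_subspaces B m))"
proof (rule card_intersecting_pairs_le[where f = "\<lambda>v. B v v" and l = l])
  show "vec.subspace U \<and> vec.dim U = l" if "U \<in> nondegenerate_subspaces B l" for U
    using that by (simp add: nondegenerate_subspaces_def)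
  show "vec.subspace U" if "U \<in> nondegenerate_subspaces B m" for U
    using that by (simp add: nondegenerate_subspaces_def)
  fix x y :: "'a ^ 'd" assume "x \<noteq> 0" "y \<noteq> 0" "B x x = B y y"
  then obtain g where g: "isometry g" "g x = y" by (rule isometry_transitive)
  have "g ` U \<in> nondegenerate_subspaces B m" if "U \<in> nondegenerate_subspaces B m" for U
    using that isometry_subspace[OF g(1), of U] by (simp add: nondegenerate_subspaces_def)
  then show "\<exists>g. inj g \<and> g x = y \<and> (\<forall>U\<in>nondegenerate_subspaces B m. g ` U \<in> nondegenerate_subspaces B m)"
    using g by (auto simp: isometry_def)
next
  fix U U' x assume U: "U \<in> nondegenerate_subspaces B l" and U': "U' \<in> nondegenerate_subspaces B m"
    and x: "x \<in> U" "x \<noteq> 0"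
  define d z where "d = (if B x x = 0 then real q - 1 else - 1)" and "z = (if B x x = 0 then real q else 0)"
  have l2: "l \<ge> 2" if "B x x = 0"
    using form_nonzero_of_dim_1[OF _ _ _ x] U that lm(1) by (cases "l = 1") (auto simp: nondegenerate_subspaces_def)
  have "(real q)\<^sup>2 * real (card {y \<in> U'. y \<noteq> 0 \<and> B y y = B x x}) * (((real q)\<^sup>2) ^ l - 1)
      \<le> 9 / 5 * ((real q)\<^sup>2 - 1) * real (card {y \<in> UNIV. y \<noteq> 0 \<and> B y y = B x x})"
  proof (rule unitary_estimate)
    show "d = - 1 \<and> z = 0 \<or> d = real q - 1 \<and> z = real q \<and> 2 \<le> l"
      using l2 by (simp add: d_def z_def)
    show "real q * real (card {y \<in> U'. y \<noteq> 0 \<and> B y y = B x x}) = real q ^ (2 * m) + (- real q) ^ m * d - z"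
      using card_norm_nonzero[OF _ _ form_fixed[of x], of U'] U' by (simp add: nondegenerate_subspaces_def d_def z_def)
    show "real q * real (card {y \<in> UNIV. y \<noteq> 0 \<and> B y y = B x x}) = real q ^ (2 * (l + m)) + (- real q) ^ (l + m) * d - z"
      using card_norm_nonzero[OF vec.subspace_UNIV nondeg form_fixed[of x]] vec_dim_card[where 'a='a and 'n='d] lm
      by (simp add: d_def z_def)
  qed (use q lm in auto)
  then show "real CARD('a) * real (card {y \<in> U'. y \<noteq> 0 \<and> B y y = B x x}) * (real CARD('a) ^ l - 1)
      \<le> 9 / 5 * (real CARD('a) - 1) * real (card {y. y \<noteq> 0 \<and> B y y = B x x})"
    by (simp add: card_field)
qed (use lm in simp)

end

section \<open>Isometries of quadratic forms\<close>

lemma third_element: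
  assumes "CARD('a::{field,finite}) \<ge> 3"
  obtains t :: "'a::{field,finite}" where "t \<noteq> 0" "t \<noteq> 1"
proof -
  have "card {0, 1 :: 'a} < CARD('a)" using assms by simp
  then have "{0, 1 :: 'a} \<noteq> UNIV" by (intro notI) simp
  then show ?thesis using that by blast
qed

context quadratic_space
begin

text \<open>In characteristic 2 the polar form does not determine \<open>Q\<close>, so preservation
  of \<open>Q\<close> is required separately.\<close>

definition quadratic_isometry :: "('a ^ 'd \<Rightarrow> 'a ^ 'd) \<Rightarrow> bool" where
  "quadratic_isometry g \<longleftrightarrow> isometry g \<and> (\<forall>x. Q (g x) = Q x)"

lemma quadratic_isometryI:
  assumes add: "\<And>x y. g (x + y) = g x + g y" and scale: "\<And>c x. g (c *s x) = c *s g x"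
    and Q: "\<And>x. Q (g x) = Q x"
  shows "quadratic_isometry g"
proof -
  have "\<beta> (g u) (g v) = \<beta> u v" for u v
    using Q[of "u + v"] Q[of u] Q[of v] by (simp add: polar_form_def add)
  then have "isometry g" using add scale by (intro isometryI[OF nondeg]) auto
  then show ?thesis using Q by (simp add: quadratic_isometry_def)
qed

lemma quadratic_isometry_compose:
  "quadratic_isometry g \<Longrightarrow> quadratic_isometry h \<Longrightarrow> quadratic_isometry (g \<circ> h)"
  by (simp add: quadratic_isometry_def isometry_compose)

lemma bij_quadratic_isometry: "quadratic_isometry g \<Longrightarrow> bij g"
  using finite_UNIV_inj_surj[of g] by (auto simp: quadratic_isometry_def isometry_def bij_def)

lemma quadratic_isometry_inv:
  assumes g: "quadratic_isometry g"
  shows "quadratic_isometry (inv_into UNIV g)"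
proof -
  have b: "bij g" using g by (rule bij_quadratic_isometry)
  have gi: "g (inv_into UNIV g x) = x" for x using b by (simp add: bij_is_surj surj_f_inv_f)
  have ig: "inv_into UNIV g (g x) = x" for x using b by (simp add: bij_is_inj)
  have add: "g (x + y) = g x + g y" and scale: "g (c *s x) = c *s g x" and Q: "Q (g x) = Q x" for x y c
    using g by (simp_all add: quadratic_isometry_def isometry_def)
  show ?thesis
  proof (rule quadratic_isometryI)
    show "inv_into UNIV g (x + y) = inv_into UNIV g x + inv_into UNIV g y" for x y
      using ig[of "inv_into UNIV g x + inv_into UNIV g y"] by (simp add: add gi)
    show "inv_into UNIV g (c *s x) = c *s inv_into UNIV g x" for c x
      using ig[of "c *s inv_into UNIV g x"] by (simp add: scale gi)
    show "Q (inv_into UNIV g x) = Q x" for x using Q[of "inv_into UNIV g x"] by (simp add: gi)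
  qed
qed

text \<open>The usual reflection, written with \<open>Q w\<close> in the denominator so that in
  characteristic 2 it becomes the orthogonal transvection.\<close>

definition reflect :: "'a ^ 'd \<Rightarrow> 'a ^ 'd \<Rightarrow> 'a ^ 'd" where
  "reflect w x = x - (\<beta> x w / Q w) *s w"

lemma quadratic_isometry_reflect:
  assumes "Q w \<noteq> 0"
  shows "quadratic_isometry (reflect w)"
proof (rule quadratic_isometryI)
  show "reflect w (x + y) = reflect w x + reflect w y" for x y
    by (simp add: reflect_def add_left add_divide_distrib vec.scale_left_distrib)
  show "reflect w (c *s x) = c *s reflect w x" for c x
    by (simp add: reflect_def scale_left vec.scale_right_diff_distrib)
  show "Q (reflect w x) = Q x" for x
    using assms by (simp add: reflect_def Q_diff Q_scale scale_right power2_eq_square)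
qed

lemma reflect_swap:
  assumes "Q u = Q v" "Q (u - v) \<noteq> 0"
  shows "reflect (u - v) u = v"
proof -
  have "\<beta> u (u - v) = Q (u - v)"
    using assms(1) by (simp add: diff_right polar_self Q_diff)
  then show ?thesis using assms(2) by (simp add: reflect_def)
qed

text \<open>If \<open>u - v\<close> is nonsingular, its reflection maps \<open>u\<close> to
  \<open>v\<close>. Otherwise, for \<open>2 * Q u \<noteq> 0\<close> the vector \<open>u + v\<close>
  is nonsingular, and the reflections in \<open>u + v\<close> and in \<open>v\<close> lead from
  \<open>u\<close> over \<open>- v\<close> to \<open>v\<close>. In the remaining case
  \<open>u\<close> is singular or the characteristic is 2; an auxiliary reflection moves
  \<open>u\<close> to a vector \<open>w\<close> with \<open>w - v\<close> nonsingular.\<close>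

lemma quadratic_isometry_transitive:
  assumes q: "CARD('a) \<ge> 3" and uv: "u \<noteq> 0" "v \<noteq> 0" and eq: "Q u = Q v"
  obtains g where "quadratic_isometry g" "g u = v"
proof (cases "Q (u - v) = 0")
  case False
  then show ?thesis using that quadratic_isometry_reflect reflect_swap[OF eq] by blast
next
  case zero: True
  show ?thesis
  proof (cases "2 * Q u = 0")
    case False
    have "Q (u + v) + Q (u - v) = 2 * (2 * Q u)" using eq by (simp add: Q_add Q_diff)
    then have "Q (u + v) = 2 * (2 * Q u)" using zero by simp
    moreover have "2 * (2 * Q u) \<noteq> 0" using False by (metis mult_eq_0_iff)
    ultimately have "Q (u - (- v)) \<noteq> 0" by simp
    moreover have "Q u = Q (- v)" using eq by (simp add: Q_minus)
    ultimately have 1: "reflect (u - (- v)) u = - v" "quadratic_isometry (reflect (u - (- v)))"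
      using reflect_swap quadratic_isometry_reflect by blast+
    have Qv: "Q v \<noteq> 0" using False eq by auto
    have "\<beta> (- v) v / Q v = - 2" using Qv by (simp add: minus_left polar_self)
    then have "reflect v (- v) = - v - (- 2) *s v" by (simp only: reflect_def)
    also have "(- 2) *s v = - (v + v)" using vec.scale_left_distrib[of 1 1 v] by simp
    finally have "reflect v (- v) = v" by simp
    then show ?thesis
      using 1 quadratic_isometry_compose[OF quadratic_isometry_reflect[OF Qv] 1(2)]
      by (intro that[of "reflect v \<circ> reflect (u - (- v))"]) simp_all
  next
    case two: True
    have buv: "\<beta> u v = 0" using zero eq two by (simp add: Q_diff)
    obtain z0 where z0: "\<beta> u z0 \<noteq> 0" "\<beta> v z0 \<noteq> 0" using common_nonorthogonal[OF nondeg uv] .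
    have bu: "\<beta> u (z0 + t *s u) = \<beta> u z0" "\<beta> v (z0 + t *s u) = \<beta> v z0" for t
      using two buv polar_commute[of v u] by (simp_all add: add_right scale_right polar_self)
    have Qz: "Q (z0 + t *s u) = Q z0 + t * (\<beta> u z0 + t * Q u)" for t
      using polar_commute[of z0 u] by (simp add: Q_add Q_scale scale_right power2_eq_square algebra_simps)
    \<comment> \<open>Along this line \<open>Q\<close> is a polynomial of degree at most 2 in
      \<open>t\<close> with nonzero linear coefficient \<open>\<beta> u z0\<close>; it cannot vanish
      at 0, 1 and a third scalar.\<close>
    have "\<exists>t. Q (z0 + t *s u) \<noteq> 0"
    proof (rule ccontr)
      assume "\<not> ?thesis"
      then have all: "Q z0 + t * (\<beta> u z0 + t * Q u) = 0" for t using Qz by metis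
      obtain t :: 'a where t: "t \<noteq> 0" "t \<noteq> 1" using third_element[OF q] .
      have "Q z0 = 0" using all[of 0] by simp
      then have "\<beta> u z0 + 1 * Q u = 0" "\<beta> u z0 + t * Q u = 0" using all[of 1] all[of t] t by auto
      moreover have "(t - 1) * Q u = (\<beta> u z0 + t * Q u) - (\<beta> u z0 + 1 * Q u)"
        by (simp add: left_diff_distrib)
      ultimately have "(t - 1) * Q u = 0" by (simp only: diff_self)
      then have "Q u = 0" using t by simp
      then show False using \<open>\<beta> u z0 + 1 * Q u = 0\<close> z0 by simp
    qed
    then obtain t where t: "Q (z0 + t *s u) \<noteq> 0" by blast
    define z where "z = z0 + t *s u"
    have z: "Q z \<noteq> 0" "\<beta> u z \<noteq> 0" "\<beta> v z \<noteq> 0" using t bu z0 by (simp_all add: z_def)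
    define w where "w = reflect z u"
    define s where "s = \<beta> u z / Q z"
    have Qw: "Q w = Q v"
      using quadratic_isometry_reflect[OF z(1)] eq by (simp add: w_def quadratic_isometry_def)
    \<comment> \<open>\<open>Q (w - v)\<close> simplifies to \<open>s * \<beta> v z\<close>, which
      is nonzero by the choice of \<open>z\<close>.\<close>
    have "w - v = (u - v) - s *s z" by (simp add: w_def reflect_def s_def)
    then have "Q (w - v) = Q ((u - v) - s *s z)" by (rule arg_cong)
    also have "\<dots> = s * (s * Q z - (\<beta> u z - \<beta> v z))"
      unfolding Q_diff[of "u - v"] zero
      by (simp add: Q_scale scale_right diff_left power2_eq_square algebra_simps)
    also have "s * Q z = \<beta> u z" using z by (simp add: s_def)
    finally have "Q (w - v) \<noteq> 0" using z by (simp add: s_def)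
    then have "reflect (w - v) w = v" "quadratic_isometry (reflect (w - v))"
      using reflect_swap[OF Qw] quadratic_isometry_reflect by blast+
    then show ?thesis
      using quadratic_isometry_compose[OF _ quadratic_isometry_reflect[OF z(1)], of "reflect (w - v)"]
      by (intro that[of "reflect (w - v) \<circ> reflect z"]) (simp_all add: w_def)
  qed
qed

section \<open>Invariance of subspace types under isometries\<close>

lemma nondegenerate_quadratic_on_iff:
  assumes "vec.subspace X"
  shows "nondegenerate_quadratic_on Q X \<longleftrightarrow> nondegenerate_on \<beta> X"
  using vec.subspace_0[OF assms] unfolding nondegenerate_quadratic_on_def nondegenerate_on_def by auto

text \<open>Applied also to the inverse isometry, the inclusion becomes the equality behind the
  invariance of the Witt index.\<close>

lemma singular_dims_image:
  assumes g: "quadratic_isometry g"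
  shows "{vec.dim S |S. vec.subspace S \<and> S \<subseteq> X \<and> (\<forall>u\<in>S. Q u = 0)}
    \<subseteq> {vec.dim S |S. vec.subspace S \<and> S \<subseteq> g ` X \<and> (\<forall>u\<in>S. Q u = 0)}"
proof clarify
  fix S assume S: "vec.subspace S" "S \<subseteq> X" "\<forall>u\<in>S. Q u = 0"
  have "isometry g" "\<forall>x. Q (g x) = Q x" using g by (simp_all add: quadratic_isometry_def)
  then show "\<exists>S'. vec.dim S = vec.dim S' \<and> vec.subspace S' \<and> S' \<subseteq> g ` X \<and> (\<forall>u\<in>S'. Q u = 0)"
    using isometry_subspace[of g S] S by (intro exI[of _ "g ` S"]) auto
qed

lemma witt_index_image:
  assumes g: "quadratic_isometry g"
  shows "witt_index Q (g ` X) = witt_index Q X"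
proof -
  have "inv_into UNIV g ` (g ` X) = X" using bij_quadratic_isometry[OF g] by (simp add: bij_is_inj)
  then show ?thesis
    using singular_dims_image[OF g, of X] singular_dims_image[OF quadratic_isometry_inv[OF g], of "g ` X"]
    unfolding witt_index_def by (intro arg_cong[where f = Max]) simp
qed

lemma perp_image:
  assumes g: "quadratic_isometry g"
  shows "perp Q (g ` X) = g ` perp Q X"
proof -
  have B: "\<beta> (g u) (g v) = \<beta> u v" for u v using g by (simp add: quadratic_isometry_def isometry_def)
  have gi: "g (inv_into UNIV g x) = x" for x
    using bij_quadratic_isometry[OF g] by (simp add: bij_is_surj surj_f_inv_f)
  show ?thesis
  proof (intro equalityI subsetI)
    fix v assume v: "v \<in> perp Q (g ` X)"
    have "\<beta> u (inv_into UNIV g v) = 0" if "u \<in> X" for u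
      using v that B[of u "inv_into UNIV g v"] by (simp add: perp_def gi)
    then show "v \<in> g ` perp Q X" using gi[of v] by (intro image_eqI[of _ _ "inv_into UNIV g v"]) (simp_all add: perp_def)
  qed (auto simp: perp_def B)
qed

lemma perp_eq_orth: "perp Q X = orth UNIV X"
  by (auto simp: perp_def orth_def polar_commute)

lemma subspace_perp: "vec.subspace (perp Q X)"
  unfolding perp_eq_orth by (rule subspace_orth) (rule vec.subspace_UNIV)

lemma is_basis_list_image:
  assumes g: "quadratic_isometry g" and bs: "is_basis_list bs X"
  shows "is_basis_list (map g bs) (g ` X)"
proof -
  have inj: "inj g" and lin: "Vector_Spaces.linear (*s) (*s) g"
    using g by (simp_all add: quadratic_isometry_def isometry_def Vector_Spaces.linear_iff vec.vector_space_axioms)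
  have "vec.independent (g ` set bs)"
    using bs inj_on_subset[OF inj]
    by (intro vec.linear_independent_injective_image[OF lin]) (auto simp: is_basis_list_def)
  moreover have "vec.span (g ` set bs) = g ` X"
    using bs vec.linear_span_image[OF lin, of "set bs"] by (simp add: is_basis_list_def)
  moreover have "distinct (map g bs)"
    using bs inj_on_subset[OF inj] by (simp add: is_basis_list_def distinct_map)
  ultimately show ?thesis by (simp add: is_basis_list_def)
qed

lemma has_discriminant_type_image:
  assumes g: "quadratic_isometry g" and X: "has_discriminant_type Q X \<sigma>"
  shows "has_discriminant_type Q (g ` X) \<sigma>"
proof -
  have "gram_matrix Q (map g bs) = gram_matrix Q bs" for bs
    using g by (auto simp: gram_matrix_def quadratic_isometry_def isometry_def)
  then show ?thesis using X is_basis_list_image[OF g] unfolding has_discriminant_type_def by metis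
qed

lemma has_subspace_type_image:
  assumes g: "quadratic_isometry g" and X: "vec.subspace X" "has_subspace_type Q X \<sigma>"
  shows "has_subspace_type Q (g ` X) \<sigma>"
proof -
  have i: "isometry g" using g by (simp add: quadratic_isometry_def)
  show ?thesis
    using X has_discriminant_type_image[OF g, of X \<sigma>]
    unfolding has_subspace_type_def has_isometry_type_def perp_image[OF g] witt_index_image[OF g]
      isometry_subspace(2)[OF i X(1)] isometry_subspace(2)[OF i subspace_perp]
    by (auto split: if_splits)
qed

lemma image_of_type:
  assumes g: "quadratic_isometry g" and U: "U \<in> nondegenerate_subspaces_of_type Q n \<sigma>"
  shows "g ` U \<in> nondegenerate_subspaces_of_type Q n \<sigma>"
proof -
  have i: "isometry g" using g by (simp add: quadratic_isometry_def)
  have s: "vec.subspace U" using U by (simp add: nondegenerate_subspaces_of_type_def)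
  show ?thesis
    using U isometry_subspace[OF i s] has_subspace_type_image[OF g s]
    by (simp add: nondegenerate_subspaces_of_type_def nondegenerate_quadratic_on_iff s)
qed

lemma card_level_nonzero:
  assumes X: "vec.subspace X" "nondegenerate_on \<beta> X" "vec.dim X = m" "m \<ge> 1"
  shows "\<bar>real (card {x \<in> X. x \<noteq> 0 \<and> Q x = a}) + (if a = 0 then 1 else 0) - real CARD('a) ^ (m - 1)\<bar> \<le> of_int (level_error m a)"
proof -
  have "{x \<in> X. x \<noteq> 0 \<and> Q x = a} = level X a - {0}" by (auto simp: level_def)
  moreover have "0 \<in> level X a \<longleftrightarrow> a = 0" using vec.subspace_0[OF X(1)] by (auto simp: level_def)
  ultimately have "card (level X a) = card {x \<in> X. x \<noteq> 0 \<and> Q x = a} + (if a = 0 then 1 else 0)"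
    using card_Suc_Diff1[of "level X a" 0] by auto
  then have "of_int \<bar>int (card (level X a)) - int CARD('a) ^ (m - 1)\<bar>
      = \<bar>real (card {x \<in> X. x \<noteq> 0 \<and> Q x = a}) + (if a = 0 then 1 else 0) - real CARD('a) ^ (m - 1)\<bar>"
    by simp
  then show ?thesis using card_level[OF X, of a] by (metis of_int_le_iff)
qed

end

section \<open>Existence of subspaces of given type\<close>

text \<open>Supplies scalars outside the image of a quadratic polynomial: nonsquares in odd
  characteristic, and in any characteristic the parameter of an anisotropic plane.\<close>

lemma not_surj_of_collision:
  fixes f :: "'a::finite \<Rightarrow> 'a"
  assumes "f x = f y" "x \<noteq> y"
  shows "\<exists>t. \<forall>z. f z \<noteq> t"
proof -
  have "\<not> surj f" using assms finite_UNIV_surj_inj[of f] by (auto simp: inj_def)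
  then show ?thesis by (metis surjI)
qed

context quadratic_space
begin

section \<open>The Witt index and subspaces of even dimension with given type\<close>

lemma finite_singular_dims: "finite {vec.dim S |S. vec.subspace S \<and> S \<subseteq> X \<and> (\<forall>u\<in>S. Q u = 0)}"
  by (rule finite_subset[of _ "range vec.dim"]) auto

lemma dim_le_witt_index:
  assumes "vec.subspace S" "S \<subseteq> X" "\<And>u. u \<in> S \<Longrightarrow> Q u = 0"
  shows "vec.dim S \<le> witt_index Q X"
  unfolding witt_index_def using assms by (intro Max_ge finite_singular_dims) auto

lemma witt_index_attained:
  assumes "0 \<in> X"
  shows "\<exists>S. vec.subspace S \<and> S \<subseteq> X \<and> (\<forall>u\<in>S. Q u = 0) \<and> vec.dim S = witt_index Q X"
proof -
  have "{0} \<in> {S. vec.subspace S \<and> S \<subseteq> X \<and> (\<forall>u\<in>S. Q u = 0)}" using assms by simp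
  then have "{vec.dim S |S. vec.subspace S \<and> S \<subseteq> X \<and> (\<forall>u\<in>S. Q u = 0)} \<noteq> {}" by blast
  from Max_in[OF finite_singular_dims this]
  obtain S where "vec.subspace S" "S \<subseteq> X" "\<forall>u\<in>S. Q u = 0" "witt_index Q X = vec.dim S"
    unfolding witt_index_def by blast
  then show ?thesis by (intro exI[of _ S]) simp
qed

lemma witt_index_anisotropic:
  assumes "0 \<in> X" "\<And>x. x \<in> X \<Longrightarrow> Q x = 0 \<Longrightarrow> x = 0"
  shows "witt_index Q X = 0"
proof -
  obtain S where S: "S \<subseteq> X" "\<forall>u\<in>S. Q u = 0" "vec.dim S = witt_index Q X"
    using witt_index_attained[OF assms(1)] by blast
  then have "S \<subseteq> {0}" using assms(2) by blast
  then show ?thesis using S(3) vec.dim_eq_0[of S] by simp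
qed

text \<open>Adjoining \<open>e\<close> to a totally singular subspace of \<open>Y\<close> gives the
  lower bound. For the upper bound, a totally singular \<open>T\<close> is cut with the vectors
  orthogonal to \<open>e\<close>, giving \<open>T1\<close>; its vectors have no component along
  \<open>f\<close>, so dropping their multiples of \<open>e\<close> yields a totally singular
  subspace \<open>R\<close> of \<open>Y\<close>.\<close>

lemma witt_index_add_hyperbolic:
  assumes ef: "Q e = 0" "Q f = 0" "\<beta> e f = 1"
    and Y: "vec.subspace Y" "\<And>y h. y \<in> Y \<Longrightarrow> h \<in> vec.span {e, f} \<Longrightarrow> \<beta> y h = 0"
  shows "witt_index Q {h + y |h y. h \<in> vec.span {e, f} \<and> y \<in> Y} = witt_index Q Y + 1"
    (is "witt_index Q ?X = _")
proof (rule antisym)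
  have eY: "\<beta> y e = 0" "\<beta> y f = 0" "\<beta> e y = 0" if "y \<in> Y" for y
    using Y(2)[OF that] polar_commute[of y e] by (simp_all add: vec.span_base)
  have e0: "e \<noteq> 0" using ef by auto
  have Qe: "Q (x *s e + y) = Q y" if "y \<in> Y" for x y
    using ef eY[OF that] by (simp add: Q_add Q_scale scale_left)
  have X0: "0 \<in> ?X" using vec.subspace_0[OF Y(1)] vec.span_zero[of "{e, f}"] by force
  obtain S where S: "vec.subspace S" "S \<subseteq> Y" "\<forall>u\<in>S. Q u = 0" "vec.dim S = witt_index Q Y"
    using witt_index_attained[OF vec.subspace_0[OF Y(1)]] by blast
  let ?S = "{h + y |h y. h \<in> vec.span {e} \<and> y \<in> S}"
  have "vec.span {e} \<inter> S \<subseteq> {0}"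
  proof
    fix s assume s: "s \<in> vec.span {e} \<inter> S"
    then obtain k where k: "s = k *s e" by (auto simp: vec.span_singleton)
    have "\<beta> s f = 0" using eY S(2) s by blast
    then have "k = 0" using ef by (simp add: k scale_left)
    then show "s \<in> {0}" by (simp add: k)
  qed
  then have "vec.dim (vec.span {e} \<inter> S) = 0" using vec.dim_eq_0[of "vec.span {e} \<inter> S"] by simp
  then have "vec.dim ?S = witt_index Q Y + 1"
    using vec.dim_sums_Int[OF vec.subspace_span[of "{e}"] S(1)] S(4) dim_span_singleton[OF e0] by linarith
  moreover have "vec.dim ?S \<le> witt_index Q ?X"
  proof (rule dim_le_witt_index)
    show "vec.subspace ?S" using S(1) by (intro vec.subspace_sums) auto
    have "vec.span {e} \<subseteq> vec.span {e, f}" by (intro vec.span_mono) auto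
    then show "?S \<subseteq> ?X" using S(2) by blast
    fix u assume "u \<in> ?S"
    then obtain k y where "u = k *s e + y" "y \<in> S" by (auto simp: vec.span_singleton)
    then show "Q u = 0" using Qe S by auto
  qed
  ultimately show "witt_index Q Y + 1 \<le> witt_index Q ?X" by simp
  have "\<exists>T. vec.subspace T \<and> T \<subseteq> ?X \<and> (\<forall>u\<in>T. Q u = 0) \<and> vec.dim T = witt_index Q ?X"
    using X0 by (rule witt_index_attained)
  then obtain T where T: "vec.subspace T" "T \<subseteq> ?X" "vec.dim T = witt_index Q ?X" and T0: "\<forall>u\<in>T. Q u = 0"
    by (elim exE conjE)
  define T1 where "T1 = {s \<in> T. \<beta> s e = 0}"
  define R where "R = {y \<in> Y. \<exists>k. k *s e + y \<in> T}"
  have subR: "vec.subspace R"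
  proof (rule vec.subspaceI)
    show "0 \<in> R" using vec.subspace_0[OF Y(1)] vec.subspace_0[OF T(1)] by (auto simp: R_def intro!: exI[of _ 0])
  next
    fix x y assume "x \<in> R" "y \<in> R"
    then obtain k l where h: "x \<in> Y" "y \<in> Y" "k *s e + x \<in> T" "l *s e + y \<in> T" by (auto simp: R_def)
    have "(k + l) *s e + (x + y) = (k *s e + x) + (l *s e + y)"
      by (simp add: vec.scale_left_distrib)
    then have "(k + l) *s e + (x + y) \<in> T" using vec.subspace_add[OF T(1) h(3,4)] by (simp only:)
    then show "x + y \<in> R" using vec.subspace_add[OF Y(1) h(1,2)] unfolding R_def by blast
  next
    fix c x assume "x \<in> R"
    then obtain k where h: "x \<in> Y" "k *s e + x \<in> T" by (auto simp: R_def)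
    have "(c * k) *s e + c *s x = c *s (k *s e + x)" by (simp add: vec.scale_right_distrib)
    then have "(c * k) *s e + c *s x \<in> T" using vec.subspace_scale[OF T(1) h(2), of c] by (simp only:)
    then show "c *s x \<in> R" using vec.subspace_scale[OF Y(1) h(1)] unfolding R_def by blast
  qed
  have dR: "vec.dim R \<le> witt_index Q Y"
  proof (rule dim_le_witt_index[OF subR])
    show "R \<subseteq> Y" by (auto simp: R_def)
    show "Q u = 0" if u: "u \<in> R" for u
    proof -
      obtain k where "u \<in> Y" "k *s e + u \<in> T" using u by (auto simp: R_def)
      then show ?thesis using Qe[of u k] T0 by simp
    qed
  qed
  have T1: "\<exists>k y. s = k *s e + y \<and> y \<in> R" if s: "s \<in> T1" for s
  proof -
    obtain h y where hy: "h \<in> vec.span {e, f}" "y \<in> Y" "s = h + y" using s T(2) by (auto simp: T1_def)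
    obtain k l where h: "h = k *s e + l *s f" using hy(1) by (auto simp: span_pair)
    have "\<beta> s e = 0" using s by (simp add: T1_def)
    then have "l = 0"
      using ef eY[OF hy(2)] polar_commute[of f e] by (simp add: hy(3) h add_left scale_left polar_self)
    then have "s = k *s e + y" using hy(3) h by simp
    then show ?thesis using s hy(2) by (auto simp: R_def T1_def)
  qed
  \<comment> \<open>The two passages, from \<open>T\<close> to \<open>T1\<close> and from
    \<open>T1\<close> to \<open>R\<close>, each cost at most one dimension, but never both. If
    \<open>e\<close> lies in \<open>T\<close>, then \<open>T = T1\<close>; if not, the projection of
    \<open>T1\<close> along \<open>e\<close> is injective.\<close>
  have "card T \<le> CARD('a) * card R"
  proof (cases "e \<in> T")
    case True
    have "\<beta> s e = 0" if s: "s \<in> T" for s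
      using bspec[OF T0 s] bspec[OF T0 True] bspec[OF T0 vec.subspace_add[OF T(1) s True]] by (simp add: Q_add)
    then have "T = T1" by (auto simp: T1_def)
    then have "T \<subseteq> (\<lambda>(k, y). k *s e + y) ` (UNIV \<times> R)" using T1 by fastforce
    then have "card T \<le> card (UNIV \<times> R :: ('a \<times> ('a ^ 'd)) set)" by (rule surj_card_le[rotated]) simp
    then show ?thesis by (simp add: card_cartesian_product)
  next
    case False
    have "card T \<le> CARD('a) * card T1"
      unfolding T1_def by (rule card_kernel_ge[OF T(1)]) (simp_all add: add_left scale_left)
    also have "card T1 \<le> card R"
    proof -
      obtain r where r: "\<And>s. s \<in> T1 \<Longrightarrow> \<exists>k. s = k *s e + r s \<and> r s \<in> R" using T1 by metis
      have "inj_on r T1"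
      proof (rule inj_onI)
        fix s s' assume s: "s \<in> T1" "s' \<in> T1" "r s = r s'"
        obtain k k' where k: "s = k *s e + r s" "s' = k' *s e + r s'" using r s by blast
        have eq: "s - s' = (k - k') *s e"
          by (subst k(1), subst k(2)) (simp add: s(3) vec.scale_left_diff_distrib)
        have "s - s' \<in> T" using s T(1) by (auto simp: T1_def intro: vec.subspace_diff)
        then have "(1 / (k - k')) *s ((k - k') *s e) \<in> T" unfolding eq by (rule vec.subspace_scale[OF T(1)])
        then have "((1 / (k - k')) * (k - k')) *s e \<in> T" by (simp only: vec.scale_scale)
        then have "k = k'" using False by (cases "k = k'") auto
        then show "s = s'" using eq by simp
      qed
      then show ?thesis using r by (intro card_inj_on_le) auto
    qed
    finally show ?thesis by simp
  qed
  then have "CARD('a) ^ vec.dim T \<le> CARD('a) ^ (vec.dim R + 1)"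
    by (simp add: card_subspace[OF T(1)] card_subspace[OF subR])
  then have "vec.dim T \<le> vec.dim R + 1"
    using one_less_CARD_field[where 'a='a] by (simp only: power_increasing_iff)
  then show "witt_index Q ?X \<le> witt_index Q Y + 1" using dR T(3) by linarith
qed

text \<open>If \<open>Q\<close> vanishes at \<open>u\<close>, \<open>v\<close> and
  \<open>u + v\<close>, then \<open>\<beta> u v = 0\<close>.\<close>

lemma nonsingular_vector_exists:
  assumes X: "vec.subspace X" "nondegenerate_on \<beta> X" "vec.dim X \<noteq> 0"
  obtains w where "w \<in> X" "Q w \<noteq> 0"
proof -
  obtain u where u: "u \<in> X" "u \<noteq> 0" using X(3) by (rule exists_nonzero)
  obtain v where v: "v \<in> X" "\<beta> u v \<noteq> 0" using nondegenerate_onD[OF X(2) u(1)] u(2) by blast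
  then have "Q u \<noteq> 0 \<or> Q v \<noteq> 0 \<or> Q (u + v) \<noteq> 0" by (auto simp: polar_form_def)
  then show ?thesis using that u v vec.subspace_add[OF X(1) u(1) v(1)] by blast
qed

text \<open>In a space spanned by a hyperbolic pair \<open>e, f\<close> and a nonsingular \<open>w\<close>, take \<open>\<langle>e - t f, f + w\<rangle>\<close>
  with \<open>t\<close> outside the image of \<open>z \<mapsto> Q w \<cdot> z\<^sup>2 + z\<close>. This works in every characteristic.\<close>

lemma anisotropic_plane_exists:
  assumes X: "vec.subspace X" "nondegenerate_on \<beta> X" "vec.dim X \<ge> 3"
  obtains U where "vec.subspace U" "U \<subseteq> X" "vec.dim U = 2" "nondegenerate_on \<beta> U"
    "\<And>x. x \<in> U \<Longrightarrow> Q x = 0 \<Longrightarrow> x = 0"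
proof -
  obtain e where e: "e \<in> X" "e \<noteq> 0" "Q e = 0" using singular_vector_exists[OF X] by blast
  obtain f where f: "f \<in> X" "Q f = 0" "\<beta> e f = 1" using hyperbolic_partner[OF X(1,2) e] .
  define Y where "Y = orth X (vec.span {e, f})"
  note Y = hyperbolic_pair(4-6)[OF X(1,2) e(1) f(1) e(3) f(2,3), folded Y_def]
  have "vec.dim Y \<noteq> 0" using Y(3) X(3) by linarith
  then obtain w where w: "w \<in> Y" "Q w \<noteq> 0" by (rule nonsingular_vector_exists[OF Y(1,2)])
  have wX: "w \<in> X" using w(1) orth_subset unfolding Y_def by blast
  have bw: "\<beta> e w = 0" "\<beta> f w = 0"
    using orthD(2)[of w X "vec.span {e, f}"] w(1) polar_commute[of w] by (simp_all add: Y_def vec.span_base)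
  define c where "c = Q w"
  have c: "c \<noteq> 0" using w by (simp add: c_def)
  have "(\<lambda>z. c * z\<^sup>2 + z) 0 = (\<lambda>z. c * z\<^sup>2 + z) (- 1 / c)" "0 \<noteq> - 1 / c"
    using c by (simp_all add: power2_eq_square)
  then obtain t where "\<forall>z. c * z\<^sup>2 + z \<noteq> t" using not_surj_of_collision[of "\<lambda>z. c * z\<^sup>2 + z"] by blast
  then have t: "c * z\<^sup>2 + z - t \<noteq> 0" for z by simp
  define u1 u2 where "u1 = e - t *s f" and "u2 = f + w"
  have Q1: "Q u1 = - t" and Q2: "Q u2 = c" and b12: "\<beta> u1 u2 = 1" and b21: "\<beta> u2 u1 = 1"
    using e f bw polar_commute[of u2 u1]
    by (simp_all add: u1_def u2_def c_def Q_add Q_diff Q_scale scale_left scale_right add_left add_right diff_left diff_right polar_self)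
  have Q: "Q (x *s u1 + z *s u2) = - t * x\<^sup>2 + x * z + c * z\<^sup>2" for x z
    by (simp add: Q_add[of "x *s u1"] Q_scale scale_left scale_right Q1 Q2 b12)
  have Q0: "x = 0 \<and> z = 0" if "- t * x\<^sup>2 + x * z + c * z\<^sup>2 = 0" for x z
  proof (cases "x = 0")
    case True
    then show ?thesis using that c by simp
  next
    case False
    then have "c * (z / x)\<^sup>2 + z / x - t = (- t * x\<^sup>2 + x * z + c * z\<^sup>2) / x\<^sup>2"
      by (simp add: power2_eq_square field_simps)
    then show ?thesis using t[of "z / x"] that by simp
  qed
  have aniso: "x = 0" if x: "x \<in> vec.span {u1, u2}" "Q x = 0" for x
  proof -
    obtain y z where "x = y *s u1 + z *s u2" using x(1) by (auto simp: span_pair)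
    then show ?thesis using Q[of y z] Q0[of y z] x(2) by simp
  qed
  have "u2 \<noteq> 0" using Q2 c by auto
  moreover have u12: "u1 \<notin> vec.span {u2}"
  proof
    assume "u1 \<in> vec.span {u2}"
    then obtain k where k: "u1 = k *s u2" by (auto simp: vec.span_singleton)
    have "1 *s u1 + (- k) *s u2 = 0" by (simp add: k)
    then have "- t * 1\<^sup>2 + 1 * (- k) + c * (- k)\<^sup>2 = 0" using Q[of 1 "- k"] by simp
    from Q0[OF this] show False by simp
  qed
  ultimately have ind: "vec.independent {u1, u2}" by (simp add: vec.independent_insert)
  have "u1 \<noteq> u2" using u12 vec.span_base[of u2 "{u2}"] by auto
  then have "vec.dim (vec.span {u1, u2}) = 2" using vec.dim_span_eq_card_independent[OF ind] by simp
  moreover have "vec.span {u1, u2} \<subseteq> X"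
    using e f wX X(1) by (intro span_pair_subset) (simp_all add: u1_def u2_def vec.subspace_add vec.subspace_diff vec.subspace_scale)
  moreover have "nondegenerate_on \<beta> (vec.span {u1, u2})"
  proof (rule nondegenerate_onI)
    fix u assume u: "u \<in> vec.span {u1, u2}" "\<And>v. v \<in> vec.span {u1, u2} \<Longrightarrow> \<beta> u v = 0"
    show "u = 0"
    \<comment> \<open>In odd characteristic a radical vector satisfies \<open>2 * Q u = 0\<close>,
      so anisotropy suffices. In characteristic 2 the polar form is alternating and
      \<open>\<beta> u1 u2 = 1\<close>.\<close>
    proof (cases "(2 :: 'a) = 0")
      case False
      have "2 * Q u = 0" using u(2)[OF u(1)] by (simp add: polar_self)
      then show ?thesis using aniso[OF u(1)] False by simp
    next
      case True
      obtain x z where xz: "u = x *s u1 + z *s u2" using u(1) by (auto simp: span_pair)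
      have "\<beta> u u1 = 0" "\<beta> u u2 = 0" using u(2) by (simp_all add: vec.span_base)
      then show ?thesis using True b12 b21 by (simp add: xz add_left scale_left polar_self)
    qed
  qed simp
  ultimately show ?thesis using that[of "vec.span {u1, u2}"] aniso by simp
qed

text \<open>\<open>j\<close> is the dimension of an anisotropic part, 0 for hyperbolic and 2 for
  elliptic type, to which \<open>k\<close> hyperbolic planes are added. The one spare dimension
  guarantees dimension at least 3, and hence a singular vector, in every step.\<close>

lemma subspace_of_witt_index:
  assumes base: "\<And>X. vec.subspace X \<Longrightarrow> nondegenerate_on \<beta> X \<Longrightarrow> vec.dim X \<ge> j + 1 \<Longrightarrow>
      \<exists>U. vec.subspace U \<and> U \<subseteq> X \<and> vec.dim U = j \<and> nondegenerate_on \<beta> U \<and> witt_index Q U = 0"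
    and X: "vec.subspace X" "nondegenerate_on \<beta> X" "vec.dim X \<ge> 2 * k + j + 1"
  shows "\<exists>U. vec.subspace U \<and> U \<subseteq> X \<and> vec.dim U = 2 * k + j \<and> nondegenerate_on \<beta> U \<and> witt_index Q U = k"
  using X
proof (induction k arbitrary: X)
  case 0
  then show ?case using base by simp
next
  case (Suc k)
  note X = Suc.prems(1,2)
  have "vec.dim X \<ge> 3" using Suc.prems(3) by simp
  then obtain e where e: "e \<in> X" "e \<noteq> 0" "Q e = 0" using singular_vector_exists[OF X] by blast
  obtain f where f: "f \<in> X" "Q f = 0" "\<beta> e f = 1" using hyperbolic_partner[OF X e] .
  let ?P = "vec.span {e, f}"
  define Y where "Y = orth X ?P"
  note P = hyperbolic_pair(1-3)[OF X e(1) f(1) e(3) f(2,3)]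
  note Y = hyperbolic_pair(4-6)[OF X e(1) f(1) e(3) f(2,3), folded Y_def]
  have "vec.dim Y \<ge> 2 * k + j + 1" using Y(3) Suc.prems(3) by simp
  then obtain U where U: "vec.subspace U" "U \<subseteq> Y" "vec.dim U = 2 * k + j" "nondegenerate_on \<beta> U" "witt_index Q U = k"
    using Suc.IH[OF Y(1,2)] by blast
  have o: "\<beta> y h = 0" if "y \<in> U" "h \<in> ?P" for y h using that U(2) orthD(2) unfolding Y_def by blast
  let ?W = "{h + y |h y. h \<in> ?P \<and> y \<in> U}"
  have dP: "vec.dim ?P = 2" using e f by (intro dim_isotropic_pair) (simp_all add: polar_self)
  show ?case
  proof (intro exI[of _ ?W] conjI)
    show "vec.subspace ?W" using P(1) U(1) by (rule vec.subspace_sums)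
    have "U \<subseteq> X" using U(2) orth_subset unfolding Y_def by blast
    then show "?W \<subseteq> X" using P(2) vec.subspace_add[OF X(1)] by blast
    show "vec.dim ?W = 2 * Suc k + j" using dim_sum_orthogonal[OF P(1,3) U(1) o] dP U(3) by simp
    show "nondegenerate_on \<beta> ?W" by (rule nondegenerate_sum_orthogonal[OF P(1,3) U(1,4) o])
    show "witt_index Q ?W = Suc k" using witt_index_add_hyperbolic[OF e(3) f(2,3) U(1) o] U(5) by simp
  qed
qed

lemma even_subspace_of_type_exists:
  assumes "even n" "1 \<le> n" "n < CARD('d)"
  obtains U where "vec.subspace U" "vec.dim U = n" "nondegenerate_on \<beta> U" "has_isometry_type Q U \<sigma>"
proof -
  have dim: "vec.dim (UNIV :: ('a ^ 'd) set) = CARD('d)" by (rule vec_dim_card)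
  obtain k where k: "n = 2 * k" "k \<ge> 1" using assms by (auto elim!: evenE)
  show ?thesis
  proof (cases \<sigma>)
    case Plus
    have "\<exists>U. vec.subspace U \<and> U \<subseteq> X \<and> vec.dim U = 0 \<and> nondegenerate_on \<beta> U \<and> witt_index Q U = 0"
      if "vec.subspace X" for X
      using vec.subspace_0[OF that] witt_index_anisotropic[of "{0}"]
      by (intro exI[of _ "{0}"]) (simp add: nondegenerate_on_zero)
    then obtain U where "vec.subspace U" "vec.dim U = 2 * k + 0" "nondegenerate_on \<beta> U" "witt_index Q U = k"
      using subspace_of_witt_index[of 0 UNIV k] nondeg assms dim k vec.subspace_UNIV by auto
    then show ?thesis using that[of U] k Plus by (simp add: has_isometry_type_def)
  next
    case Minus
    have "\<exists>U. vec.subspace U \<and> U \<subseteq> X \<and> vec.dim U = 2 \<and> nondegenerate_on \<beta> U \<and> witt_index Q U = 0"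
      if X: "vec.subspace X" "nondegenerate_on \<beta> X" "vec.dim X \<ge> 2 + 1" for X
    proof -
      have "vec.dim X \<ge> 3" using X(3) by simp
      then obtain U where U: "vec.subspace U" "U \<subseteq> X" "vec.dim U = 2" "nondegenerate_on \<beta> U"
        "\<And>x. x \<in> U \<Longrightarrow> Q x = 0 \<Longrightarrow> x = 0" by (rule anisotropic_plane_exists[OF X(1,2)]) blast
      then have "witt_index Q U = 0" using witt_index_anisotropic[OF vec.subspace_0[OF U(1)]] by blast
      then show ?thesis using U by blast
    qed
    moreover have "2 * (k - 1) + 2 + 1 \<le> vec.dim (UNIV :: ('a ^ 'd) set)" using dim assms k by simp
    ultimately obtain U where "vec.subspace U" "vec.dim U = 2 * (k - 1) + 2" "nondegenerate_on \<beta> U" "witt_index Q U = k - 1"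
      using subspace_of_witt_index[of 2 UNIV "k - 1"] nondeg vec.subspace_UNIV by metis
    then show ?thesis using that[of U] k Minus by (simp add: has_isometry_type_def)
  qed
qed

text \<open>By symmetry of \<open>\<beta>\<close> it is enough that each entry is orthogonal to the
  later ones, which suits induction on the list.\<close>

definition orthogonal_list :: "('a ^ 'd) list \<Rightarrow> bool" where
  "orthogonal_list bs \<longleftrightarrow> sorted_wrt (\<lambda>b c. \<beta> b c = 0) bs \<and> (\<forall>b\<in>set bs. Q b \<noteq> 0)"

lemma orthogonal_list_span:
  assumes 2: "(2 :: 'a) \<noteq> 0" and "orthogonal_list bs"
  shows "distinct bs \<and> vec.independent (set bs) \<and> nondegenerate_on \<beta> (vec.span (set bs)) \<and>
    vec.dim (vec.span (set bs)) = length bs"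
  using assms(2)
proof (induction bs)
  case Nil
  then show ?case using vec.independent_empty by (simp add: nondegenerate_on_zero)
next
  case (Cons b bs)
  then have b: "Q b \<noteq> 0" "\<And>c. c \<in> set bs \<Longrightarrow> \<beta> b c = 0" and "orthogonal_list bs"
    by (auto simp: orthogonal_list_def)
  with Cons.IH have IH: "distinct bs" "vec.independent (set bs)" "nondegenerate_on \<beta> (vec.span (set bs))"
    by blast+
  have bb: "\<beta> b b \<noteq> 0" using b 2 by (simp add: polar_self)
  have "b \<in> orth UNIV (set bs)" using b by (simp add: orth_def)
  then have o: "\<beta> b c = 0" if "c \<in> vec.span (set bs)" for c
    using orthD(2)[of b UNIV "vec.span (set bs)" c] that by (simp add: orth_span)
  have nb: "b \<notin> vec.span (set bs)" using o bb by blast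
  then have d: "distinct (b # bs)" using IH(1) vec.span_base by auto
  have i: "vec.independent (set (b # bs))" using nb IH(2) by (simp add: vec.independent_insert)
  have o': "\<beta> y z = 0" if yz: "y \<in> vec.span (set bs)" "z \<in> vec.span {b}" for y z
  proof -
    obtain k where "z = k *s b" using yz(2) by (auto simp: vec.span_singleton)
    then show ?thesis using o[OF yz(1)] polar_commute[of y b] by (simp add: scale_right)
  qed
  have "nondegenerate_on \<beta> {z + y |z y. z \<in> vec.span {b} \<and> y \<in> vec.span (set bs)}"
    by (rule nondegenerate_sum_orthogonal[OF _ nondegenerate_span_singleton[OF bb] _ IH(3) o']) simp_all
  also have "{z + y |z y. z \<in> vec.span {b} \<and> y \<in> vec.span (set bs)} = vec.span (set (b # bs))"
    using vec.span_Un[of "{b}" "set bs"] by simp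
  finally have "nondegenerate_on \<beta> (vec.span (set (b # bs)))" .
  then show ?case
    using d i vec.dim_span_eq_card_independent[OF i] distinct_card[OF d] by simp
qed

lemma orthogonal_list_extend:
  assumes 2: "(2 :: 'a) \<noteq> 0" and bs: "orthogonal_list bs"
  defines "Y \<equiv> orth UNIV (vec.span (set bs))"
  shows "vec.subspace Y" "nondegenerate_on \<beta> Y" "length bs + vec.dim Y = CARD('d)"
    and "u \<in> Y \<Longrightarrow> Q u \<noteq> 0 \<Longrightarrow> orthogonal_list (u # bs)"
proof -
  note S = orthogonal_list_span[OF 2 bs]
  show "vec.subspace Y" unfolding Y_def by (rule subspace_orth) (rule vec.subspace_UNIV)
  show "nondegenerate_on \<beta> Y"
    unfolding Y_def using S by (intro nondegenerate_orth nondeg vec.subspace_UNIV) auto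
  show "length bs + vec.dim Y = CARD('d)"
    using dim_orth[OF vec.subspace_UNIV vec.subspace_span _ , of "set bs"] S vec_dim_card[where 'a='a and 'n='d]
    by (simp add: Y_def)
  assume "u \<in> Y" "Q u \<noteq> 0"
  then show "orthogonal_list (u # bs)"
    using bs by (auto simp: orthogonal_list_def Y_def orth_def vec.span_base)
qed

lemma orthogonal_list_exists:
  assumes 2: "(2 :: 'a) \<noteq> 0" and "r \<le> CARD('d)"
  shows "\<exists>bs. orthogonal_list bs \<and> length bs = r"
  using assms(2)
proof (induction r)
  case 0
  then show ?case by (intro exI[of _ "[]"]) (simp add: orthogonal_list_def)
next
  case (Suc r)
  then obtain bs where bs: "orthogonal_list bs" "length bs = r" by auto
  note Y = orthogonal_list_extend[OF 2 bs(1)]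
  have "vec.dim (orth UNIV (vec.span (set bs))) \<noteq> 0" using Y(3) bs(2) Suc.prems by linarith
  then obtain u where "u \<in> orth UNIV (vec.span (set bs))" "Q u \<noteq> 0"
    by (rule nonsingular_vector_exists[OF Y(1,2)])
  then show ?case using Y(4) bs(2) by (intro exI[of _ "u # bs"]) simp
qed

lemma det_gram_orthogonal_list:
  assumes "orthogonal_list bs"
  shows "Determinant.det (gram_matrix Q bs) = (\<Prod>b\<leftarrow>bs. 2 * Q b)"
proof -
  let ?A = "gram_matrix Q bs"
  have A: "?A \<in> carrier_mat (length bs) (length bs)" by (simp add: gram_matrix_def)
  have "upper_triangular ?A"
  proof (rule upper_triangularI)
    fix i j assume "j < i" "i < dim_row ?A"
    then have ij: "j < i" "i < length bs" by (simp_all add: gram_matrix_def)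
    then have "\<beta> (bs ! j) (bs ! i) = 0"
      using assms by (simp add: orthogonal_list_def sorted_wrt_iff_nth_less)
    then show "?A $$ (i, j) = 0" using ij by (simp add: gram_matrix_def polar_commute[of "bs ! i"])
  qed
  then have "Determinant.det ?A = prod_list (diag_mat ?A)" using A by (rule det_upper_triangular)
  also have "diag_mat ?A = map (\<lambda>b. 2 * Q b) bs"
    by (rule nth_equalityI) (simp_all add: diag_mat_def gram_matrix_def polar_self)
  finally show ?thesis .
qed

text \<open>In dimension at least 2 the main term of the level size exceeds the possible
  deviation.\<close>

lemma level_nonempty:
  assumes X: "vec.subspace X" "nondegenerate_on \<beta> X" "vec.dim X \<ge> 2" and a: "a \<noteq> 0"
  shows "level X a \<noteq> {}"
proof
  assume "level X a = {}"
  then have "int CARD('a) ^ (vec.dim X - 1) \<le> int CARD('a) ^ ((vec.dim X - 1) div 2)"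
    using card_level[OF X(1,2) refl, of a] X(3) a by (simp add: level_error_def)
  then have "vec.dim X - 1 \<le> (vec.dim X - 1) div 2"
    using one_less_CARD_field[where 'a='a] power_increasing_iff[of "int CARD('a)"] by simp
  then show False using X(3) by simp
qed

text \<open>All but one vector of an orthogonal basis are arbitrary. As \<open>r\<close> is below
  the full dimension, their complement has dimension at least 2 and takes every nonzero value, so
  the last vector can make the Gram determinant equal to a prescribed square or nonsquare
  \<open>a\<close>.\<close>

lemma discriminant_type_exists:
  assumes 2: "(2 :: 'a) \<noteq> 0" and r: "1 \<le> r" "r < CARD('d)"
  obtains U where "vec.subspace U" "vec.dim U = r" "nondegenerate_on \<beta> U" "has_discriminant_type Q U \<sigma>"
proof -
  have "r - 1 \<le> CARD('d)" using r by simp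
  then obtain bs where bs: "orthogonal_list bs" "length bs = r - 1"
    using orthogonal_list_exists[OF 2] by blast
  note Y = orthogonal_list_extend[OF 2 bs(1)]
  let ?Y = "orth UNIV (vec.span (set bs))"
  have dY: "vec.dim ?Y \<ge> 2" using Y(3) bs(2) r by linarith
  define D where "D = (\<Prod>b\<leftarrow>bs. 2 * Q b)"
  have D: "D \<noteq> 0" using bs(1) 2 by (auto simp: D_def orthogonal_list_def prod_list_zero_iff)
  have "(\<lambda>z :: 'a. z\<^sup>2) 1 = (\<lambda>z. z\<^sup>2) (- 1)" "(1 :: 'a) \<noteq> - 1"
    using 2 by (simp_all add: eq_neg_iff_add_eq_0)
  then obtain s :: 'a where s: "\<forall>z. z\<^sup>2 \<noteq> s" using not_surj_of_collision[of "\<lambda>z :: 'a. z\<^sup>2"] by blast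
  define a where "a = (case \<sigma> of Plus \<Rightarrow> 1 | Minus \<Rightarrow> s)"
  have a: "a \<noteq> 0" using spec[OF s, of 0] by (auto simp: a_def split: space_sign.splits)
  have "a / (2 * D) \<noteq> 0" using a 2 D by simp
  then have "level ?Y (a / (2 * D)) \<noteq> {}" by (rule level_nonempty[OF Y(1,2) dY])
  then obtain u where u: "u \<in> ?Y" "Q u = a / (2 * D)" unfolding level_def by blast
  then have ub: "orthogonal_list (u # bs)" using a 2 D by (intro Y(4)) auto
  note S = orthogonal_list_span[OF 2 ub]
  let ?U = "vec.span (set (u # bs))"
  have "Determinant.det (gram_matrix Q (u # bs)) = a"
    using det_gram_orthogonal_list[OF ub] u(2) 2 D by (simp add: D_def[symmetric])
  moreover have "is_basis_list (u # bs) ?U" using S by (simp add: is_basis_list_def)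
  moreover have "case \<sigma> of Plus \<Rightarrow> \<exists>z. a = z\<^sup>2 | Minus \<Rightarrow> \<nexists>z. a = z\<^sup>2"
    using s by (auto simp: a_def intro!: exI[of _ 1] split: space_sign.splits)
  ultimately have "has_discriminant_type Q ?U \<sigma>" unfolding has_discriminant_type_def by metis
  then show ?thesis using that[of ?U] S bs(2) r by simp
qed

end

section \<open>Proportions in orthogonal spaces\<close>

lemma two_neq_zero_of_odd_card:
  assumes "odd CARD('a::{field,finite})"
  shows "(2 :: 'a) \<noteq> 0"
proof
  assume "(2 :: 'a) = 0"
  then have "CHAR('a) dvd 2" using of_nat_eq_0_iff_char_dvd[of 2, where 'a='a] by simp
  moreover have prime: "prime CHAR('a)" by (simp add: prime_CHAR_semidom finite_imp_CHAR_pos)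
  ultimately have "CHAR('a) = 2" using primes_dvd_imp_eq two_is_prime_nat by blast
  then show False using CHAR_dvd_CARD[where 'a='a] assms by simp
qed

text \<open>\<open>\<delta>\<close> accounts for the zero vector in the singular level. The general
  argument leads to the quotient \<open>q\<^sup>2 / (q - 1)\<^sup>2\<close>, at most 9/4 for
  \<open>q \<ge> 3\<close>. The three small cases lead to \<open>2 * q / (q - 1)\<close> (at most
  5/2 for \<open>q \<ge> 5\<close>), \<open>(q + 1) / (q - 1)\<close> (at most 2) and
  \<open>2 * q * (q + 1) / (q\<^sup>2 + 1)\<close> (at most 12/5). All of these are below
  43/16.\<close>

lemma orthogonal_estimate:
  fixes q t T E E' \<delta> :: real and l m :: nat
  assumes q: "q \<ge> 3" and l: "1 \<le> l" "l \<le> m" and ex: "m = 1 \<Longrightarrow> q \<ge> 5" and t0: "t \<ge> 0"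
    and t: "t + \<delta> \<le> q ^ (m - 1) + E" and T: "q ^ (l + m - 1) - E' \<le> T + \<delta>"
    and cases: "\<delta> = 0 \<and> E = q ^ ((m - 1) div 2) \<and> E' = q ^ ((l + m - 1) div 2) \<or>
      \<delta> = 1 \<and> l \<ge> 2 \<and> E = (if odd m then 0 else (q - 1) * q ^ ((m - 1) div 2)) \<and>
      E' = (if odd (l + m) then 0 else (q - 1) * q ^ ((l + m - 1) div 2))"
  shows "q * t * (q ^ l - 1) \<le> 43 / 16 * (q - 1) * T"
proof -
  have pw: "q ^ i \<le> q ^ j" if "i \<le> j" for i j using q that by (simp add: power_increasing)
  have pos: "q ^ i > 0" for i using q by simp
  have ql: "q ^ l \<ge> 1" using q by (simp add: one_le_power)
  \<comment> \<open>This covers all dimensions in which the deviations are at most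
    \<open>q ^ (m - 2)\<close> in \<open>U'\<close> and \<open>q ^ (l + m - 3)\<close> in the whole
    space; exactly three small configurations escape it.\<close>
  have main: ?thesis
    if m: "m \<ge> 2" and t: "t \<le> q ^ (m - 1) + q ^ (m - 2)" and T: "q ^ (l + m - 1) - q ^ (l + m - 3) \<le> T"
  proof -
    define r where "r = q ^ (l + m - 3)"
    have r: "r > 0" unfolding r_def by (rule pos)
    have m1: "q ^ (m - 1) = q ^ (m - 2) * q" using m power_minus_mult[of "m - 1" q] by (simp add: numeral_eq_Suc)
    have "q ^ (m - 2) * q ^ l = q ^ (l + m - 3 + 1)" unfolding power_add[symmetric] using m l by (intro arg_cong[where f = "(^) q"]) simp
    then have rq: "q ^ (m - 2) * q ^ l = r * q" by (simp add: r_def)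
    have "q ^ (l + m - 1) = q ^ (l + m - 3 + 2)" using m l by (intro arg_cong[where f = "(^) q"]) simp
    then have T': "r * (q\<^sup>2 - 1) \<le> T" using T by (simp add: r_def power_add power2_eq_square algebra_simps)
    have "q * t * (q ^ l - 1) \<le> q * (q ^ (m - 1) + q ^ (m - 2)) * q ^ l"
      using t t0 q ql by (intro mult_mono) auto
    also have "\<dots> = q * (q + 1) * (q ^ (m - 2) * q ^ l)" unfolding m1 by (simp add: algebra_simps)
    also have "\<dots> = r * (q + 1) * q\<^sup>2" unfolding rq by (simp add: power2_eq_square)
    also have "\<dots> \<le> r * (q + 1) * (43 / 16 * (q - 1)\<^sup>2)"
    proof (rule mult_left_mono)
      have "0 \<le> (q - 3) * (27 * q - 5) + 28" using q by (intro add_nonneg_nonneg mult_nonneg_nonneg) auto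
      then show "q\<^sup>2 \<le> 43 / 16 * (q - 1)\<^sup>2" by (simp add: power2_eq_square algebra_simps)
    qed (use r q in simp)
    also have "\<dots> = 43 / 16 * (q - 1) * (r * (q\<^sup>2 - 1))" by (simp add: power2_eq_square algebra_simps)
    also have "\<dots> \<le> 43 / 16 * (q - 1) * T" using T' q by (intro mult_left_mono) auto
    finally show ?thesis .
  qed
  consider "m = 1" "l = 1" "\<delta> = 0" | "m = 2" "l = 1" "\<delta> = 0" | "m = 2" "l = 2" "\<delta> = 1"
    | "l + m \<ge> 4" "\<delta> = 0" | "l + m \<ge> 5" "\<delta> = 1"
  proof (cases "\<delta> = 0")
    case True
    have "l + m \<ge> 4 \<or> m = 1 \<and> l = 1 \<or> m = 2 \<and> l = 1" using l by arith
    then show ?thesis using that True by blast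
  next
    case False
    then have "\<delta> = 1" "l \<ge> 2" using cases by blast+
    moreover from this have "l + m \<ge> 5 \<or> m = 2 \<and> l = 2" using l by arith
    ultimately show ?thesis using that by blast
  qed
  then show ?thesis
  proof cases
    case 1
    then have "t \<le> 2" "q - 1 \<le> T" using t T cases by auto
    have "q * t * (q ^ l - 1) \<le> q * 2 * (q - 1)"
      using \<open>t \<le> 2\<close> t0 q 1 by (intro mult_mono) auto
    also have "\<dots> \<le> 43 / 16 * (q - 1) * (q - 1)" using ex[OF 1(1)] by (simp add: mult_right_mono)
    also have "\<dots> \<le> 43 / 16 * (q - 1) * T" using \<open>q - 1 \<le> T\<close> q by (intro mult_left_mono) auto
    finally show ?thesis .
  next
    case 2
    then have tT: "t \<le> q + 1" "q * q - q \<le> T" using t T cases by (auto simp: power2_eq_square)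
    have "q * t * (q ^ l - 1) \<le> q * (q + 1) * (q - 1)"
      using tT t0 q 2 by (intro mult_mono) auto
    also have "\<dots> = (q - 1) * q * (q + 1)" by simp
    also have "\<dots> \<le> (q - 1) * q * (43 / 16 * (q - 1))" using q by (intro mult_left_mono) auto
    also have "\<dots> = 43 / 16 * (q - 1) * (q * q - q)" by (simp add: algebra_simps)
    also have "\<dots> \<le> 43 / 16 * (q - 1) * T" using tT q by (intro mult_left_mono) auto
    finally show ?thesis .
  next
    case 3
    then have E: "E = q - 1" "E' = (q - 1) * q" using cases by auto
    have "t \<le> 2 * (q - 1)" using t 3 E by simp
    have "(q - 1) * (q * q + 1) \<le> T" using T 3 E by (simp add: power3_eq_cube algebra_simps)
    have "q * t * (q ^ l - 1) \<le> q * (2 * (q - 1)) * (q ^ l - 1)"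
      using \<open>t \<le> 2 * (q - 1)\<close> q ql by (intro mult_right_mono mult_left_mono) auto
    also have "\<dots> = (q - 1) * (q - 1) * (2 * q * (q + 1))" using 3 by (simp add: power2_eq_square algebra_simps)
    also have "\<dots> \<le> (q - 1) * (q - 1) * (43 / 16 * (q * q + 1))"
    proof (intro mult_left_mono)
      have "0 \<le> (q - 3) * (11 * q + 1) + 46" using q by (intro add_nonneg_nonneg mult_nonneg_nonneg) auto
      then show "2 * q * (q + 1) \<le> 43 / 16 * (q * q + 1)" by (simp add: algebra_simps)
    qed (use q in simp)
    also have "\<dots> = 43 / 16 * (q - 1) * ((q - 1) * (q * q + 1))" by (simp only: mult_ac)
    also have "\<dots> \<le> 43 / 16 * (q - 1) * T"
      using \<open>(q - 1) * (q * q + 1) \<le> T\<close> q by (intro mult_left_mono) auto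
    finally show ?thesis .
  next
    case 4
    have "E \<le> q ^ (m - 2)" using cases 4 l by (auto intro!: pw)
    moreover have "E' \<le> q ^ (l + m - 3)" using cases 4 by (auto intro!: pw)
    ultimately show ?thesis using t T 4 l by (intro main) linarith+
  next
    case 5
    then have E: "E = (if odd m then 0 else (q - 1) * q ^ ((m - 1) div 2))"
      "E' = (if odd (l + m) then 0 else (q - 1) * q ^ ((l + m - 1) div 2))" using cases by auto
    \<comment> \<open>The summand 1 is the zero vector; it fits because
      \<open>(q - 1) * q ^ k + 1 \<le> q ^ (k + 1)\<close>.\<close>
    have bd: "(if odd i then 0 else (q - 1) * q ^ ((i - 1) div 2)) + 1 \<le> q ^ j"
      if "odd i \<or> (i - 1) div 2 + 1 \<le> j" for i j
    proof (cases "odd i")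
      case True
      then show ?thesis using q by (simp add: one_le_power)
    next
      case False
      let ?k = "(i - 1) div 2"
      have "1 \<le> q ^ ?k" using q by (simp add: one_le_power)
      then have "(q - 1) * q ^ ?k + 1 \<le> q ^ (?k + 1)" by (simp add: algebra_simps)
      also have "\<dots> \<le> q ^ j" using that False by (intro pw) auto
      finally show ?thesis using False by simp
    qed
    have "E + 1 \<le> q ^ (m - 2)"
      unfolding E by (rule bd) (use 5 l in \<open>cases "m = 3"; auto\<close>)
    moreover have "E' + 1 \<le> q ^ (l + m - 3)"
      unfolding E by (rule bd) (use 5 in \<open>cases "l + m = 5"; auto\<close>)
    ultimately show ?thesis using t T 5 l by (intro main) linarith+
  qed
qed

context quadratic_space
begin

lemma nondegenerate_subspaces_of_type_nonempty:
  assumes n: "n \<ge> 1" "n' \<ge> 1" "CARD('d) = n + n'" and odd: "odd n \<or> odd n' \<longrightarrow> odd CARD('a)"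
  shows "nondegenerate_subspaces_of_type Q n \<sigma> \<noteq> {}"
proof -
  have dim: "vec.dim (UNIV :: ('a ^ 'd) set) = n + n'" using vec_dim_card[where 'a='a and 'n='d] n by simp
  have perp: "vec.dim U + vec.dim (perp Q U) = n + n'" "nondegenerate_on \<beta> (perp Q U)"
    if "vec.subspace U" "nondegenerate_on \<beta> U" for U
    using dim_orth[OF vec.subspace_UNIV that(1) _ that(2)] nondegenerate_orth[OF vec.subspace_UNIV nondeg that(1) _ that(2)] dim
    by (simp_all add: perp_eq_orth)
  have intro: ?thesis if "vec.subspace U" "vec.dim U = n" "nondegenerate_on \<beta> U" "has_subspace_type Q U \<sigma>" for U
  proof -
    have "U \<in> nondegenerate_subspaces_of_type Q n \<sigma>"
      using that by (simp add: nondegenerate_subspaces_of_type_def nondegenerate_quadratic_on_iff)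
    then show ?thesis by blast
  qed
  consider "even n" | "odd n" "even n'" | "odd n" "odd n'" by blast
  then show ?thesis
  proof cases
    case 1
    then obtain U where "vec.subspace U" "vec.dim U = n" "nondegenerate_on \<beta> U" "has_isometry_type Q U \<sigma>"
      by (rule even_subspace_of_type_exists) (use n in auto)
    then show ?thesis using 1 by (intro intro[of U]) (simp_all add: has_subspace_type_def)
  next
    \<comment> \<open>The type of an odd-dimensional subspace is here that of its even-dimensional
      complement, so the complement is chosen instead; taking \<open>perp\<close> twice returns
      it.\<close>
    case 2
    obtain W where W: "vec.subspace W" "vec.dim W = n'" "nondegenerate_on \<beta> W" "has_isometry_type Q W \<sigma>"
      by (rule even_subspace_of_type_exists[OF 2(2)]) (use n in auto)
    let ?U = "perp Q W"
    note U = perp[OF W(1,3)]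
    have "W \<subseteq> perp Q ?U" using polar_commute by (fastforce simp: perp_def)
    moreover have "vec.dim (perp Q ?U) = n'" using perp(1)[OF subspace_perp U(2)] U(1) W(2) by linarith
    ultimately have "W = perp Q ?U"
      using W by (intro vec.subspace_dim_equal subspace_perp) auto
    then show ?thesis
      using U W 2 subspace_perp by (intro intro[of ?U]) (simp_all add: has_subspace_type_def)
  next
    case 3
    then have "(2 :: 'a) \<noteq> 0" using odd two_neq_zero_of_odd_card by blast
    then obtain U where U: "vec.subspace U" "vec.dim U = n" "nondegenerate_on \<beta> U" "has_discriminant_type Q U \<sigma>"
      by (rule discriminant_type_exists[of n]) (use n in auto)
    moreover have "vec.dim (perp Q U) = n'" using perp(1)[OF U(1,3)] U(2) by linarith
    ultimately show ?thesis using 3 by (intro intro[of U]) (simp_all add: has_subspace_type_def)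
  qed
qed

lemma orthogonal_intersecting_le:
  assumes lm: "1 \<le> l" "l \<le> m" "l + m = CARD('d)" and q: "CARD('a) \<ge> 3" "m = 1 \<longrightarrow> CARD('a) \<ge> 5"
  shows "real CARD('a) * real (card {(U, U'). (U, U') \<in> nondegenerate_subspaces_of_type Q l \<sigma> \<times>
      nondegenerate_subspaces_of_type Q m \<sigma>' \<and> U \<inter> U' \<noteq> {0}})
    \<le> 43 / 16 * real (card (nondegenerate_subspaces_of_type Q l \<sigma>)) * real (card (nondegenerate_subspaces_of_type Q m \<sigma>'))"
    (is "_ * real (card {(U, U'). (U, U') \<in> ?S \<times> ?S' \<and> _}) \<le> _")
proof (rule card_intersecting_pairs_le[where f = Q and l = l])
  have D: "vec.subspace U" "vec.dim U = i" "nondegenerate_on \<beta> U"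
    if "U \<in> nondegenerate_subspaces_of_type Q i \<tau>" for U i \<tau>
    using that by (auto simp: nondegenerate_subspaces_of_type_def nondegenerate_quadratic_on_iff)
  show "vec.subspace U \<and> vec.dim U = l" if "U \<in> ?S" for U using D[OF that] by blast
  show "vec.subspace U" if "U \<in> ?S'" for U using D[OF that] by blast
  fix x y :: "'a ^ 'd" assume "x \<noteq> 0" "y \<noteq> 0" "Q x = Q y"
  then obtain g where g: "quadratic_isometry g" "g x = y" by (rule quadratic_isometry_transitive[OF q(1)])
  then show "\<exists>g. inj g \<and> g x = y \<and> (\<forall>U\<in>?S'. g ` U \<in> ?S')"
    using image_of_type[OF g(1)] by (intro exI[of _ g]) (auto simp: quadratic_isometry_def isometry_def)
next
  fix U U' x assume U: "U \<in> ?S" and U': "U' \<in> ?S'" and x: "x \<in> U" "x \<noteq> 0"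
  have D: "vec.subspace U" "vec.dim U = l" "nondegenerate_on \<beta> U"
    and D': "vec.subspace U'" "vec.dim U' = m" "nondegenerate_on \<beta> U'"
    using U U' by (auto simp: nondegenerate_subspaces_of_type_def nondegenerate_quadratic_on_iff)
  have l2: "l \<ge> 2" if "Q x = 0"
    using form_nonzero_of_dim_1[OF D(1) _ D(3) x] D(2) that lm(1) by (cases "l = 1") (auto simp: polar_self)
  define \<delta> where "\<delta> = (if Q x = 0 then 1 else 0 :: real)"
  have m1: "m \<ge> 1" using lm by simp
  have bU: "\<bar>real (card {y \<in> U'. y \<noteq> 0 \<and> Q y = Q x}) + \<delta> - real CARD('a) ^ (m - 1)\<bar>
      \<le> real_of_int (level_error m (Q x))"
    unfolding \<delta>_def by (rule card_level_nonzero[OF D'(1,3,2) m1])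
  have "vec.dim (UNIV :: ('a ^ 'd) set) = l + m" using vec_dim_card[where 'a='a and 'n='d] lm by simp
  then have bV: "\<bar>real (card {y \<in> UNIV. y \<noteq> 0 \<and> Q y = Q x}) + \<delta> - real CARD('a) ^ (l + m - 1)\<bar>
      \<le> real_of_int (level_error (l + m) (Q x))"
    unfolding \<delta>_def using lm by (intro card_level_nonzero[OF vec.subspace_UNIV nondeg]) auto
  have "real CARD('a) * real (card {y \<in> U'. y \<noteq> 0 \<and> Q y = Q x}) * (real CARD('a) ^ l - 1)
      \<le> 43 / 16 * (real CARD('a) - 1) * real (card {y \<in> UNIV. y \<noteq> 0 \<and> Q y = Q x})"
  proof (rule orthogonal_estimate[where \<delta> = \<delta> and E = "real_of_int (level_error m (Q x))"
        and E' = "real_of_int (level_error (l + m) (Q x))"])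
    show "\<delta> = 0 \<and> real_of_int (level_error m (Q x)) = real CARD('a) ^ ((m - 1) div 2) \<and>
          real_of_int (level_error (l + m) (Q x)) = real CARD('a) ^ ((l + m - 1) div 2) \<or>
        \<delta> = 1 \<and> l \<ge> 2 \<and>
          real_of_int (level_error m (Q x)) = (if odd m then 0 else (real CARD('a) - 1) * real CARD('a) ^ ((m - 1) div 2)) \<and>
          real_of_int (level_error (l + m) (Q x)) =
            (if odd (l + m) then 0 else (real CARD('a) - 1) * real CARD('a) ^ ((l + m - 1) div 2))"
      using l2 by (simp add: \<delta>_def level_error_def)
    show "real (card {y \<in> U'. y \<noteq> 0 \<and> Q y = Q x}) + \<delta> \<le> real CARD('a) ^ (m - 1) + real_of_int (level_error m (Q x))"
      using bU by linarith
    show "real CARD('a) ^ (l + m - 1) - real_of_int (level_error (l + m) (Q x))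
        \<le> real (card {y \<in> UNIV. y \<noteq> 0 \<and> Q y = Q x}) + \<delta>"
      using bV by linarith
  qed (use q lm in auto)
  then show "real CARD('a) * real (card {y \<in> U'. y \<noteq> 0 \<and> Q y = Q x}) * (real CARD('a) ^ l - 1)
      \<le> 43 / 16 * (real CARD('a) - 1) * real (card {y. y \<noteq> 0 \<and> Q y = Q x})" by simp
qed (use lm in simp)

end

section \<open>Assembling the three cases\<close>

lemma card_intersecting_swap:
  "card {(U, U'). (U, U') \<in> S \<times> S' \<and> U \<inter> U' \<noteq> {0}} = card {(U, U'). (U, U') \<in> S' \<times> S \<and> U \<inter> U' \<noteq> {0}}"
    (is "card ?A = card ?B")
proof -
  have "?A = prod.swap ` ?B" by (force simp: Int_commute)
  then show ?thesis using card_image[of prod.swap ?B] by simp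
qed

text \<open>The count of intersecting pairs is symmetric, so the smaller dimension may come first.
  \<open>P\<close> carries the restriction on the field that applies when the larger dimension is 1,
  and the second argument of \<open>S\<close> carries the subspace type.\<close>

lemma intersecting_le_symmetric:
  fixes S :: "nat \<Rightarrow> 'b \<Rightarrow> ('a::{field,finite} ^ 'd) set set"
  assumes "\<And>l m \<sigma> \<tau>. 1 \<le> l \<Longrightarrow> l \<le> m \<Longrightarrow> l + m = n + n' \<Longrightarrow> P m \<Longrightarrow>
      F * real (card {(U, U'). (U, U') \<in> S l \<sigma> \<times> S m \<tau> \<and> U \<inter> U' \<noteq> {0}})
        \<le> c * real (card (S l \<sigma>)) * real (card (S m \<tau>))"
    and "1 \<le> n" "1 \<le> n'" "P (max n n')"
  shows "F * real (card {(U, U'). (U, U') \<in> S n \<sigma> \<times> S n' \<tau> \<and> U \<inter> U' \<noteq> {0}})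
    \<le> c * real (card (S n \<sigma>)) * real (card (S n' \<tau>))"
proof (cases "n \<le> n'")
  case True
  then show ?thesis using assms by (simp add: max_def)
next
  case False
  then show ?thesis
    using assms(1)[of n' n \<tau> \<sigma>] assms(2-4) card_intersecting_swap[of "S n \<sigma>" "S n' \<tau>"]
    by (simp add: max_def mult_ac add.commute)
qed

lemma proportion_of_complements:
  fixes S S' :: "('a::{field,finite} ^ 'd) set set"
  assumes S: "\<And>U. U \<in> S \<Longrightarrow> vec.subspace U \<and> vec.dim U = n"
    and S': "\<And>U. U \<in> S' \<Longrightarrow> vec.subspace U \<and> vec.dim U = n'"
    and dim: "CARD('d) = n + n'" and ne: "S \<noteq> {}" "S' \<noteq> {}" and c: "c < real CARD('a)"
    and bad: "real CARD('a) * real (card {(U, U'). (U, U') \<in> S \<times> S' \<and> U \<inter> U' \<noteq> {0}})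
      \<le> c * real (card S) * real (card S')"
  shows "let proportion = real (card {(U, U'). (U, U') \<in> S \<times> S' \<and> U + U' = UNIV}) / real (card (S \<times> S'))
    in proportion > 0 \<and> proportion \<ge> 1 - c / real CARD('a)"
proof (rule proportion_bound)
  have "{(U, U'). (U, U') \<in> S \<times> S' \<and> U + U' \<noteq> UNIV} = {(U, U'). (U, U') \<in> S \<times> S' \<and> U \<inter> U' \<noteq> {0}}"
    using S S' dim set_sum_UNIV_iff by fastforce
  then show "real CARD('a) * real (card {(U, U'). (U, U') \<in> S \<times> S' \<and> U + U' \<noteq> UNIV})
      \<le> c * real (card S) * real (card S')" using bad by simp
qed (use ne c in simp_all)

theorem theorem1p1:
  fixes n n' q :: nat
    and B :: "'a::{field,finite} ^ 'd \<Rightarrow> 'a ^ 'd \<Rightarrow> 'a"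
    and Q :: "'a ^ 'd \<Rightarrow> 'a"
    and \<sigma> \<sigma>' :: space_sign
    and \<U> \<U>' :: "('a ^ 'd) set set"
    and c :: real
  assumes "n \<ge> 1" and "n' \<ge> 1" and "primepow q" and "CARD('d) = n + n'"
    and cases:
      "(\<comment> \<open>unitary\<close>
        CARD('a) = q\<^sup>2 \<and> hermitian_form q B \<and> nondegenerate_on B UNIV \<and>
        q \<ge> 2 \<and> (n, n', q) \<noteq> (1, 1, 2) \<and> c = 9 / 5 \<and>
        \<U> = nondegenerate_subspaces B n \<and>
        \<U>' = nondegenerate_subspaces B n')
       \<or>
       (\<comment> \<open>symplectic\<close>
        CARD('a) = q \<and> alternating_form B \<and> nondegenerate_on B UNIV \<and>
        q \<ge> 2 \<and> n \<ge> 2 \<and> n' \<ge> 2 \<and> even n \<and> even n' \<and> c = 5 / 3 \<and>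
        \<U> = nondegenerate_subspaces B n \<and>
        \<U>' = nondegenerate_subspaces B n')
       \<or>
       (\<comment> \<open>orthogonal\<close>
        CARD('a) = q \<and> quadratic_form Q \<and> nondegenerate_quadratic_on Q UNIV \<and>
        q \<ge> 3 \<and> (n, n', q) \<noteq> (1, 1, 3) \<and> (odd n \<or> odd n' \<longrightarrow> odd q) \<and> c = 43 / 16 \<and>
        \<U> = nondegenerate_subspaces_of_type Q n \<sigma> \<and>
        \<U>' = nondegenerate_subspaces_of_type Q n' \<sigma>')"
  shows
    "let proportion = real (card {(U, U'). (U, U') \<in> \<U> \<times> \<U>' \<and> U + U' = UNIV}) /
                      real (card (\<U> \<times> \<U>'))
     in proportion > 0 \<and> proportion \<ge> 1 - c / real CARD('a)"
  using cases
proof (elim disjE, goal_cases)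
  case A: 1
  interpret hermitian_space B q using A \<open>primepow q\<close> by (intro hermitian_spaceI) auto
  have UU: "\<U> = nondegenerate_subspaces B n" "\<U>' = nondegenerate_subspaces B n'" "c = 9 / 5" using A by auto
  have "2 * 2 \<le> q * q" using A by (intro mult_le_mono) auto
  then have "CARD('a) \<ge> 4" using A by (simp add: power2_eq_square)
  then have "9 / 5 < real CARD('a)" by linarith
  moreover have "real CARD('a) * real (card {(U, U'). (U, U') \<in> nondegenerate_subspaces B n \<times> nondegenerate_subspaces B n' \<and> U \<inter> U' \<noteq> {0}})
      \<le> 9 / 5 * real (card (nondegenerate_subspaces B n)) * real (card (nondegenerate_subspaces B n'))"
    by (rule intersecting_le_symmetric[where S = "\<lambda>i (_ :: unit). nondegenerate_subspaces B i" and P = "\<lambda>m. m = 1 \<longrightarrow> q \<ge> 3"],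
        rule unitary_intersecting_le) (use A assms(1,2,4) in \<open>auto simp: max_def split: if_splits\<close>)
  moreover have "nondegenerate_subspaces B n \<noteq> {}" "nondegenerate_subspaces B n' \<noteq> {}"
    using assms(4) by (auto intro!: nondegenerate_subspace_exists)
  ultimately show ?thesis
    unfolding UU by (intro proportion_of_complements[OF _ _ assms(4)]) (simp_all add: nondegenerate_subspaces_def)
next
  case A: 2
  have UU: "\<U> = nondegenerate_subspaces B n" "\<U>' = nondegenerate_subspaces B n'" "c = 5 / 3" using A by auto
  have "5 / 3 < real CARD('a)" using A by simp
  moreover have "nondegenerate_subspaces B n \<noteq> {}" "nondegenerate_subspaces B n' \<noteq> {}"
    using A assms(4) symplectic_proportion(1)[of B n n'] symplectic_proportion(1)[of B n' n] by (simp_all add: add.commute)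
  ultimately show ?thesis
    unfolding UU using A assms(4) symplectic_proportion(2)[of B n n']
    by (intro proportion_of_complements[OF _ _ assms(4)]) (simp_all add: nondegenerate_subspaces_def)
next
  case A: 3
  interpret quadratic_space Q using A by unfold_locales (auto simp: nondegenerate_quadratic_on_def)
  have UU: "\<U> = nondegenerate_subspaces_of_type Q n \<sigma>" "\<U>' = nondegenerate_subspaces_of_type Q n' \<sigma>'" "c = 43 / 16"
    using A by auto
  \<comment> \<open>For \<open>n = n' = 1\<close> the order of the field is odd and different from
    3. Over three elements a hyperbolic plane has a single nonsingular point of each type, so for
    equal types the proportion would be 0.\<close>
  have q5: "max n n' = 1 \<longrightarrow> CARD('a) \<ge> 5"
  proof
    assume "max n n' = 1"
    then have "n = 1" "n' = 1" using assms(1,2) by auto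
    then have "odd q" "q \<noteq> 3" "q \<ge> 3" using A by auto
    then have "q \<noteq> 4" by auto
    then show "CARD('a) \<ge> 5" using \<open>q \<noteq> 3\<close> \<open>q \<ge> 3\<close> A by linarith
  qed
  have "43 / 16 < real CARD('a)" using A by simp
  moreover have "real CARD('a) * real (card {(U, U'). (U, U') \<in> nondegenerate_subspaces_of_type Q n \<sigma> \<times>
        nondegenerate_subspaces_of_type Q n' \<sigma>' \<and> U \<inter> U' \<noteq> {0}})
      \<le> 43 / 16 * real (card (nondegenerate_subspaces_of_type Q n \<sigma>)) * real (card (nondegenerate_subspaces_of_type Q n' \<sigma>'))"
    by (rule intersecting_le_symmetric[where S = "nondegenerate_subspaces_of_type Q" and P = "\<lambda>m. m = 1 \<longrightarrow> CARD('a) \<ge> 5"],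
        rule orthogonal_intersecting_le) (use A assms(1,2,4) q5 in auto)
  moreover have "nondegenerate_subspaces_of_type Q n \<sigma> \<noteq> {}" "nondegenerate_subspaces_of_type Q n' \<sigma>' \<noteq> {}"
    using A assms(1,2,4) nondegenerate_subspaces_of_type_nonempty[of n n' \<sigma>] nondegenerate_subspaces_of_type_nonempty[of n' n \<sigma>']
    by (simp_all add: add.commute disj_commute)
  ultimately show ?thesis
    unfolding UU by (intro proportion_of_complements[OF _ _ assms(4)]) (simp_all add: nondegenerate_subspaces_of_type_def)
qed

end
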